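(* Let $(M,\Pi)$ be a Poisson manifold. If $\varphi\colon(M,\Pi)\to(M,\Pi)$ is a Hameomorphism, then $\varphi$ maps each symplectic leaf of $(M,\Pi)$ to itself.
   Context: A Poisson manifold $(M,\Pi)$ is a smooth, possibly non-compact, manifold with a bivector field $\Pi$ satisfying $[\Pi,\Pi]=0$; the Hamiltonian vector field of a (possibly time-dependent) function $H$ is $X_H=\Pi(dH,\cdot)$ and its flow is denoted $\phi^t_H$. The symplectic leaf through $p$ is the set of points reachable from $p$ by finitely many Hamiltonian flows. Maps $f_i$ $C^0$-converge to $f$ if for every compact subset $K$ of the source, $\sup_{p\in K} d(f_i(p),f(p))\to 0$, with $d$ a Riemannian distance on the target. An isotopy of homeomorphisms $\phi^t\colon M\to M$, $t\in[0,1]$, is a Hameotopy if there is a sequence of time-dependent smooth functions $H_i\in C^\infty([0,1]_t\times M)$, with supports in a compact subset of $M$ uniformly in $t$, such that the flows $\phi^t_{H_i}$ $C^0$-converge to $\phi^t$ uniformly in $t$, and $H_i(t,\cdot)$ $C^0$-converges to a continuous time-dependent function $H(t,\cdot)$. A Hameomorphism is the time-one map of a Hameotopy. *)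

theory Defs
  imports "HOL-Analysis.Analysis"
begin

section \<open>Smooth maps between normed spaces\<close>

text \<open>\<open>Ck_on k S f\<close> and \<open>smooth_on S f\<close> are only meant for open \<open>S\<close>.\<close>

primrec Ck_on ::
  "nat \<Rightarrow> 'a::real_normed_vector set \<Rightarrow> ('a \<Rightarrow> 'b::real_normed_vector) \<Rightarrow> bool" where
  "Ck_on 0 S f \<longleftrightarrow> continuous_on S f"
| "Ck_on (Suc k) S f \<longleftrightarrow> (\<forall>x\<in>S. f differentiable (at x)) \<and>
     (\<forall>v. Ck_on k S (\<lambda>x. frechet_derivative f (at x) v))"

definition smooth_on ::
  "'a::real_normed_vector set \<Rightarrow> ('a \<Rightarrow> 'b::real_normed_vector) \<Rightarrow> bool" where
  "smooth_on S f \<longleftrightarrow> (\<forall>k. Ck_on k S f)"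


section \<open>Smooth manifolds\<close>

text \<open>
  The manifold is the whole type \<open>'m\<close>, which is required to be Hausdorff and second countable
  by its type class. A chart is a pair of its domain and its coordinate map into the model space
  \<open>'e\<close>; values of the coordinate map outside the domain are irrelevant.

  The model space is a finite-dimensional normed space rather than a type of class
  \<open>euclidean_space\<close>, because the latter class excludes dimension 0. (Every finite-dimensional
  real inner product space is complete and has the Heine-Borel property, so requiring
  the classes \<open>banach\<close> and \<open>heine_borel\<close> of \<open>'e\<close> is no restriction.)
\<close>

type_synonym ('m, 'e) chart = "'m set \<times> ('m \<Rightarrow> 'e)"

abbreviation chart_dom :: "('m, 'e) chart \<Rightarrow> 'm set" where
  "chart_dom c \<equiv> fst c"

abbreviation chart_map :: "('m, 'e) chart \<Rightarrow> 'm \<Rightarrow> 'e" where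
  "chart_map c \<equiv> snd c"

abbreviation chart_img :: "('m, 'e) chart \<Rightarrow> 'e set" where
  "chart_img c \<equiv> chart_map c ` chart_dom c"

definition chart_inv :: "('m, 'e) chart \<Rightarrow> 'e \<Rightarrow> 'm" where
  "chart_inv c = inv_into (chart_dom c) (chart_map c)"

definition is_chart :: "('m::topological_space, 'e::real_normed_vector) chart \<Rightarrow> bool" where
  "is_chart c \<longleftrightarrow> open (chart_dom c) \<and> open (chart_img c) \<and>
     homeomorphism (chart_dom c) (chart_img c) (chart_map c) (chart_inv c)"

definition smooth_atlas ::
  "('m::{t2_space,second_countable_topology}, 'e::real_normed_vector) chart set \<Rightarrow> bool" where
  "smooth_atlas A \<longleftrightarrow>
     (\<exists>B :: 'e set. finite B \<and> span B = UNIV) \<and>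
     (\<forall>c\<in>A. is_chart c) \<and>
     (\<Union>c\<in>A. chart_dom c) = UNIV \<and>
     (\<forall>c\<in>A. \<forall>c'\<in>A.
        smooth_on (chart_map c ` (chart_dom c \<inter> chart_dom c')) (chart_map c' \<circ> chart_inv c))"

text \<open>The derivative at \<open>p\<close> of the change of coordinates from \<open>c\<close> to \<open>c'\<close>.\<close>

definition coord_change ::
  "('m, 'e::real_normed_vector) chart \<Rightarrow> ('m, 'e) chart \<Rightarrow> 'm \<Rightarrow> 'e \<Rightarrow> 'e" where
  "coord_change c c' p =
     frechet_derivative (chart_map c' \<circ> chart_inv c) (at (chart_map c p))"

text \<open>
  Smoothness of a function on \<open>[0,1] \<times> M\<close>; as this is a manifold with boundary, smoothness means
  that in charts the function locally extends to a smooth function on an open set.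
\<close>

definition smooth_time_dependent ::
  "('m, 'e::real_normed_vector) chart set \<Rightarrow> (real \<Rightarrow> 'm \<Rightarrow> real) \<Rightarrow> bool" where
  "smooth_time_dependent A H \<longleftrightarrow>
     (\<forall>c\<in>A. \<forall>t\<in>{0..1}. \<forall>p\<in>chart_dom c. \<exists>W F.
        open W \<and> (t, chart_map c p) \<in> W \<and> smooth_on W F \<and>
        (\<forall>(s, y) \<in> W \<inter> ({0..1} \<times> chart_img c). F (s, y) = H s (chart_inv c y)))"

text \<open>The differential at \<open>p\<close> in the chart \<open>c\<close>, as a covector on the model space.\<close>

definition chart_differential ::
  "('m, 'e::real_normed_vector) chart \<Rightarrow> ('m \<Rightarrow> real) \<Rightarrow> 'm \<Rightarrow> 'e \<Rightarrow>\<^sub>L real" where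
  "chart_differential c f p =
     Blinfun (frechet_derivative (f \<circ> chart_inv c) (at (chart_map c p)))"


section \<open>Poisson structures\<close>

text \<open>
  A tensor field is given by its components in the charts of the atlas. For a bivector field,
  \<open>P c p\<close> is the alternating bilinear form on covectors that represents, in the chart \<open>c\<close>, its
  value at \<open>p \<in> chart_dom c\<close>.
\<close>

type_synonym ('m, 'e) bivector =
  "('m, 'e) chart \<Rightarrow> 'm \<Rightarrow> ('e \<Rightarrow>\<^sub>L real) \<Rightarrow> ('e \<Rightarrow>\<^sub>L real) \<Rightarrow> real"

definition bivector_field ::
  "('m, 'e::real_normed_vector) chart set \<Rightarrow> ('m, 'e) bivector \<Rightarrow> bool" where
  "bivector_field A P \<longleftrightarrow>
     (\<forall>c\<in>A. \<forall>p\<in>chart_dom c. bilinear (P c p) \<and> (\<forall>\<alpha>. P c p \<alpha> \<alpha> = 0)) \<and>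
     (\<forall>c\<in>A. \<forall>\<alpha> \<beta>. smooth_on (chart_img c) (\<lambda>x. P c (chart_inv c x) \<alpha> \<beta>)) \<and>
     (\<forall>c\<in>A. \<forall>c'\<in>A. \<forall>p\<in>chart_dom c \<inter> chart_dom c'. \<forall>\<alpha> \<beta>.
        P c' p \<alpha> \<beta> = P c p (\<alpha> o\<^sub>L Blinfun (coord_change c c' p))
                           (\<beta> o\<^sub>L Blinfun (coord_change c c' p)))"

text \<open>
  The vector \<open>P(\<alpha>, \<cdot>)\<close> in the chart \<open>c\<close>, under the identification of the (finite-dimensional)
  model space with its bidual.
\<close>

definition contract ::
  "('m, 'e::real_normed_vector) bivector \<Rightarrow> ('m, 'e) chart \<Rightarrow> 'm \<Rightarrow> ('e \<Rightarrow>\<^sub>L real) \<Rightarrow> 'e" where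
  "contract P c p \<alpha> = (THE v. \<forall>\<beta>. blinfun_apply \<beta> v = P c p \<alpha> \<beta>)"

text \<open>
  The Schouten bracket of two bivector fields in the chart \<open>c\<close>, evaluated on constant covectors.
  In components this is the usual
  \<open>[P,Q]\<^sup>i\<^sup>j\<^sup>k = \<Sum>\<^sub>l P\<^sup>i\<^sup>l \<partial>\<^sub>l Q\<^sup>j\<^sup>k + Q\<^sup>i\<^sup>l \<partial>\<^sub>l P\<^sup>j\<^sup>k + (cyclic permutations of i, j, k)\<close>;
  other sign conventions in use differ by an overall sign.
\<close>

definition schouten_term ::
  "('m, 'e::real_normed_vector) bivector \<Rightarrow> ('m, 'e) bivector \<Rightarrow> ('m, 'e) chart \<Rightarrow> 'm \<Rightarrow>
     ('e \<Rightarrow>\<^sub>L real) \<Rightarrow> ('e \<Rightarrow>\<^sub>L real) \<Rightarrow> ('e \<Rightarrow>\<^sub>L real) \<Rightarrow> real" where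
  "schouten_term P Q c p \<alpha> \<beta> \<gamma> =
     frechet_derivative (\<lambda>x. Q c (chart_inv c x) \<beta> \<gamma>) (at (chart_map c p)) (contract P c p \<alpha>) +
     frechet_derivative (\<lambda>x. P c (chart_inv c x) \<beta> \<gamma>) (at (chart_map c p)) (contract Q c p \<alpha>)"

definition schouten_bracket ::
  "('m, 'e::real_normed_vector) bivector \<Rightarrow> ('m, 'e) bivector \<Rightarrow> ('m, 'e) chart \<Rightarrow> 'm \<Rightarrow>
     ('e \<Rightarrow>\<^sub>L real) \<Rightarrow> ('e \<Rightarrow>\<^sub>L real) \<Rightarrow> ('e \<Rightarrow>\<^sub>L real) \<Rightarrow> real" where
  "schouten_bracket P Q c p \<alpha> \<beta> \<gamma> =
     schouten_term P Q c p \<alpha> \<beta> \<gamma> + schouten_term P Q c p \<beta> \<gamma> \<alpha> + schouten_term P Q c p \<gamma> \<alpha> \<beta>"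

definition poisson_manifold ::
  "('m::{t2_space,second_countable_topology}, 'e::real_normed_vector) chart set \<Rightarrow>
     ('m, 'e) bivector \<Rightarrow> bool" where
  "poisson_manifold A P \<longleftrightarrow> smooth_atlas A \<and> bivector_field A P \<and>
     (\<forall>c\<in>A. \<forall>p\<in>chart_dom c. \<forall>\<alpha> \<beta> \<gamma>. schouten_bracket P P c p \<alpha> \<beta> \<gamma> = 0)"


section \<open>Hamiltonian flows and symplectic leaves\<close>

definition ham_vector_field ::
  "('m, 'e::real_normed_vector) bivector \<Rightarrow> ('m \<Rightarrow> real) \<Rightarrow> ('m, 'e) chart \<Rightarrow> 'm \<Rightarrow> 'e" where
  "ham_vector_field P f c p = contract P c p (chart_differential c f p)"

definition ham_integral_curve ::
  "('m::topological_space, 'e::real_normed_vector) chart set \<Rightarrow> ('m, 'e) bivector \<Rightarrow>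
     (real \<Rightarrow> 'm \<Rightarrow> real) \<Rightarrow> real set \<Rightarrow> (real \<Rightarrow> 'm) \<Rightarrow> bool" where
  "ham_integral_curve A P H J \<gamma> \<longleftrightarrow> continuous_on J \<gamma> \<and>
     (\<forall>t\<in>J. \<forall>c\<in>A. \<gamma> t \<in> chart_dom c \<longrightarrow>
        ((\<lambda>s. chart_map c (\<gamma> s)) has_vector_derivative ham_vector_field P (H t) c (\<gamma> t))
          (at t within J))"

definition ham_flow ::
  "('m::topological_space, 'e::real_normed_vector) chart set \<Rightarrow> ('m, 'e) bivector \<Rightarrow>
     (real \<Rightarrow> 'm \<Rightarrow> real) \<Rightarrow> (real \<Rightarrow> 'm \<Rightarrow> 'm) \<Rightarrow> bool" where
  "ham_flow A P H \<Phi> \<longleftrightarrow>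
     (\<forall>p. \<Phi> 0 p = p \<and> ham_integral_curve A P H {0..1} (\<lambda>t. \<Phi> t p))"

text \<open>
  \<open>q\<close> is the image of \<open>p\<close> under a single Hamiltonian flow. The flow need not be complete: it
  suffices that the integral curve starting at \<open>p\<close> exists up to time \<open>T\<close>.
\<close>

definition ham_reachable ::
  "('m::topological_space, 'e::real_normed_vector) chart set \<Rightarrow> ('m, 'e) bivector \<Rightarrow>
     'm \<Rightarrow> 'm \<Rightarrow> bool" where
  "ham_reachable A P p q \<longleftrightarrow>
     (\<exists>H T \<gamma>. smooth_time_dependent A H \<and> T \<in> {0..1} \<and>
        ham_integral_curve A P H {0..T} \<gamma> \<and> \<gamma> 0 = p \<and> \<gamma> T = q)"

definition symplectic_leaf ::
  "('m::topological_space, 'e::real_normed_vector) chart set \<Rightarrow> ('m, 'e) bivector \<Rightarrow>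
     'm \<Rightarrow> 'm set" where
  "symplectic_leaf A P p = {q. (ham_reachable A P)\<^sup>*\<^sup>* p q}"


section \<open>Riemannian distance\<close>

type_synonym ('m, 'e) metric_tensor = "('m, 'e) chart \<Rightarrow> 'm \<Rightarrow> 'e \<Rightarrow> 'e \<Rightarrow> real"

definition riemannian_metric ::
  "('m, 'e::real_normed_vector) chart set \<Rightarrow> ('m, 'e) metric_tensor \<Rightarrow> bool" where
  "riemannian_metric A g \<longleftrightarrow>
     (\<forall>c\<in>A. \<forall>p\<in>chart_dom c. bilinear (g c p) \<and>
        (\<forall>u v. g c p u v = g c p v u) \<and> (\<forall>u. u \<noteq> 0 \<longrightarrow> g c p u u > 0)) \<and>
     (\<forall>c\<in>A. \<forall>u v. smooth_on (chart_img c) (\<lambda>x. g c (chart_inv c x) u v)) \<and>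
     (\<forall>c\<in>A. \<forall>c'\<in>A. \<forall>p\<in>chart_dom c \<inter> chart_dom c'. \<forall>u v.
        g c p u v = g c' p (coord_change c c' p u) (coord_change c c' p v))"

definition C1_curve ::
  "('m::topological_space, 'e::real_normed_vector) chart set \<Rightarrow> real set \<Rightarrow> (real \<Rightarrow> 'm) \<Rightarrow> bool"
where
  "C1_curve A J \<gamma> \<longleftrightarrow> continuous_on J \<gamma> \<and>
     (\<forall>c\<in>A. \<exists>w. continuous_on {t\<in>J. \<gamma> t \<in> chart_dom c} w \<and>
        (\<forall>t\<in>J. \<gamma> t \<in> chart_dom c \<longrightarrow>
           ((\<lambda>s. chart_map c (\<gamma> s)) has_vector_derivative w t) (at t within J)))"

definition piecewise_C1_curve ::
  "('m::topological_space, 'e::real_normed_vector) chart set \<Rightarrow> (real \<Rightarrow> 'm) \<Rightarrow> bool" where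
  "piecewise_C1_curve A \<gamma> \<longleftrightarrow>
     (\<exists>n \<tau>. \<tau> 0 = 0 \<and> \<tau> n = 1 \<and>
        (\<forall>i<n. \<tau> i < \<tau> (Suc i) \<and> C1_curve A {\<tau> i..\<tau> (Suc i)} \<gamma>))"

text \<open>
  The speed does not depend on the chosen chart, wherever \<open>\<gamma>\<close> is differentiable; the finitely many
  break points of a piecewise differentiable curve do not contribute to its length.
\<close>

definition curve_speed ::
  "('m, 'e::real_normed_vector) chart set \<Rightarrow> ('m, 'e) metric_tensor \<Rightarrow>
     (real \<Rightarrow> 'm) \<Rightarrow> real \<Rightarrow> real" where
  "curve_speed A g \<gamma> t =
     (let c = (SOME c. c \<in> A \<and> \<gamma> t \<in> chart_dom c);
          v = vector_derivative (\<lambda>s. chart_map c (\<gamma> s)) (at t)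
      in sqrt (g c (\<gamma> t) v v))"

definition curve_length ::
  "('m, 'e::real_normed_vector) chart set \<Rightarrow> ('m, 'e) metric_tensor \<Rightarrow>
     (real \<Rightarrow> 'm) \<Rightarrow> ennreal" where
  "curve_length A g \<gamma> = (\<integral>\<^sup>+t\<in>{0..1}. ennreal (curve_speed A g \<gamma> t) \<partial>lborel)"

text \<open>The distance between points of different connected components is \<open>\<infinity>\<close>.\<close>

definition riemannian_dist ::
  "('m::topological_space, 'e::real_normed_vector) chart set \<Rightarrow> ('m, 'e) metric_tensor \<Rightarrow>
     'm \<Rightarrow> 'm \<Rightarrow> ennreal" where
  "riemannian_dist A g p q =
     (INF \<gamma> \<in> {\<gamma>. piecewise_C1_curve A \<gamma> \<and> \<gamma> 0 = p \<and> \<gamma> 1 = q}. curve_length A g \<gamma>)"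


section \<open>Hameomorphisms\<close>

text \<open>
  \<open>C0_converges_unif d T f h\<close>: the maps \<open>f i t\<close> converge to \<open>h t\<close> uniformly on compact subsets
  of the source, with respect to the distance \<open>d\<close> on the target, uniformly in \<open>t \<in> T\<close>.
\<close>

definition C0_converges_unif ::
  "('b \<Rightarrow> 'b \<Rightarrow> ennreal) \<Rightarrow> real set \<Rightarrow> (nat \<Rightarrow> real \<Rightarrow> 'm::topological_space \<Rightarrow> 'b) \<Rightarrow>
     (real \<Rightarrow> 'm \<Rightarrow> 'b) \<Rightarrow> bool" where
  "C0_converges_unif d T f h \<longleftrightarrow>
     (\<forall>K. compact K \<longrightarrow> (\<lambda>i. SUP t\<in>T. SUP p\<in>K. d (f i t p) (h t p)) \<longlonglongrightarrow> 0)"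

definition C0_converges ::
  "('b \<Rightarrow> 'b \<Rightarrow> ennreal) \<Rightarrow> (nat \<Rightarrow> 'm::topological_space \<Rightarrow> 'b) \<Rightarrow> ('m \<Rightarrow> 'b) \<Rightarrow> bool" where
  "C0_converges d f h \<longleftrightarrow>
     (\<forall>K. compact K \<longrightarrow> (\<lambda>i. SUP p\<in>K. d (f i p) (h p)) \<longlonglongrightarrow> 0)"

definition isotopy_of_homeomorphisms :: "(real \<Rightarrow> 'm::topological_space \<Rightarrow> 'm) \<Rightarrow> bool" where
  "isotopy_of_homeomorphisms \<phi> \<longleftrightarrow>
     continuous_on ({0..1} \<times> UNIV) (\<lambda>(t, p). \<phi> t p) \<and>
     (\<forall>t\<in>{0..1}. \<exists>\<psi>. homeomorphism UNIV UNIV (\<phi> t) \<psi>)"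

definition compactly_supported :: "(real \<Rightarrow> 'm::topological_space \<Rightarrow> real) \<Rightarrow> bool" where
  "compactly_supported H \<longleftrightarrow>
     (\<exists>K. compact K \<and> (\<forall>t\<in>{0..1}. closure {p. H t p \<noteq> 0} \<subseteq> K))"

text \<open>
  The choice of the Riemannian metric is immaterial, since convergence is only tested on compact
  sets and the limit is continuous. The convergence of the Hamiltonians is required separately at
  each time, and the compact support may depend on \<open>i\<close>.
\<close>

definition hameotopy ::
  "('m::topological_space, 'e::real_normed_vector) chart set \<Rightarrow> ('m, 'e) bivector \<Rightarrow>
     (real \<Rightarrow> 'm \<Rightarrow> 'm) \<Rightarrow> bool" where
  "hameotopy A P \<phi> \<longleftrightarrow> isotopy_of_homeomorphisms \<phi> \<and>
     (\<exists>H \<Phi> h g.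
        (\<forall>i::nat. smooth_time_dependent A (H i) \<and> compactly_supported (H i) \<and>
           ham_flow A P (H i) (\<Phi> i)) \<and>
        riemannian_metric A g \<and>
        C0_converges_unif (riemannian_dist A g) {0..1} \<Phi> \<phi> \<and>
        continuous_on ({0..1} \<times> UNIV) (\<lambda>(t, p). h t p) \<and>
        (\<forall>t\<in>{0..1}. C0_converges (\<lambda>x y. ennreal (dist x y)) (\<lambda>i. H i t) (h t)))"

definition hameomorphism ::
  "('m::topological_space, 'e::real_normed_vector) chart set \<Rightarrow> ('m, 'e) bivector \<Rightarrow>
     ('m \<Rightarrow> 'm) \<Rightarrow> bool" where
  "hameomorphism A P \<phi> \<longleftrightarrow> (\<exists>\<phi>t. hameotopy A P \<phi>t \<and> \<phi> = \<phi>t 1)"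

end

theory Submission
  imports Defs
begin

text \<open>
  Let \<open>\<phi> t\<close> be the limit of the Hamiltonian flows \<open>\<Phi> i t\<close>. It suffices that for each \<open>p\<close> and \<open>t0\<close> the
  points \<open>\<phi> t p\<close> with \<open>t\<close> near \<open>t0\<close> lie on the leaf of \<open>q = \<phi> t0 p\<close>. Two facts give this. First, since
  \<open>\<phi> t0\<close> is a homeomorphism, \<open>\<Phi> i t0\<close> composed with its inverse is close to the identity near \<open>q\<close>, so
  there are points \<open>p\<^sub>i\<close> converging to \<open>p\<close> with \<open>\<Phi> i t0 p\<^sub>i = q\<close> exactly. Second, \<open>q\<close> has a coordinate
  ball in which Hamiltonian curves through \<open>q\<close> stay, as long as they remain in the ball, on a closed
  subset of the leaf of \<open>q\<close>. Hence the curves \<open>\<Phi> i t p\<^sub>i\<close>, and therefore their limit \<open>\<phi> t p\<close>, stay on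
  that set.
\<close>

section \<open>Calculus of smooth maps\<close>

text \<open>Leaves are in general neither closed nor of constant dimension, so a limit of points on
  leaves near that of \<open>q\<close> says nothing about the leaf of \<open>q\<close>. Only curves
  through \<open>q\<close> itself are under control, which is why the starting points are moved
  until the curves hit \<open>q\<close> exactly. The hitting has to come from a topological
  argument, because the flows converge without their derivatives.

  The rank of the bivector may jump up near \<open>q\<close>, so the Frobenius theorem for
  distributions of constant rank does not apply. Instead the block of the bivector that is
  nondegenerate at \<open>q\<close> is inverted near \<open>q\<close>. The Dirac bracket that
  remains vanishes at \<open>q\<close>, and by the Jacobi identity it stays zero along Hamiltonian
  curves from \<open>q\<close>. Where it vanishes, the horizontal lifts over the range of
  \<open>P q\<close> are flat, which is enough to integrate them to one plaque.

  Reachability is followed in both directions throughout: that a leaf is contained in its image uses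
  the way back from \<open>\<phi> x\<close> to \<open>x\<close>.\<close>

lemma Ck_on_subset: "Ck_on k S f \<Longrightarrow> T \<subseteq> S \<Longrightarrow> Ck_on k T f"
  by (induction k arbitrary: f) (auto intro: continuous_on_subset)

lemma Ck_on_cong:
  assumes "open S" "\<And>x. x \<in> S \<Longrightarrow> f x = g x" "Ck_on k S f"
  shows "Ck_on k S g"
  using assms(2,3)
proof (induction k arbitrary: f g)
  case 0
  then show ?case by (simp cong: continuous_on_cong)
next
  case (Suc k)
  have d: "(g has_derivative frechet_derivative f (at x)) (at x)" if "x \<in> S" for x
    using Suc.prems that \<open>open S\<close> has_derivative_transform_within_open[of f _ x UNIV S g]
    by (auto simp: frechet_derivative_works)
  have e: "frechet_derivative g (at x) = frechet_derivative f (at x)" if "x \<in> S" for x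
    using d[OF that] by (simp add: frechet_derivative_at[symmetric])
  have "Ck_on k S (\<lambda>x. frechet_derivative g (at x) v)" for v
    by (rule Suc.IH[of "\<lambda>x. frechet_derivative f (at x) v"]) (use Suc.prems e in auto)
  with d show ?case by (auto simp: differentiable_def)
qed

text \<open>On an open set derivatives are unique, so an explicit formula may replace
  \<open>frechet_derivative\<close>. Every later induction on the order of differentiability runs
  through this rule.\<close>

lemma Ck_on_SucI:
  assumes "open S" "\<And>x. x \<in> S \<Longrightarrow> (f has_derivative f' x) (at x)"
    and "\<And>v. Ck_on k S (\<lambda>x. f' x v)"
  shows "Ck_on (Suc k) S f"
proof -
  have "frechet_derivative f (at x) = f' x" if "x \<in> S" for x
    using assms(2)[OF that] by (simp add: frechet_derivative_at[symmetric])
  then have "Ck_on k S (\<lambda>x. frechet_derivative f (at x) v)" for v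
    by (intro Ck_on_cong[OF \<open>open S\<close> _ assms(3)[of v]]) simp
  then show ?thesis
    using assms(2) by (auto simp: differentiable_def)
qed

lemma Ck_on_SucD:
  assumes "Ck_on (Suc k) S f"
  shows "x \<in> S \<Longrightarrow> (f has_derivative frechet_derivative f (at x)) (at x)"
    and "Ck_on k S (\<lambda>x. frechet_derivative f (at x) v)"
  using assms by (auto simp: frechet_derivative_works)

text \<open>The recursion only speaks of derivatives of \<open>f\<close>, so lower orders have to be
  recovered by induction; at the bottom, differentiability gives continuity.\<close>

lemma Ck_on_Suc_imp: "Ck_on (Suc k) S f \<Longrightarrow> Ck_on k S f"
proof (induction k arbitrary: f)
  case 0
  then show ?case
    by (auto intro!: continuous_at_imp_continuous_on differentiable_imp_continuous_within)
next
  case (Suc k)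
  show ?case
    unfolding Ck_on.simps(2)[of k]
  proof (intro conjI allI)
    show "\<forall>x\<in>S. f differentiable (at x)"
      using Suc.prems unfolding Ck_on.simps(2)[of "Suc k"] by blast
    show "Ck_on k S (\<lambda>x. frechet_derivative f (at x) v)" for v
      using Suc.prems unfolding Ck_on.simps(2)[of "Suc k"] by (intro Suc.IH) blast
  qed
qed

lemma Ck_on_imp_continuous_on: "Ck_on k S f \<Longrightarrow> continuous_on S f"
proof (induction k)
  case 0
  then show ?case by simp
next
  case (Suc k)
  then show ?case using Ck_on_Suc_imp by blast
qed

lemma Ck_on_bounded_linear:
  assumes "bounded_linear L" "open S" "Ck_on k S f"
  shows "Ck_on k S (\<lambda>x. L (f x))"
  using assms(3)
proof (induction k arbitrary: f)
  case 0
  then show ?case using assms(1) by (simp add: bounded_linear.continuous_on)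
next
  case (Suc k)
  show ?case
    by (rule Ck_on_SucI[OF \<open>open S\<close> bounded_linear.has_derivative[OF assms(1) Ck_on_SucD(1)[OF Suc.prems]]
          Suc.IH[OF Ck_on_SucD(2)[OF Suc.prems]]])
qed

lemma Ck_on_const: "open S \<Longrightarrow> Ck_on k S (\<lambda>x. c)"
proof (induction k arbitrary: c)
  case 0
  then show ?case by simp
next
  case (Suc k)
  show ?case
    by (rule Ck_on_SucI[of _ _ "\<lambda>x v. 0"]) (use Suc in auto)
qed

lemma Ck_on_id: "open S \<Longrightarrow> Ck_on k S (\<lambda>x. x)"
proof (induction k)
  case 0
  then show ?case by simp
next
  case (Suc k)
  show ?case
    by (rule Ck_on_SucI[of _ _ "\<lambda>x v. v"]) (use Suc in \<open>auto intro: Ck_on_const\<close>)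
qed

lemma Ck_on_add:
  assumes "open S" "Ck_on k S f" "Ck_on k S g"
  shows "Ck_on k S (\<lambda>x. f x + g x)"
  using assms(2,3)
proof (induction k arbitrary: f g)
  case 0
  then show ?case by (simp add: continuous_on_add)
next
  case (Suc k)
  show ?case
    by (rule Ck_on_SucI[OF \<open>open S\<close> has_derivative_add[OF Ck_on_SucD(1)[OF Suc.prems(1)] Ck_on_SucD(1)[OF Suc.prems(2)]]
       Suc.IH[OF Ck_on_SucD(2)[OF Suc.prems(1)] Ck_on_SucD(2)[OF Suc.prems(2)]]])
qed

lemma Ck_on_sum:
  assumes "open S" "\<And>i. i \<in> I \<Longrightarrow> Ck_on k S (f i)"
  shows "Ck_on k S (\<lambda>x. \<Sum>i\<in>I. f i x)"
  using assms(2)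
  by (induction I rule: infinite_finite_induct) (auto intro: Ck_on_add Ck_on_const assms(1))

lemma Ck_on_bilinear:
  assumes "bounded_bilinear p" "open S" "Ck_on k S f" "Ck_on k S g"
  shows "Ck_on k S (\<lambda>x. p (f x) (g x))"
  using assms(3,4)
proof (induction k arbitrary: f g)
  case 0
  then show ?case using assms(1) by (simp add: bounded_bilinear.continuous_on)
next
  case (Suc k)
  show ?case
  proof (rule Ck_on_SucI[OF \<open>open S\<close>])
    show "((\<lambda>x. p (f x) (g x)) has_derivative
        (\<lambda>v. p (f x) (frechet_derivative g (at x) v) + p (frechet_derivative f (at x) v) (g x))) (at x)"
      if "x \<in> S" for x
      using Ck_on_SucD(1)[OF Suc.prems(1) that] Ck_on_SucD(1)[OF Suc.prems(2) that]
      by (rule bounded_bilinear.FDERIV[OF assms(1)])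
    have "Ck_on k S (\<lambda>x. p (f x) (frechet_derivative g (at x) v))"
      "Ck_on k S (\<lambda>x. p (frechet_derivative f (at x) v) (g x))" for v
      using Suc.IH[OF Ck_on_Suc_imp[OF Suc.prems(1)] Ck_on_SucD(2)[OF Suc.prems(2)]]
        Suc.IH[OF Ck_on_SucD(2)[OF Suc.prems(1)] Ck_on_Suc_imp[OF Suc.prems(2)]] .
    then show "Ck_on k S (\<lambda>x. p (f x) (frechet_derivative g (at x) v) + p (frechet_derivative f (at x) v) (g x))" for v
      by (rule Ck_on_add[OF \<open>open S\<close>])
  qed
qed

text \<open>A finite spanning set with dual coordinate functionals. No inner product enters, so that
  it covers the real line, the model space (possibly of dimension 0) and space-time alike.\<close>

definition coordinate_system :: "'a::real_normed_vector set \<Rightarrow> ('a \<Rightarrow> 'a \<Rightarrow> real) \<Rightarrow> bool" where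
  "coordinate_system B \<xi> \<longleftrightarrow>
     finite B \<and> (\<forall>b. bounded_linear (\<xi> b)) \<and> (\<forall>v. v = (\<Sum>b\<in>B. \<xi> b v *\<^sub>R b))"

lemma coordinate_system_real: "coordinate_system {1::real} (\<lambda>_ v. v)"
  by (auto simp: coordinate_system_def intro: bounded_linear_ident)

text \<open>\<open>Ck_on\<close> controls derivatives in fixed directions only, whereas the chain
  rule differentiates \<open>f\<close> in the moving direction \<open>g' x v\<close>. Expanding that
  direction in coordinates gives a finite sum of products to which the induction hypothesis
  applies.\<close>

lemma Ck_on_compose:
  fixes g :: "'a::real_normed_vector \<Rightarrow> 'b::real_normed_vector" and B :: "'b set"
  assumes coord: "coordinate_system B \<xi>" and "open S" "open T" "g ` S \<subseteq> T"
    and "Ck_on k T f" "Ck_on k S g"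
  shows "Ck_on k S (\<lambda>x. f (g x))"
  using assms(5,6)
proof (induction k arbitrary: f)
  case 0
  then show ?case using assms(4) by (auto intro: continuous_on_compose2)
next
  case (Suc k)
  let ?f = "\<lambda>y. frechet_derivative f (at y)" and ?g = "\<lambda>x. frechet_derivative g (at x)"
  have fd: "(f has_derivative ?f (g x)) (at (g x))" if "x \<in> S" for x
    using Ck_on_SucD(1)[OF Suc.prems(1)] that assms(4) by auto
  have eq: "(\<Sum>b\<in>B. \<xi> b (?g x v) *\<^sub>R ?f (g x) b) = ?f (g x) (?g x v)" if "x \<in> S" for x v
  proof -
    have lin: "linear (?f (g x))"
      using fd[OF that] by (auto dest: has_derivative_linear)
    have "?f (g x) (?g x v) = ?f (g x) (\<Sum>b\<in>B. \<xi> b (?g x v) *\<^sub>R b)"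
      using coord by (metis coordinate_system_def)
    then show ?thesis
      by (simp add: linear_sum[OF lin] linear_scale[OF lin])
  qed
  have Ckg: "Ck_on k S g"
    using Suc.prems(2) by (rule Ck_on_Suc_imp)
  have ck: "Ck_on k S (\<lambda>x. \<Sum>b\<in>B. \<xi> b (?g x v) *\<^sub>R ?f (g x) b)" for v
  proof (rule Ck_on_sum[OF \<open>open S\<close>], rule Ck_on_bilinear[OF bounded_bilinear_scaleR \<open>open S\<close>])
    fix b
    have "bounded_linear (\<xi> b)"
      using coord by (simp add: coordinate_system_def)
    then show "Ck_on k S (\<lambda>x. \<xi> b (?g x v))"
      by (rule Ck_on_bounded_linear[OF _ \<open>open S\<close> Ck_on_SucD(2)[OF Suc.prems(2)]])
    show "Ck_on k S (\<lambda>x. ?f (g x) b)"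
      by (rule Suc.IH[OF Ck_on_SucD(2)[OF Suc.prems(1)] Ckg])
  qed
  show ?case
  proof (rule Ck_on_SucI[OF \<open>open S\<close>])
    show "((\<lambda>x. f (g x)) has_derivative (\<lambda>v. ?f (g x) (?g x v))) (at x)" if "x \<in> S" for x
      using has_derivative_compose[OF Ck_on_SucD(1)[OF Suc.prems(2) that] fd[OF that]] .
    show "Ck_on k S (\<lambda>x. ?f (g x) (?g x v))" for v
      by (rule Ck_on_cong[OF \<open>open S\<close> eq ck])
  qed
qed

section \<open>Maps that are smooth of all orders, and inverses\<close>

lemma smooth_on_imp_continuous_on: "smooth_on S f \<Longrightarrow> continuous_on S f"
  using Ck_on_imp_continuous_on smooth_on_def by blast

lemma smooth_on_subset: "smooth_on S f \<Longrightarrow> T \<subseteq> S \<Longrightarrow> smooth_on T f"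
  by (auto simp: smooth_on_def intro: Ck_on_subset)

lemma smooth_on_derivative:
  assumes "smooth_on S f"
  shows "x \<in> S \<Longrightarrow> (f has_derivative frechet_derivative f (at x)) (at x)"
    and "smooth_on S (\<lambda>x. frechet_derivative f (at x) v)"
  using assms Ck_on_SucD[of _ S f] unfolding smooth_on_def by blast+

lemma smooth_on_bounded_linear: "bounded_linear L \<Longrightarrow> open S \<Longrightarrow> smooth_on S f \<Longrightarrow> smooth_on S (\<lambda>x. L (f x))"
  by (auto simp: smooth_on_def intro: Ck_on_bounded_linear)

lemma smooth_on_const: "open S \<Longrightarrow> smooth_on S (\<lambda>x. c)"
  by (auto simp: smooth_on_def intro: Ck_on_const)

lemma smooth_on_id: "open S \<Longrightarrow> smooth_on S (\<lambda>x. x)"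
  by (auto simp: smooth_on_def intro: Ck_on_id)

lemma smooth_on_add: "open S \<Longrightarrow> smooth_on S f \<Longrightarrow> smooth_on S g \<Longrightarrow> smooth_on S (\<lambda>x. f x + g x)"
  by (auto simp: smooth_on_def intro: Ck_on_add)

lemma smooth_on_sum: "open S \<Longrightarrow> (\<And>i. i \<in> I \<Longrightarrow> smooth_on S (f i)) \<Longrightarrow> smooth_on S (\<lambda>x. \<Sum>i\<in>I. f i x)"
  by (auto simp: smooth_on_def intro: Ck_on_sum)

lemma smooth_on_bilinear:
  "bounded_bilinear p \<Longrightarrow> open S \<Longrightarrow> smooth_on S f \<Longrightarrow> smooth_on S g \<Longrightarrow> smooth_on S (\<lambda>x. p (f x) (g x))"
  by (auto simp: smooth_on_def intro: Ck_on_bilinear)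

lemma smooth_on_compose:
  fixes g :: "'a::real_normed_vector \<Rightarrow> 'b::real_normed_vector" and B :: "'b set"
  assumes "coordinate_system B \<xi>" "open S" "open T" "g ` S \<subseteq> T" "smooth_on T f" "smooth_on S g"
  shows "smooth_on S (\<lambda>x. f (g x))"
  using assms(5,6) Ck_on_compose[OF assms(1-4)] unfolding smooth_on_def by blast

text \<open>Differentiating \<open>T \<circ> R = 1\<close> gives \<open>R' = - R \<circ> T' \<circ> R\<close>.\<close>

lemma has_derivative_inverse_operator:
  fixes T :: "'a::real_normed_vector \<Rightarrow> 'b::real_normed_vector \<Rightarrow>\<^sub>L 'b"
  assumes "open S" "x \<in> S" and d: "(T has_derivative T') (at x)" and c: "continuous_on S R"
    and inv: "\<And>x. x \<in> S \<Longrightarrow> T x o\<^sub>L R x = id_blinfun" "\<And>x. x \<in> S \<Longrightarrow> R x o\<^sub>L T x = id_blinfun"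
  shows "(R has_derivative (\<lambda>v. - (R x o\<^sub>L T' v o\<^sub>L R x))) (at x)"
proof -
  have ev: "eventually (\<lambda>y. y \<in> S) (at x)"
    using assms(1,2) by (simp add: eventually_at_in_open')
  have cR: "isCont R x"
    using assms(1,2) c by (simp add: continuous_on_eq_continuous_at)
  interpret T': bounded_linear T'
    using d by (rule has_derivative_bounded_linear)
  have bl: "bounded_linear (\<lambda>v. - (R x o\<^sub>L T' v o\<^sub>L R x))"
    by (rule bounded_linear_minus[OF bounded_linear_compose[OF
          bounded_bilinear.bounded_linear_left[OF bounded_bilinear_blinfun_compose]
          bounded_linear_compose[OF bounded_bilinear.bounded_linear_right[OF bounded_bilinear_blinfun_compose]
            T'.bounded_linear_axioms]]])
  have diff: "R y - R x = - (R y o\<^sub>L (T y - T x) o\<^sub>L R x)" if "y \<in> S" for y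
  proof (rule blinfun_eqI)
    fix w
    have "R y (T y (R x w)) = R x w" "T x (R x w) = w"
      using inv(2)[OF that] inv(1)[OF \<open>x \<in> S\<close>] by (metis blinfun_apply_blinfun_compose blinfun_apply_id_blinfun)+
    then show "blinfun_apply (R y - R x) w = blinfun_apply (- (R y o\<^sub>L (T y - T x) o\<^sub>L R x)) w"
      by (simp add: blinfun.diff_left blinfun.minus_left blinfun.diff_right)
  qed
  \<comment> \<open>\<open>?e\<close> is the remainder of \<open>T\<close> and \<open>?q\<close> its
    linear difference quotient. The remainder quotient of \<open>R\<close> is
    \<open>- R y ?e R x - (R y - R x) ?q R x\<close>: the first term tends to 0 with
    \<open>?e\<close>, the second because \<open>?q\<close> is bounded and \<open>R\<close>
    continuous.\<close>
  let ?e = "\<lambda>y. (T y - T x - T' (y - x)) /\<^sub>R norm (y - x)"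
  let ?q = "\<lambda>y. T' (y - x) /\<^sub>R norm (y - x)"
  have e0: "(?e \<longlongrightarrow> 0) (at x)"
    using d unfolding has_derivative_at_within by simp
  obtain K where K: "\<And>v. norm (T' v) \<le> norm v * K" "K > 0"
    using T'.pos_bounded by auto
  have qb: "norm (?q y) \<le> K" for y
    using K(1)[of "y - x"] K(2) by (cases "y = x") (auto simp: field_simps)
  have 1: "((\<lambda>y. (R y - R x) o\<^sub>L ?q y o\<^sub>L R x) \<longlongrightarrow> 0) (at x)"
  proof (rule Lim_null_comparison)
    show "eventually (\<lambda>y. norm ((R y - R x) o\<^sub>L ?q y o\<^sub>L R x) \<le> norm (R y - R x) * K * norm (R x)) (at x)"
    proof (intro always_eventually allI)
      fix y
      have "norm ((R y - R x) o\<^sub>L ?q y o\<^sub>L R x) \<le> norm ((R y - R x) o\<^sub>L ?q y) * norm (R x)"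
        by (rule norm_blinfun_compose)
      also have "\<dots> \<le> norm (R y - R x) * norm (?q y) * norm (R x)"
        by (intro mult_right_mono norm_blinfun_compose) auto
      also have "\<dots> \<le> norm (R y - R x) * K * norm (R x)"
        by (intro mult_right_mono mult_left_mono qb) auto
      finally show "norm ((R y - R x) o\<^sub>L ?q y o\<^sub>L R x) \<le> norm (R y - R x) * K * norm (R x)" .
    qed
    have "((\<lambda>y. norm (R y - R x) * K * norm (R x)) \<longlongrightarrow> norm (R x - R x) * K * norm (R x)) (at x)"
      using cR by (intro tendsto_intros) (auto simp: isCont_def)
    then show "((\<lambda>y. norm (R y - R x) * K * norm (R x)) \<longlongrightarrow> 0) (at x)" by simp
  qed
  have 2: "((\<lambda>y. R y o\<^sub>L ?e y o\<^sub>L R x) \<longlongrightarrow> R x o\<^sub>L 0 o\<^sub>L R x) (at x)"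
    using cR e0 by (intro bounded_bilinear.tendsto[OF bounded_bilinear_blinfun_compose] tendsto_const) (auto simp: isCont_def)
  have 3: "((\<lambda>y. - (R y o\<^sub>L ?e y o\<^sub>L R x) - ((R y - R x) o\<^sub>L ?q y o\<^sub>L R x)) \<longlongrightarrow> 0) (at x)"
    using tendsto_diff[OF tendsto_minus[OF 2] 1] by simp
  have "((\<lambda>y. (R y - R x - - (R x o\<^sub>L T' (y - x) o\<^sub>L R x)) /\<^sub>R norm (y - x)) \<longlongrightarrow> 0) (at x)"
  proof (rule Lim_transform_eventually[OF 3])
    show "eventually (\<lambda>y. - (R y o\<^sub>L ?e y o\<^sub>L R x) - ((R y - R x) o\<^sub>L ?q y o\<^sub>L R x) =
      (R y - R x - - (R x o\<^sub>L T' (y - x) o\<^sub>L R x)) /\<^sub>R norm (y - x)) (at x)"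
      using ev
    proof eventually_elim
      case (elim y)
      have "- (R y o\<^sub>L ?e y o\<^sub>L R x) - ((R y - R x) o\<^sub>L ?q y o\<^sub>L R x) =
          (- (R y o\<^sub>L (T y - T x) o\<^sub>L R x) - - (R x o\<^sub>L T' (y - x) o\<^sub>L R x)) /\<^sub>R norm (y - x)"
        by (rule blinfun_eqI) (simp add: blinfun.bilinear_simps algebra_simps)
      then show ?case
        by (simp add: diff[OF elim])
    qed
  qed
  then show ?thesis
    unfolding has_derivative_at_within
    using bl by simp
qed

text \<open>Bootstrapping: the derivative of \<open>R\<close> is a product of \<open>R\<close> and
  derivatives of \<open>T\<close>, so each order of \<open>R\<close> yields the next.\<close>

lemma smooth_on_inverse_operator:
  fixes T :: "'a::real_normed_vector \<Rightarrow> 'b::real_normed_vector \<Rightarrow>\<^sub>L 'b"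
  assumes "open S" "smooth_on S T" "continuous_on S R"
    and inv: "\<And>x. x \<in> S \<Longrightarrow> T x o\<^sub>L R x = id_blinfun" "\<And>x. x \<in> S \<Longrightarrow> R x o\<^sub>L T x = id_blinfun"
  shows "smooth_on S R"
proof -
  have "Ck_on k S R" for k
  proof (induction k)
    case 0
    then show ?case using assms by simp
  next
    case (Suc k)
    show ?case
    proof (rule Ck_on_SucI[OF \<open>open S\<close>])
      show "(R has_derivative (\<lambda>v. - (R x o\<^sub>L frechet_derivative T (at x) v o\<^sub>L R x))) (at x)" if "x \<in> S" for x
        by (rule has_derivative_inverse_operator[OF assms(1) that smooth_on_derivative(1)[OF assms(2) that] assms(3)]) (auto simp: inv)
      have "Ck_on k S (\<lambda>x. R x o\<^sub>L frechet_derivative T (at x) v o\<^sub>L R x)" for v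
        using smooth_on_derivative(2)[OF assms(2)] Suc
        by (intro Ck_on_bilinear[OF bounded_bilinear_blinfun_compose] \<open>open S\<close>) (auto simp: smooth_on_def)
      then show "Ck_on k S (\<lambda>x. - (R x o\<^sub>L frechet_derivative T (at x) v o\<^sub>L R x))" for v
        by (rule Ck_on_bounded_linear[OF bounded_linear_minus[OF bounded_linear_ident] \<open>open S\<close>])
    qed
  qed
  then show ?thesis by (simp add: smooth_on_def)
qed

lemma smooth_on_inverse:
  fixes f :: "'a::real_normed_vector \<Rightarrow> real"
  assumes "open S" "smooth_on S f" "\<And>x. x \<in> S \<Longrightarrow> f x \<noteq> 0"
  shows "smooth_on S (\<lambda>x. inverse (f x))"
proof -
  have "Ck_on k S (\<lambda>x. inverse (f x))" for k
  proof (induction k)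
    case 0
    then show ?case using assms smooth_on_imp_continuous_on by (auto intro: continuous_on_inverse)
  next
    case (Suc k)
    show ?case
    proof (rule Ck_on_SucI[OF \<open>open S\<close>])
      show "((\<lambda>x. inverse (f x)) has_derivative (\<lambda>v. - (inverse (f x) * frechet_derivative f (at x) v * inverse (f x)))) (at x)" if "x \<in> S" for x
        by (rule Deriv.has_derivative_inverse[OF assms(3)[OF that] smooth_on_derivative(1)[OF assms(2) that]])
      have "Ck_on k S (\<lambda>x. inverse (f x) * frechet_derivative f (at x) v * inverse (f x))" for v
        using smooth_on_derivative(2)[OF assms(2)] Suc
        by (intro Ck_on_bilinear[OF bounded_bilinear_mult] \<open>open S\<close>) (auto simp: smooth_on_def)
      then show "Ck_on k S (\<lambda>x. - (inverse (f x) * frechet_derivative f (at x) v * inverse (f x)))" for v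
        by (rule Ck_on_bounded_linear[OF bounded_linear_minus[OF bounded_linear_ident] \<open>open S\<close>])
    qed
  qed
  then show ?thesis by (simp add: smooth_on_def)
qed

text \<open>Bootstrapping again: the velocity is \<open>F (u t)\<close>, hence as often
  differentiable as \<open>u\<close>.\<close>

lemma smooth_on_integral_curve:
  fixes u :: "real \<Rightarrow> 'b::real_normed_vector" and B :: "'b set"
  assumes "coordinate_system B \<xi>" "open I" "open T" "u ` I \<subseteq> T" "smooth_on T F"
    and d: "\<And>t. t \<in> I \<Longrightarrow> (u has_vector_derivative F (u t)) (at t)"
  shows "smooth_on I u"
proof -
  have "Ck_on k I u" for k
  proof (induction k)
    case 0
    have "continuous_on I u"
      using d by (meson continuous_at_imp_continuous_on has_vector_derivative_continuous)
    then show ?case by simp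
  next
    case (Suc k)
    show ?case
    proof (rule Ck_on_SucI[OF \<open>open I\<close>])
      show "(u has_derivative (\<lambda>v. v *\<^sub>R F (u t))) (at t)" if "t \<in> I" for t
        using d[OF that] by (simp add: has_vector_derivative_def)
      have "Ck_on k I (\<lambda>t. F (u t))"
        using assms(5) Suc by (intro Ck_on_compose[OF assms(1-4), of k F]) (simp_all add: smooth_on_def)
      then show "Ck_on k I (\<lambda>t. v *\<^sub>R F (u t))" for v
        by (rule Ck_on_bounded_linear[OF bounded_linear_scaleR_right \<open>open I\<close>])
    qed
  qed
  then show ?thesis by (simp add: smooth_on_def)
qed

section \<open>Bump functions\<close>

text \<open>\<open>n = 0\<close> is the classical flat function \<open>exp (- 1 / t)\<close>. The
  powers of \<open>1 / t\<close> make the family closed under differentiation up to linear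
  combinations.\<close>

definition flat_exp :: "nat \<Rightarrow> real \<Rightarrow> real" where
  "flat_exp n t = (if t \<le> 0 then 0 else inverse t ^ n * exp (- inverse t))"

lemma flat_exp_tendsto_0: "(flat_exp n \<longlongrightarrow> 0) (at 0)"
proof -
  have "((\<lambda>s::real. s ^ n / exp s) \<longlongrightarrow> 0) at_top"
    by (rule tendsto_power_div_exp_0)
  then have "((\<lambda>t::real. inverse t ^ n / exp (inverse t)) \<longlongrightarrow> 0) (at_right 0)"
    by (rule filterlim_compose) (rule filterlim_inverse_at_top_right)
  then have "(flat_exp n \<longlongrightarrow> 0) (at_right 0)"
    by (rule Lim_transform_eventually)
       (auto simp: eventually_at_filter flat_exp_def exp_minus field_simps)
  moreover have "(flat_exp n \<longlongrightarrow> 0) (at_left 0)"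
    by (rule tendsto_eventually) (auto simp: eventually_at_filter flat_exp_def)
  ultimately show ?thesis
    by (simp add: filterlim_split_at_real)
qed

lemma flat_exp_has_derivative:
  "(flat_exp n has_real_derivative flat_exp (n + 2) t - n * flat_exp (n + 1) t) (at t)"
proof -
  consider "t < 0" | "t = 0" | "t > 0" by linarith
  then show ?thesis
  proof cases
    case 1
    have "((\<lambda>_. 0) has_real_derivative 0) (at t)" by simp
    then have "(flat_exp n has_real_derivative 0) (at t)"
      by (rule has_field_derivative_transform_within[of _ _ _ _ "-t"]) (use 1 in \<open>auto simp: flat_exp_def dist_real_def\<close>)
    then show ?thesis using 1 by (simp add: flat_exp_def)
  next
    case 2
    \<comment> \<open>The difference quotient of \<open>flat_exp n\<close> at 0 is
      \<open>flat_exp (Suc n)\<close> itself.\<close>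
    have "((\<lambda>h. (flat_exp n (0 + h) - flat_exp n 0) / h) \<longlongrightarrow> 0) (at 0)"
      by (rule Lim_transform_eventually[OF flat_exp_tendsto_0[of "Suc n"]])
         (auto simp: eventually_at_filter flat_exp_def divide_inverse mult_ac)
    then show ?thesis using 2 by (simp add: DERIV_def flat_exp_def)
  next
    case 3
    have "((\<lambda>t. inverse t ^ n * exp (- inverse t)) has_real_derivative
       inverse t ^ (n + 2) * exp (- inverse t) - n * (inverse t ^ (n + 1) * exp (- inverse t))) (at t)"
      by (rule derivative_eq_intros refl | use 3 in \<open>simp; fail\<close>)+ (use 3 in \<open>cases n; simp add: algebra_simps power2_eq_square\<close>)
    then have "(flat_exp n has_real_derivative
       inverse t ^ (n + 2) * exp (- inverse t) - n * (inverse t ^ (n + 1) * exp (- inverse t))) (at t)"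
      by (rule has_field_derivative_transform_within[of _ _ _ _ "t"]) (use 3 in \<open>auto simp: flat_exp_def dist_real_def\<close>)
    then show ?thesis using 3 by (simp add: flat_exp_def)
  qed
qed

lemma smooth_flat_exp: "smooth_on UNIV (flat_exp n)"
proof -
  have "Ck_on k UNIV (flat_exp n)" for k n
  proof (induction k arbitrary: n)
    case 0
    then show ?case
      by (auto intro!: continuous_at_imp_continuous_on DERIV_isCont flat_exp_has_derivative)
  next
    case (Suc k)
    show ?case
    proof (rule Ck_on_SucI[OF open_UNIV])
      show "(flat_exp n has_derivative (\<lambda>v. (flat_exp (n + 2) t + (- real n) * flat_exp (n + 1) t) * v)) (at t)" for t
        using flat_exp_has_derivative[of n t] by (simp add: has_field_derivative_def)
      show "Ck_on k UNIV (\<lambda>t. (flat_exp (n + 2) t + (- real n) * flat_exp (n + 1) t) * v)" for v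
        by (intro Ck_on_bounded_linear[OF bounded_linear_mult_left] Ck_on_add
              Ck_on_bounded_linear[OF bounded_linear_mult_right] Suc open_UNIV)
    qed
  qed
  then show ?thesis by (simp add: smooth_on_def)
qed

text \<open>With \<open>f\<close> the flat function and \<open>s\<close> the squared distance to
  \<open>q\<close>, the bump is the quotient \<open>n / (n + m)\<close> for
  \<open>n = f (4 r^2 - s)\<close> and \<open>m = f (s - r^2)\<close>. The two never vanish together
  because \<open>r^2 < 4 r^2\<close>. The square keeps \<open>s\<close> smooth at
  \<open>q\<close>.\<close>

lemma smooth_bump:
  fixes q :: "'e::real_inner"
  assumes "r > 0"
  obtains \<psi> :: "'e \<Rightarrow> real" where "smooth_on UNIV \<psi>" "\<And>x. x \<in> ball q r \<Longrightarrow> \<psi> x = 1"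
    "\<And>x. x \<notin> ball q (2 * r) \<Longrightarrow> \<psi> x = 0"
proof -
  define f where "f = flat_exp 0"
  have f: "f t = 0" if "t \<le> 0" for t using that by (simp add: f_def flat_exp_def)
  have fp: "f t > 0" if "t > 0" for t using that by (simp add: f_def flat_exp_def)
  have f0: "f t \<ge> 0" for t by (simp add: f_def flat_exp_def)
  define s where "s x = (x - q) \<bullet> (x - q)" for x
  have s: "smooth_on UNIV s"
    unfolding s_def diff_conv_add_uminus
    by (intro smooth_on_bilinear[OF bounded_bilinear_inner] smooth_on_add smooth_on_const smooth_on_id open_UNIV)
  have sn: "s x = (dist q x)\<^sup>2" for x
    unfolding s_def dist_commute[of q x] by (simp add: dist_norm power2_norm_eq_inner)
  have sf: "smooth_on UNIV (\<lambda>x. f (a * s x + b))" for a b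
    unfolding f_def
    by (rule smooth_on_compose[OF coordinate_system_real open_UNIV open_UNIV subset_UNIV smooth_flat_exp])
       (intro smooth_on_add smooth_on_bounded_linear[OF bounded_linear_mult_right] s smooth_on_const open_UNIV)
  define n where "n x = f ((-1) * s x + 4 * r\<^sup>2)" for x
  define m where "m x = f (1 * s x + - r\<^sup>2)" for x
  have pos: "n x + m x > 0" for x
  proof (cases "s x < 4 * r\<^sup>2")
    case True
    then show ?thesis using fp[of "(-1) * s x + 4 * r\<^sup>2"] f0 by (simp add: n_def m_def add_pos_nonneg)
  next
    case False
    have "r\<^sup>2 > 0" using assms by simp
    then have "s x > r\<^sup>2" using False by linarith
    then have "f (1 * s x + - r\<^sup>2) > 0" by (intro fp) simp
    then show ?thesis using f0 unfolding n_def m_def by (intro add_nonneg_pos) auto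
  qed
  have nz: "n x + m x \<noteq> 0" for x using pos[of x] by simp
  show ?thesis
  proof
    show "smooth_on UNIV (\<lambda>x. n x * inverse (n x + m x))"
      unfolding n_def m_def
      by (intro smooth_on_bilinear[OF bounded_bilinear_mult] smooth_on_inverse smooth_on_add sf open_UNIV)
         (use nz in \<open>auto simp: n_def m_def\<close>)
    show "n x * inverse (n x + m x) = 1" if "x \<in> ball q r" for x
    proof -
      have "s x \<le> r\<^sup>2" using that by (auto simp: sn intro: power_mono)
      then have "m x = 0" by (simp add: m_def f)
      then show ?thesis using nz[of x] by simp
    qed
    show "n x * inverse (n x + m x) = 0" if "x \<notin> ball q (2 * r)" for x
    proof -
      have "(2 * r)\<^sup>2 \<le> s x" using that assms unfolding sn by (intro power_mono) auto
      then have "n x = 0" by (simp add: n_def f power_mult_distrib)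
      then show ?thesis by simp
    qed
  qed
qed

section \<open>Orthonormal bases\<close>

lemma orthonormal_basis_of_span:
  fixes B0 :: "'e::real_inner set"
  assumes "finite B0"
  obtains C where "finite C" "\<And>a b. a \<in> C \<Longrightarrow> b \<in> C \<Longrightarrow> a \<bullet> b = (if a = b then 1 else 0)"
    "span C = span B0"
proof -
  obtain D where D: "finite D" "span D = span B0" "pairwise orthogonal D"
    using basis_orthogonal[OF assms] by blast
  define C where "C = (\<lambda>x. x /\<^sub>R norm x) ` (D - {0})"
  have "span C = span (D - {0})"
    unfolding C_def
    by (intro span_image_scale) (use D(1) in auto)
  also have "\<dots> = span D"
    by (rule span_delete_0)
  finally have "span C = span B0" using D(2) by simp
  moreover have "a \<bullet> b = (if a = b then 1 else 0)" if ab: "a \<in> C" "b \<in> C" for a b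
  proof -
    obtain x y where xy: "x \<in> D" "x \<noteq> 0" "a = x /\<^sub>R norm x" "y \<in> D" "y \<noteq> 0" "b = y /\<^sub>R norm y"
      using ab unfolding C_def by auto
    show ?thesis
    proof (cases "x = y")
      case True
      then show ?thesis using xy by (simp add: dot_square_norm power2_eq_square)
    next
      case False
      then have "x \<bullet> y = 0" using D(3) xy by (simp add: pairwise_def orthogonal_def)
      then have "a \<bullet> b = 0" using xy by simp
      moreover have "a \<bullet> a = 1" using xy by (simp add: dot_square_norm power2_eq_square)
      ultimately show ?thesis by auto
    qed
  qed
  moreover have "finite C" using D(1) by (simp add: C_def)
  ultimately show ?thesis using that by blast
qed

lemma orthonormal_expansion:
  fixes C :: "'e::real_inner set"
  assumes "finite C" "\<And>a b. a \<in> C \<Longrightarrow> b \<in> C \<Longrightarrow> a \<bullet> b = (if a = b then 1 else 0)" "x \<in> span C"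
  shows "(\<Sum>b\<in>C. (x \<bullet> b) *\<^sub>R b) = x"
proof -
  obtain u where u: "x = (\<Sum>a\<in>C. u a *\<^sub>R a)"
    using assms(1,3) by (auto simp: span_finite)
  have "x \<bullet> b = u b" if "b \<in> C" for b
  proof -
    have "x \<bullet> b = (\<Sum>a\<in>C. u a * (a \<bullet> b))" by (simp add: u inner_sum_left)
    also have "\<dots> = (\<Sum>a\<in>C. if a = b then u a else 0)"
      using assms(2) that by (intro sum.cong) auto
    finally show ?thesis using assms(1) that by simp
  qed
  then show ?thesis by (simp add: u)
qed

text \<open>Stands in for the canonical basis of a Euclidean space; \<open>B\<close> may be empty,
  as dimension 0 is allowed.\<close>

locale orthonormal_basis =
  fixes B :: "'e::real_inner set"
  assumes finite_B: "finite B"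
    and inner_B: "\<And>a b. a \<in> B \<Longrightarrow> b \<in> B \<Longrightarrow> a \<bullet> b = (if a = b then 1 else 0)"
    and span_B: "span B = UNIV"
begin

lemma expansion: "(\<Sum>b\<in>B. (x \<bullet> b) *\<^sub>R b) = x"
  by (rule orthonormal_expansion) (use finite_B inner_B span_B in auto)

lemma coordinate_system_B: "coordinate_system B (\<lambda>b v. v \<bullet> b)"
  unfolding coordinate_system_def
  by (intro conjI allI finite_B bounded_linear_inner_left) (simp add: expansion)

lemma norm_B: "b \<in> B \<Longrightarrow> norm b = 1"
  using inner_B by (simp add: norm_eq_sqrt_inner)

lemma norm_le_coords: "norm x \<le> (\<Sum>b\<in>B. \<bar>x \<bullet> b\<bar>)"
proof -
  have "norm x = norm (\<Sum>b\<in>B. (x \<bullet> b) *\<^sub>R b)" by (simp add: expansion)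
  also have "\<dots> \<le> (\<Sum>b\<in>B. norm ((x \<bullet> b) *\<^sub>R b))" by (rule norm_sum)
  also have "\<dots> = (\<Sum>b\<in>B. \<bar>x \<bullet> b\<bar>)" using norm_B by (intro sum.cong) auto
  finally show ?thesis .
qed

lemma inner_B_le_norm: "b \<in> B \<Longrightarrow> \<bar>x \<bullet> b\<bar> \<le> norm x"
  using Cauchy_Schwarz_ineq2[of x b] by (simp add: norm_B)

lemma linear_imp_bounded_linear:
  fixes f :: "'e \<Rightarrow> 'f::real_normed_vector"
  assumes "linear f"
  shows "bounded_linear f"
proof (rule bounded_linear_intro[where K = "\<Sum>b\<in>B. norm (f b)"])
  fix x
  have "norm (f x) = norm (\<Sum>b\<in>B. (x \<bullet> b) *\<^sub>R f b)"
    using arg_cong[OF expansion, of f x] by (simp add: linear_sum[OF assms] linear_scale[OF assms])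
  also have "\<dots> \<le> (\<Sum>b\<in>B. norm x * norm (f b))"
    by (intro sum_norm_le) (auto intro: mult_right_mono inner_B_le_norm)
  finally show "norm (f x) \<le> norm x * (\<Sum>b\<in>B. norm (f b))" by (simp add: sum_distrib_left)
qed (use assms in \<open>auto simp: linear_add linear_scale\<close>)

text \<open>By Kuhn's combinatorial lemma on grids of mesh \<open>2 r / p\<close>.\<close>

lemma poincare_miranda:
  fixes f :: "'e \<Rightarrow> 'e" and q :: 'e
  defines "Q r \<equiv> {x. \<forall>b\<in>B. \<bar>(x - q) \<bullet> b\<bar> \<le> r}"
  assumes "r > 0" and compact: "compact (Q r)" and cont: "continuous_on (Q r) f"
    and pos: "\<And>x b. x \<in> Q r \<Longrightarrow> b \<in> B \<Longrightarrow> (x - q) \<bullet> b = r \<Longrightarrow> f x \<bullet> b > 0"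
    and neg: "\<And>x b. x \<in> Q r \<Longrightarrow> b \<in> B \<Longrightarrow> (x - q) \<bullet> b = - r \<Longrightarrow> f x \<bullet> b < 0"
  obtains x where "x \<in> Q r" "f x = 0"
proof -
  have "q \<in> Q r" using \<open>r > 0\<close> by (simp add: Q_def)
  \<comment> \<open>At a minimum of \<open>norm (f x)\<close>, points where \<open>f\<close> is
    arbitrarily small suffice; no convergent sequence of approximate zeros is needed.\<close>
  then obtain x0 where x0: "x0 \<in> Q r" "\<And>x. x \<in> Q r \<Longrightarrow> norm (f x0) \<le> norm (f x)"
    using continuous_attains_inf[OF compact _ continuous_on_norm[OF cont]] by auto
  define n where "n = card B"
  obtain e where e: "bij_betw e {..<n} B"
    using ex_bij_betw_nat_finite[OF finite_B] by (auto simp: n_def atLeast0LessThan)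
  have "f x0 = 0"
  proof (rule ccontr)
    assume "f x0 \<noteq> 0"
    \<comment> \<open>The final bound is \<open>n * \<epsilon>\<close>, and \<open>n + 1\<close>
      makes it strictly smaller than \<open>norm (f x0)\<close>, also for
      \<open>n = 0\<close>.\<close>
    define \<epsilon> where "\<epsilon> = norm (f x0) / (n + 1)"
    have "\<epsilon> > 0" using \<open>f x0 \<noteq> 0\<close> by (simp add: \<epsilon>_def)
    obtain \<delta> where \<delta>: "\<delta> > 0" "\<And>x y. x \<in> Q r \<Longrightarrow> y \<in> Q r \<Longrightarrow> dist x y < \<delta> \<Longrightarrow> dist (f x) (f y) < \<epsilon>"
      using compact_uniformly_continuous[OF cont compact] \<open>\<epsilon> > 0\<close>
      unfolding uniformly_continuous_on_def by metis
    obtain p0 where p0: "2 * r * n / \<delta> < real p0" using reals_Archimedean2 by blast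
    define p where "p = p0 + 1"
    have "p > 0" by (simp add: p_def)
    have pd: "2 * r * n / p < \<delta>"
    proof -
      have "2 * r * n < \<delta> * p" using p0 \<delta>(1) by (simp add: p_def field_simps)
      then show ?thesis using \<open>p > 0\<close> by (simp add: field_simps)
    qed
    define g where "g x = q + (\<Sum>i<n. (2 * r * real (x i) / p - r) *\<^sub>R e i)" for x :: "nat \<Rightarrow> nat"
    have eB: "e i \<in> B" if "i < n" for i using e that by (auto simp: bij_betw_def)
    have inner_e: "e j \<bullet> e i = (if i = j then 1 else 0)" if "i < n" "j < n" for i j
      using inner_B[OF eB eB, OF that(2,1)] e that by (auto simp: bij_betw_def inj_on_def)
    have coord: "(g x - q) \<bullet> e i = 2 * r * real (x i) / p - r" if "i < n" for x i
    proof -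
      have "(g x - q) \<bullet> e i = (\<Sum>j<n. (2 * r * real (x j) / p - r) * (e j \<bullet> e i))"
        by (simp add: g_def inner_sum_left)
      also have "\<dots> = (\<Sum>j<n. if j = i then 2 * r * real (x j) / p - r else 0)"
        using inner_e[OF that] by (intro sum.cong) auto
      finally have "(g x - q) \<bullet> e i = (\<Sum>j<n. if j = i then 2 * r * real (x j) / p - r else 0)" .
      then show ?thesis using that by simp
    qed
    have gQ: "g x \<in> Q r" if "\<forall>i<n. x i \<le> p" for x
    proof -
      have "\<bar>(g x - q) \<bullet> e i\<bar> \<le> r" if "i < n" for i
      proof -
        have "real (x i) \<le> p" using \<open>\<forall>i<n. x i \<le> p\<close> that by simp
        then have "2 * r * real (x i) / p \<le> 2 * r"
          using \<open>p > 0\<close> \<open>r > 0\<close> by (simp add: field_simps)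
        moreover have "0 \<le> 2 * r * real (x i) / p" using \<open>r > 0\<close> by simp
        ultimately show ?thesis by (simp add: coord[OF that] abs_le_iff)
      qed
      then show ?thesis
        unfolding Q_def using e by (auto simp: bij_betw_def)
    qed
    \<comment> \<open>The label is the sign of a component of \<open>f\<close>. The conditions on
      opposite faces are the boundary conditions of Kuhn's lemma, which yields a cell in which every
      component takes both labels.\<close>
    define label where "label x i = (if f (g x) \<bullet> e i < 0 then 0 else 1 :: nat)" for x i
    obtain z where z: "\<forall>i<n. z i < p"
      "\<forall>i<n. \<exists>s t. (\<forall>j<n. z j \<le> s j \<and> s j \<le> z j + 1) \<and> (\<forall>j<n. z j \<le> t j \<and> t j \<le> z j + 1) \<and> label s i \<noteq> label t i"
    proof (rule kuhn_lemma[of p n label])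
      show "\<forall>x. (\<forall>i<n. x i \<le> p) \<longrightarrow> (\<forall>i<n. x i = 0 \<longrightarrow> label x i = 0)"
        using neg[OF gQ eB] by (auto simp: label_def coord)
      show "\<forall>x. (\<forall>i<n. x i \<le> p) \<longrightarrow> (\<forall>i<n. x i = p \<longrightarrow> label x i = 1)"
      proof (intro allI impI)
        fix x i assume x: "\<forall>i<n. x i \<le> p" and i: "i < n" and "x i = p"
        then have "(g x - q) \<bullet> e i = r" using \<open>p > 0\<close> by (simp add: coord)
        then have "f (g x) \<bullet> e i > 0" by (rule pos[OF gQ[OF x] eB[OF i]])
        then show "label x i = 1" by (simp add: label_def)
      qed
    qed (auto simp: label_def \<open>p > 0\<close>)
    have zQ: "g z \<in> Q r" using z(1) by (intro gQ) (auto intro: less_imp_le)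
    have near: "dist (f (g z)) (f (g s)) < \<epsilon>" if s: "\<forall>j<n. z j \<le> s j \<and> s j \<le> z j + 1" for s
    proof (rule \<delta>(2)[OF zQ])
      show "g s \<in> Q r" using s z(1) by (intro gQ) (auto intro: le_trans simp: Suc_le_eq)
      have "dist (g z) (g s) = norm (\<Sum>i<n. (2 * r * (real (z i) - real (s i)) / p) *\<^sub>R e i)"
        unfolding dist_norm g_def
        by (simp add: sum_subtractf[symmetric] scaleR_left_diff_distrib[symmetric] diff_divide_distrib right_diff_distrib)
      also have "\<dots> \<le> (\<Sum>i<n. 2 * r / p)"
      proof (rule sum_norm_le)
        fix i assume i: "i \<in> {..<n}"
        have "\<bar>real (z i) - real (s i)\<bar> \<le> 1" using s i by force
        then have "2 * r / p * \<bar>real (z i) - real (s i)\<bar> \<le> 2 * r / p * 1"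
          using \<open>r > 0\<close> by (intro mult_left_mono) auto
        then show "norm ((2 * r * (real (z i) - real (s i)) / p) *\<^sub>R e i) \<le> 2 * r / p"
          using i \<open>r > 0\<close> by (simp add: norm_B[OF eB] abs_mult)
      qed
      also have "\<dots> = 2 * r * n / p" by simp
      finally show "dist (g z) (g s) < \<delta>" using pd by simp
    qed
    \<comment> \<open>The component has opposite signs at \<open>s\<close> and \<open>t\<close>, and
      its value at \<open>z\<close> is within \<open>\<epsilon>\<close> of both.\<close>
    have small: "\<bar>f (g z) \<bullet> b\<bar> \<le> \<epsilon>" if "b \<in> B" for b
    proof -
      have "b \<in> e ` {..<n}" using e that by (simp add: bij_betw_def)
      then obtain i where i: "i < n" "b = e i" by auto
      obtain s t where st: "\<forall>j<n. z j \<le> s j \<and> s j \<le> z j + 1" "\<forall>j<n. z j \<le> t j \<and> t j \<le> z j + 1"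
        "label s i \<noteq> label t i"
        using z(2) i(1) by blast
      have "\<bar>f (g z) \<bullet> b - f (g s) \<bullet> b\<bar> < \<epsilon>" "\<bar>f (g z) \<bullet> b - f (g t) \<bullet> b\<bar> < \<epsilon>"
        using near[OF st(1)] near[OF st(2)] inner_B_le_norm[OF that, of "f (g z) - f (g s)"]
          inner_B_le_norm[OF that, of "f (g z) - f (g t)"]
        by (auto simp: dist_norm inner_diff_left)
      moreover have "f (g s) \<bullet> b < 0 \<longleftrightarrow> \<not> f (g t) \<bullet> b < 0"
        using st(3) i by (auto simp: label_def split: if_splits)
      ultimately show ?thesis by linarith
    qed
    have "norm (f x0) \<le> norm (f (g z))" by (rule x0(2)[OF zQ])
    also have "\<dots> \<le> (\<Sum>b\<in>B. \<bar>f (g z) \<bullet> b\<bar>)" by (rule norm_le_coords)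
    also have "\<dots> \<le> n * \<epsilon>"
      using sum_bounded_above[of B "\<lambda>b. \<bar>f (g z) \<bullet> b\<bar>" \<epsilon>] small by (simp add: n_def)
    also have "\<dots> < norm (f x0)"
      using \<open>f x0 \<noteq> 0\<close> by (simp add: \<epsilon>_def field_simps)
    finally show False by simp
  qed
  then show ?thesis using that x0(1) by blast
qed

end

section \<open>Estimates for differentiable maps and differential equations\<close>

lemma C1_bounded_derivative:
  fixes f :: "'a::real_normed_vector \<Rightarrow> 'b::real_normed_vector" and B :: "'a set"
  assumes coord: "coordinate_system B \<xi>" and "Ck_on 1 V f" "compact K" "K \<subseteq> V"
  obtains L where "L \<ge> 0" "\<And>x v. x \<in> K \<Longrightarrow> norm (frechet_derivative f (at x) v) \<le> L * norm v"
proof -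
  let ?f = "\<lambda>x. frechet_derivative f (at x)"
  have "\<exists>M\<ge>0. \<forall>x\<in>K. norm (?f x b) \<le> M" for b
  proof -
    have "continuous_on K (\<lambda>x. ?f x b)"
      using assms by (auto intro: continuous_on_subset)
    then have "bounded ((\<lambda>x. ?f x b) ` K)"
      using assms(3) by (intro compact_imp_bounded compact_continuous_image)
    then obtain M where "\<forall>x\<in>K. norm (?f x b) \<le> M" by (auto simp: bounded_iff)
    then have "\<forall>x\<in>K. norm (?f x b) \<le> max 0 M" by (auto simp: le_max_iff_disj)
    then show ?thesis using max.cobounded1 by blast
  qed
  then obtain M where M: "\<And>b. M b \<ge> 0" "\<And>b x. x \<in> K \<Longrightarrow> norm (?f x b) \<le> M b" by metis
  have "\<exists>N\<ge>0. \<forall>v. \<bar>\<xi> b v\<bar> \<le> norm v * N" for b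
    using coord bounded_linear.nonneg_bounded[of "\<xi> b"] by (auto simp: coordinate_system_def)
  then obtain N where N: "\<And>b. N b \<ge> 0" "\<And>b v. \<bar>\<xi> b v\<bar> \<le> norm v * N b" by metis
  show ?thesis
  proof
    show "(\<Sum>b\<in>B. N b * M b) \<ge> 0" using M N by (simp add: sum_nonneg)
    fix x v assume "x \<in> K"
    then have lin: "linear (?f x)"
      using assms by (auto intro!: linear_frechet_derivative)
    have "?f x v = (\<Sum>b\<in>B. \<xi> b v *\<^sub>R ?f x b)"
      using coord linear_sum[OF lin, of "\<lambda>b. \<xi> b v *\<^sub>R b" B] by (simp add: coordinate_system_def linear_scale[OF lin])
    also have "norm \<dots> \<le> (\<Sum>b\<in>B. norm v * N b * M b)"
      using M N \<open>x \<in> K\<close> by (intro sum_norm_le) (auto intro!: mult_mono)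
    finally show "norm (?f x v) \<le> (\<Sum>b\<in>B. N b * M b) * norm v"
      by (simp add: sum_distrib_left sum_distrib_right mult_ac)
  qed
qed

lemma C1_lipschitz:
  fixes f :: "'a::real_normed_vector \<Rightarrow> 'b::real_normed_vector" and B :: "'a set"
  assumes coord: "coordinate_system B \<xi>" and "Ck_on 1 V f" "compact K" "convex K" "K \<subseteq> V"
  obtains L where "L \<ge> 0" "\<And>x y. x \<in> K \<Longrightarrow> y \<in> K \<Longrightarrow> norm (f x - f y) \<le> L * norm (x - y)"
proof -
  obtain L where L: "L \<ge> 0" "\<And>x v. x \<in> K \<Longrightarrow> norm (frechet_derivative f (at x) v) \<le> L * norm v"
    using C1_bounded_derivative[OF assms(1,2,3,5)] by blast
  have "norm (f x - f y) \<le> L * norm (x - y)" if "x \<in> K" "y \<in> K" for x y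
  proof (rule differentiable_bound[OF \<open>convex K\<close> _ _ that])
    fix z assume z: "z \<in> K"
    then show "(f has_derivative frechet_derivative f (at z)) (at z within K)"
      using Ck_on_SucD(1)[of 0 V f z] assms by (auto intro: has_derivative_at_withinI)
    show "onorm (frechet_derivative f (at z)) \<le> L"
      using L z by (intro onorm_bound) auto
  qed
  with L(1) show ?thesis using that by blast
qed

text \<open>The mean value inequality is applied to \<open>f z - f' x z\<close> on the segment from
  \<open>x\<close> to \<open>y\<close>. Its derivative \<open>f' z - f' x\<close> is of order
  \<open>norm (y - x)\<close>, since the partial derivatives of \<open>f\<close> are Lipschitz on
  the compact convex set.\<close>

lemma smooth_taylor:
  fixes f :: "'a::real_normed_vector \<Rightarrow> 'b::real_normed_vector" and B :: "'a set"
  assumes coord: "coordinate_system B \<xi>" and "smooth_on V f" "compact K" "convex K" "K \<subseteq> V"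
  obtains C where "C \<ge> 0"
    "\<And>x y. x \<in> K \<Longrightarrow> y \<in> K \<Longrightarrow> norm (f y - f x - frechet_derivative f (at x) (y - x)) \<le> C * (norm (y - x))\<^sup>2"
proof -
  let ?f = "\<lambda>x. frechet_derivative f (at x)"
  have d: "(f has_derivative ?f x) (at x)" if "x \<in> K" for x
    using smooth_on_derivative(1)[OF assms(2)] that assms(5) by blast
  have "\<exists>L\<ge>0. \<forall>x\<in>K. \<forall>y\<in>K. norm (?f x b - ?f y b) \<le> L * norm (x - y)" for b
  proof -
    have "Ck_on 1 V (\<lambda>x. ?f x b)"
      using smooth_on_derivative(2)[OF assms(2)] unfolding smooth_on_def by blast
    then show ?thesis using C1_lipschitz[OF coord _ assms(3-5)] by metis
  qed
  then obtain M where M: "\<And>b. M b \<ge> 0" "\<And>b x y. x \<in> K \<Longrightarrow> y \<in> K \<Longrightarrow> norm (?f x b - ?f y b) \<le> M b * norm (x - y)"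
    by metis
  have "\<exists>N\<ge>0. \<forall>v. \<bar>\<xi> b v\<bar> \<le> norm v * N" for b
    using coord bounded_linear.nonneg_bounded[of "\<xi> b"] by (auto simp: coordinate_system_def)
  then obtain N where N: "\<And>b. N b \<ge> 0" "\<And>b v. \<bar>\<xi> b v\<bar> \<le> norm v * N b" by metis
  define C where "C = (\<Sum>b\<in>B. N b * M b)"
  have "C \<ge> 0" using M N by (simp add: C_def sum_nonneg)
  have lip: "norm (?f x v - ?f y v) \<le> C * norm (x - y) * norm v" if "x \<in> K" "y \<in> K" for x y v
  proof -
    have ex: "?f z v = (\<Sum>b\<in>B. \<xi> b v *\<^sub>R ?f z b)" if "z \<in> K" for z
    proof -
      have lin: "linear (?f z)" using d[OF that] by (auto dest: has_derivative_linear)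
      show ?thesis
        using coord linear_sum[OF lin, of "\<lambda>b. \<xi> b v *\<^sub>R b" B]
        by (simp add: coordinate_system_def linear_scale[OF lin])
    qed
    have "?f x v - ?f y v = (\<Sum>b\<in>B. \<xi> b v *\<^sub>R (?f x b - ?f y b))"
      by (simp add: ex that sum_subtractf scaleR_right_diff_distrib)
    also have "norm \<dots> \<le> (\<Sum>b\<in>B. norm v * N b * (M b * norm (x - y)))"
      using M N that by (intro sum_norm_le) (auto intro!: mult_mono)
    finally show ?thesis
      by (simp add: C_def sum_distrib_left sum_distrib_right mult_ac)
  qed
  have "norm (f y - f x - ?f x (y - x)) \<le> C * (norm (y - x))\<^sup>2" if "x \<in> K" "y \<in> K" for x y
  proof -
    have seg: "closed_segment x y \<subseteq> K" using that \<open>convex K\<close> by (simp add: closed_segment_subset)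
    interpret D: bounded_linear "?f x" using d[OF that(1)] by (rule has_derivative_bounded_linear)
    have "norm ((f y - ?f x y) - (f x - ?f x x)) \<le> (C * norm (y - x)) * norm (y - x)"
    proof (rule differentiable_bound[of "closed_segment x y" _ "\<lambda>z v. ?f z v - ?f x v"])
      fix z assume z: "z \<in> closed_segment x y"
      then have "z \<in> K" using seg by blast
      have "norm (z - x) \<le> norm (y - x)"
        using segment_bound[OF z] by simp
      then show "onorm (\<lambda>v. ?f z v - ?f x v) \<le> C * norm (y - x)"
        using lip[OF \<open>z \<in> K\<close> that(1)] \<open>C \<ge> 0\<close>
        by (intro onorm_bound) (auto intro!: order_trans[OF lip[OF \<open>z \<in> K\<close> that(1)]] mult_right_mono mult_left_mono)
      show "((\<lambda>z. f z - ?f x z) has_derivative (\<lambda>v. ?f z v - ?f x v)) (at z within closed_segment x y)"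
        by (intro has_derivative_diff has_derivative_at_withinI[OF d[OF \<open>z \<in> K\<close>]] D.has_derivative has_derivative_ident)
    qed auto
    then show ?thesis by (simp add: D.diff power2_eq_square algebra_simps)
  qed
  with \<open>C \<ge> 0\<close> show ?thesis using that by blast
qed

text \<open>Compare with the maximum \<open>K\<close> of \<open>norm (e t) * exp (- 2 * C * t)\<close>:
  integrating the differential inequality up to the maximum point bounds \<open>K\<close> by \<open>K / 2 + d * T\<close>.\<close>

lemma gronwall_forward:
  fixes e :: "real \<Rightarrow> 'a::real_normed_vector"
  assumes "T \<ge> 0" "C > 0" "d \<ge> 0" and cont: "continuous_on {0..T} e" and "e 0 = 0"
    and deriv: "\<And>t. 0 < t \<Longrightarrow> t < T \<Longrightarrow> (e has_vector_derivative e' t) (at t)"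
    and bound: "\<And>t. 0 < t \<Longrightarrow> t < T \<Longrightarrow> norm (e' t) \<le> C * norm (e t) + d"
    and "t \<in> {0..T}"
  shows "norm (e t) \<le> 2 * d * T * exp (2 * C * T)"
proof -
  have "continuous_on {0..T} (\<lambda>t. norm (e t) * exp (- 2 * C * t))"
    by (intro continuous_intros cont)
  then obtain m where m: "m \<in> {0..T}"
    "\<And>s. s \<in> {0..T} \<Longrightarrow> norm (e s) * exp (- 2 * C * s) \<le> norm (e m) * exp (- 2 * C * m)"
    using continuous_attains_sup[of "{0..T}" "\<lambda>t. norm (e t) * exp (- 2 * C * t)"] \<open>t \<in> {0..T}\<close> by auto
  define K where "K = norm (e m) * exp (- 2 * C * m)"
  have "K \<ge> 0" by (simp add: K_def)
  have eK: "norm (e s) \<le> K * exp (2 * C * s)" if "s \<in> {0..T}" for s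
    using m(2)[OF that] by (simp add: K_def exp_minus field_simps)
  have "K \<le> 2 * d * T"
  proof (cases "m = 0")
    case True
    then show ?thesis using \<open>e 0 = 0\<close> assms by (simp add: K_def)
  next
    case False
    then have "0 < m" "m \<le> T" using m by auto
    have "norm (e m - e 0) \<le> (K / 2 * exp (2 * C * m) + d * m) - (K / 2 * exp (2 * C * 0) + d * 0)"
    proof (rule differentiable_bound_general[OF \<open>0 < m\<close>, of e "\<lambda>s. K / 2 * exp (2 * C * s) + d * s"])
      show "continuous_on {0..m} e" using \<open>m \<le> T\<close> by (intro continuous_on_subset[OF cont]) auto
      show "continuous_on {0..m} (\<lambda>s. K / 2 * exp (2 * C * s) + d * s)" by (intro continuous_intros)
      fix s assume s: "0 < s" "s < m"
      show "(e has_vector_derivative e' s) (at s)" using deriv s \<open>m \<le> T\<close> by simp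
      show "((\<lambda>s. K / 2 * exp (2 * C * s) + d * s) has_vector_derivative C * (K * exp (2 * C * s)) + d) (at s)"
        unfolding has_real_derivative_iff_has_vector_derivative[symmetric]
        by (auto intro!: derivative_eq_intros)
      have "norm (e' s) \<le> C * norm (e s) + d" using bound s \<open>m \<le> T\<close> by simp
      also have "\<dots> \<le> C * (K * exp (2 * C * s)) + d"
        using eK[of s] s \<open>m \<le> T\<close> \<open>C > 0\<close> by (intro add_right_mono mult_left_mono) auto
      finally show "norm (e' s) \<le> C * (K * exp (2 * C * s)) + d" .
    qed
    then have "norm (e m) \<le> K / 2 * exp (2 * C * m) + d * m"
      using \<open>K \<ge> 0\<close> \<open>e 0 = 0\<close> by simp
    then have "K \<le> (K / 2 * exp (2 * C * m) + d * m) * exp (- 2 * C * m)"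
      unfolding K_def by (intro mult_right_mono) auto
    also have "\<dots> = K / 2 + d * m * exp (- 2 * C * m)"
      by (simp add: exp_minus field_simps)
    also have "\<dots> \<le> K / 2 + d * T * 1"
      using \<open>m \<le> T\<close> \<open>0 < m\<close> \<open>d \<ge> 0\<close> \<open>C > 0\<close> by (intro add_left_mono mult_mono) auto
    finally show ?thesis by simp
  qed
  have "norm (e t) \<le> K * exp (2 * C * t)" by (rule eK) fact
  also have "\<dots> \<le> (2 * d * T) * exp (2 * C * T)"
    using \<open>K \<le> 2 * d * T\<close> \<open>K \<ge> 0\<close> assms by (intro mult_mono) auto
  finally show ?thesis .
qed

text \<open>Splitting at \<open>t0\<close> and reversing time reduces this to the forward case. With
  \<open>d = 0\<close> it forces \<open>e\<close> to vanish; a small \<open>d\<close> measures how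
  far an approximate solution or a nearby orbit drifts.\<close>

lemma gronwall:
  fixes e :: "real \<Rightarrow> 'a::real_normed_vector"
  assumes "C > 0" "d \<ge> 0" and cont: "continuous_on {a..b} e" and "t0 \<in> {a..b}" "e t0 = 0"
    and deriv: "\<And>t. a < t \<Longrightarrow> t < b \<Longrightarrow> (e has_vector_derivative e' t) (at t)"
    and bound: "\<And>t. a < t \<Longrightarrow> t < b \<Longrightarrow> norm (e' t) \<le> C * norm (e t) + d"
    and "t \<in> {a..b}"
  shows "norm (e t) \<le> 2 * d * (b - a) * exp (2 * C * (b - a))"
proof -
  have mono: "2 * d * T * exp (2 * C * T) \<le> 2 * d * (b - a) * exp (2 * C * (b - a))"
    if "0 \<le> T" "T \<le> b - a" for T
    using that assms(1,2) by (intro mult_mono) auto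
  consider "t0 \<le> t" | "t \<le> t0" by linarith
  then show ?thesis
  proof cases
    case 1
    have "norm (e (t0 + (t - t0))) \<le> 2 * d * (b - t0) * exp (2 * C * (b - t0))"
    proof (rule gronwall_forward[of _ C d "\<lambda>s. e (t0 + s)" "\<lambda>s. e' (t0 + s)"])
      show "continuous_on {0..b - t0} (\<lambda>s. e (t0 + s))"
        by (rule continuous_on_compose2[OF cont]) (use assms in \<open>auto intro!: continuous_intros\<close>)
      fix s assume s: "0 < s" "s < b - t0"
      then show "norm (e' (t0 + s)) \<le> C * norm (e (t0 + s)) + d" using assms by (intro bound) auto
      have "(e has_vector_derivative e' (t0 + s)) (at (t0 + s))" using s assms by (intro deriv) auto
      then show "((\<lambda>s. e (t0 + s)) has_vector_derivative e' (t0 + s)) (at s)"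
        using vector_diff_chain_at[OF has_vector_derivative_add[OF has_vector_derivative_const has_vector_derivative_id], of e "e' (t0 + s)" t0 s]
        by (simp add: o_def)
    qed (use assms 1 in auto)
    then show ?thesis using mono[of "b - t0"] assms by simp
  next
    case 2
    have "norm (e (t0 - (t0 - t))) \<le> 2 * d * (t0 - a) * exp (2 * C * (t0 - a))"
    proof (rule gronwall_forward[of _ C d "\<lambda>s. e (t0 - s)" "\<lambda>s. - e' (t0 - s)"])
      show "continuous_on {0..t0 - a} (\<lambda>s. e (t0 - s))"
        by (rule continuous_on_compose2[OF cont]) (use assms in \<open>auto intro!: continuous_intros\<close>)
      fix s assume s: "0 < s" "s < t0 - a"
      then show "norm (- e' (t0 - s)) \<le> C * norm (e (t0 - s)) + d" using assms bound[of "t0 - s"] by auto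
      have "(e has_vector_derivative e' (t0 - s)) (at (t0 - s))" using s assms by (intro deriv) auto
      then show "((\<lambda>s. e (t0 - s)) has_vector_derivative - e' (t0 - s)) (at s)"
        using vector_diff_chain_at[OF has_vector_derivative_diff[OF has_vector_derivative_const has_vector_derivative_id], of e "e' (t0 - s)" t0 s]
        by (simp add: o_def)
    qed (use assms 2 in auto)
    then show ?thesis using mono[of "t0 - a"] assms by simp
  qed
qed

text \<open>Picard iteration: \<open>M * T \<le> R\<close> keeps the curves in the ball, and
  \<open>L * T < 1\<close> makes the integral operator a contraction in the supremum norm.\<close>

lemma autonomous_ode_solution:
  fixes F :: "'a::banach \<Rightarrow> 'a"
  assumes "T > 0" "M \<ge> 0" "L \<ge> 0" "M * T \<le> R" "L * T < 1"
    and bound: "\<And>x. x \<in> cball q R \<Longrightarrow> norm (F x) \<le> M"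
    and lip: "\<And>x y. x \<in> cball q R \<Longrightarrow> y \<in> cball q R \<Longrightarrow> norm (F x - F y) \<le> L * norm (x - y)"
  obtains u where "u 0 = q" "\<And>t. t \<in> {-T..T} \<Longrightarrow> u t \<in> cball q R"
    "\<And>t. t \<in> {-T..T} \<Longrightarrow> (u has_vector_derivative F (u t)) (at t within {-T..T})"
proof -
  let ?I = "{-T..T}"
  \<comment> \<open>This is the integral from 0 to \<open>t\<close>; the difference form also covers
    negative \<open>t\<close>.\<close>
  define J where "J f t = integral {-T..t} f - integral {-T..0} f" for f :: "real \<Rightarrow> 'a" and t
  have J0: "J f 0 = 0" for f by (simp add: J_def)
  have Jd: "(J f has_vector_derivative f t) (at t within ?I)" if "continuous_on ?I f" "t \<in> ?I" for f t
    unfolding J_def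
    using has_vector_derivative_diff[OF integral_has_vector_derivative[OF that] has_vector_derivative_const] by simp
  have J_diff: "norm (J f t - J f s) \<le> N * \<bar>t - s\<bar>"
    if "continuous_on ?I f" "\<And>s. s \<in> ?I \<Longrightarrow> norm (f s) \<le> N" "t \<in> ?I" "s \<in> ?I" for f N t s
    unfolding real_norm_def[symmetric]
  proof (rule differentiable_bound[of ?I _ "\<lambda>x h. h *\<^sub>R f x"])
    have "N \<ge> 0" using that(2)[OF that(3)] norm_ge_zero order_trans by blast
    fix x assume x: "x \<in> ?I"
    show "(J f has_derivative (\<lambda>h. h *\<^sub>R f x)) (at x within ?I)"
      using Jd[OF that(1) x] by (simp add: has_vector_derivative_def)
    show "onorm (\<lambda>h. h *\<^sub>R f x) \<le> N"
      using \<open>N \<ge> 0\<close> mult_left_mono[OF that(2)[OF x] abs_ge_zero]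
      by (intro onorm_bound) (auto simp: mult.commute[of N])
  qed (use that in auto)
  \<comment> \<open>Clamping time to the interval turns curves into bounded continuous functions on
    the whole line, which form a complete metric space.\<close>
  define c where "c t = max (-T) (min T t)" for t
  have cI: "c t \<in> ?I" for t using \<open>T > 0\<close> by (auto simp: c_def)
  have c_id: "c t = t" if "t \<in> ?I" for t using that by (auto simp: c_def)
  have cc: "continuous_on UNIV c" unfolding c_def by (intro continuous_intros)
  have "R \<ge> 0" using assms by (meson mult_nonneg_nonneg less_imp_le order_trans)
  define X where "X = {u :: real \<Rightarrow>\<^sub>C 'a. \<forall>t. u t \<in> cball q R}"
  define w where "w u t = q + J (\<lambda>s. F (u s)) (c t)" for u :: "real \<Rightarrow>\<^sub>C 'a" and t
  have cF: "continuous_on S (\<lambda>s. F (u s))" if "u \<in> X" for u and S :: "real set"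
  proof (rule continuous_on_compose2[of "cball q R" F])
    have "L-lipschitz_on (cball q R) F"
      using lip \<open>L \<ge> 0\<close> by (auto simp: lipschitz_on_def dist_norm)
    then show "continuous_on (cball q R) F" by (rule lipschitz_on_continuous_on)
  qed (use that in \<open>auto simp: X_def\<close>)
  have Fb: "norm (F (u s)) \<le> M" if "u \<in> X" for u s
    using bound that by (auto simp: X_def)
  have wball: "w u t \<in> cball q R" if "u \<in> X" for u t
  proof -
    have "norm (J (\<lambda>s. F (u s)) (c t) - J (\<lambda>s. F (u s)) 0) \<le> M * \<bar>c t - 0\<bar>"
      using cI[of t] \<open>T > 0\<close> by (intro J_diff cF Fb that) auto
    also have "\<dots> \<le> M * T"
      using cI[of t] \<open>M \<ge> 0\<close> by (intro mult_left_mono) auto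
    finally show ?thesis using \<open>M * T \<le> R\<close> by (simp add: w_def J0 dist_norm)
  qed
  have wb: "w u \<in> bcontfun" if "u \<in> X" for u
  proof (rule bcontfun_normI)
    have "continuous_on ?I (J (\<lambda>s. F (u s)))"
      using Jd[OF cF[OF that]] by (meson continuous_on_eq_continuous_within has_vector_derivative_continuous)
    then show "continuous_on UNIV (w u)"
      unfolding w_def using cI by (intro continuous_intros continuous_on_compose2[OF _ cc]) auto
    show "norm (w u t) \<le> norm q + R" for t
      using wball[OF that, of t] norm_triangle_ineq2[of "w u t" q]
      by (simp add: dist_norm norm_minus_commute)
  qed
  define G where "G u = Bcontfun (w u)" for u
  have G: "apply_bcontfun (G u) = w u" if "u \<in> X" for u
    using wb[OF that] by (simp add: G_def Bcontfun_inverse)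
  have "\<exists>!u\<in>X. G u = u"
  proof (rule Banach_fix)
    have "X = PiC UNIV (\<lambda>_. cball q R)" by (auto simp: X_def mem_PiC_iff Pi_iff)
    then have "closed X" using closed_PiC[of UNIV "\<lambda>_::real. cball q R"] by simp
    then show "complete X" by (simp add: complete_eq_closed)
    have "const_bcontfun q \<in> X" using \<open>R \<ge> 0\<close> by (simp add: X_def)
    then show "X \<noteq> {}" by blast
    show "0 \<le> L * T" using assms by simp
    show "L * T < 1" by fact
    show "G ` X \<subseteq> X" using wball G by (auto simp: X_def)
    fix u v assume uv: "u \<in> X" "v \<in> X"
    show "dist (G u) (G v) \<le> L * T * dist u v"
    proof (rule dist_bound)
      fix t
      let ?f = "\<lambda>s. F (u s)" and ?g = "\<lambda>s. F (v s)"
      have lin: "J ?f s - J ?g s = J (\<lambda>s. ?f s - ?g s) s" if "s \<in> ?I" for s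
      proof -
        have i: "?f integrable_on {-T..s}" "?g integrable_on {-T..s}" "?f integrable_on {-T..0}" "?g integrable_on {-T..0}"
          by (intro integrable_continuous_real cF uv)+
        show ?thesis by (simp add: J_def i integral_diff)
      qed
      have "norm (J (\<lambda>s. ?f s - ?g s) (c t) - J (\<lambda>s. ?f s - ?g s) 0) \<le> (L * dist u v) * \<bar>c t - 0\<bar>"
      proof (rule J_diff)
        show "continuous_on ?I (\<lambda>s. ?f s - ?g s)" by (intro continuous_on_diff cF uv)
        fix s
        have "norm (?f s - ?g s) \<le> L * norm (u s - v s)"
          using uv by (intro lip) (auto simp: X_def)
        also have "\<dots> \<le> L * dist u v"
          using dist_bounded[of u s v] \<open>L \<ge> 0\<close> by (intro mult_left_mono) (auto simp: dist_norm)
        finally show "norm (?f s - ?g s) \<le> L * dist u v" .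
      qed (use cI[of t] \<open>T > 0\<close> in auto)
      also have "\<dots> \<le> (L * dist u v) * T"
        using cI[of t] \<open>L \<ge> 0\<close> by (intro mult_left_mono) auto
      finally show "dist (G u t) (G v t) \<le> L * T * dist u v"
        using lin[OF cI[of t]] by (simp add: G uv w_def dist_norm J0 mult_ac)
    qed
  qed
  then obtain u where u: "u \<in> X" "G u = u" by blast
  have eq: "u t = w u t" for t using G[OF u(1)] u(2) by simp
  show ?thesis
  proof
    show "u 0 = q" using eq[of 0] \<open>T > 0\<close> by (simp add: w_def c_def J0)
    show "u t \<in> cball q R" for t using u(1) by (auto simp: X_def)
    have us: "u s = q + J (\<lambda>s. F (u s)) s" if "s \<in> ?I" for s
      using eq[of s] unfolding w_def c_id[OF that] .
    fix t assume t: "t \<in> ?I"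
    have "((\<lambda>t. q + J (\<lambda>s. F (u s)) t) has_vector_derivative 0 + F (u t)) (at t within ?I)"
      by (intro has_vector_derivative_add has_vector_derivative_const Jd cF u t)
    then have "((\<lambda>t. q + J (\<lambda>s. F (u s)) t) has_vector_derivative F (u t)) (at t within ?I)" by simp
    then show "(u has_vector_derivative F (u t)) (at t within ?I)"
      by (rule has_vector_derivative_transform[OF t, rotated]) (rule us)
  qed
qed

lemma has_derivative_quadratic:
  fixes f :: "'a::real_normed_vector \<Rightarrow> 'b::real_normed_vector"
  assumes "bounded_linear f'" "open S" "x \<in> S"
    and bound: "\<And>y. y \<in> S \<Longrightarrow> norm (f y - f x - f' (y - x)) \<le> C * (norm (y - x))\<^sup>2"
  shows "(f has_derivative f') (at x)"
proof -
  have "((\<lambda>y. ((f y - f x) - f' (y - x)) /\<^sub>R norm (y - x)) \<longlongrightarrow> 0) (at x)"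
  proof (rule Lim_null_comparison)
    show "\<forall>\<^sub>F y in at x. norm (((f y - f x) - f' (y - x)) /\<^sub>R norm (y - x)) \<le> C * norm (y - x)"
      using eventually_at_in_open'[OF assms(2,3)]
    proof eventually_elim
      case (elim y)
      show ?case
      proof (cases "y = x")
        case False
        have "inverse (norm (y - x)) * norm (f y - f x - f' (y - x)) \<le> inverse (norm (y - x)) * (C * (norm (y - x))\<^sup>2)"
          by (intro mult_left_mono bound elim) simp
        also have "\<dots> = C * norm (y - x)"
          using False by (simp add: power2_eq_square)
        finally show ?thesis by simp
      qed simp
    qed
    have "((\<lambda>y. C * norm (y - x)) \<longlongrightarrow> C * norm (x - x)) (at x)"
      by (intro tendsto_intros)
    then show "((\<lambda>y. C * norm (y - x)) \<longlongrightarrow> 0) (at x)" by simp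
  qed
  then show ?thesis using assms(1) unfolding has_derivative_at_within by blast
qed

text \<open>With \<open>D = T x - T q\<close>, a right inverse solves \<open>X = R0 - R0 D X\<close>
  and a left inverse \<open>Y = R0 - Y D R0\<close>; both are fixed points of contractions with
  factor \<open>1 / 2\<close>, and they coincide. The bound \<open>norm X \<le> 2 * norm R0\<close>
  and the identity \<open>R y - R x = R y (T x - T y) R x\<close> then give continuity.\<close>

lemma continuous_inverse_operator:
  fixes T :: "'a::metric_space \<Rightarrow> 'b::banach \<Rightarrow>\<^sub>L 'b"
  assumes "open V" "q \<in> V" and cont: "continuous_on V T"
    and R0: "T q o\<^sub>L R0 = id_blinfun" "R0 o\<^sub>L T q = id_blinfun"
  obtains U R where "open U" "q \<in> U" "U \<subseteq> V" "continuous_on U R"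
    "\<And>x. x \<in> U \<Longrightarrow> T x o\<^sub>L R x = id_blinfun" "\<And>x. x \<in> U \<Longrightarrow> R x o\<^sub>L T x = id_blinfun"
proof -
  \<comment> \<open>The summand 1 avoids division by zero when \<open>R0 = 0\<close>, which happens
    in dimension 0.\<close>
  define \<epsilon> where "\<epsilon> = 1 / (2 * (norm R0 + 1))"
  have "\<epsilon> > 0" by (simp add: \<epsilon>_def add_nonneg_pos)
  have small: "norm R0 * \<epsilon> \<le> 1/2" by (simp add: \<epsilon>_def divide_simps add_nonneg_pos)
  define U where "U = V \<inter> T -` ball (T q) \<epsilon>"
  have "open U" unfolding U_def using cont \<open>open V\<close> by (simp add: continuous_on_open_vimage Int_commute)
  have "q \<in> U" using \<open>q \<in> V\<close> \<open>\<epsilon> > 0\<close> by (simp add: U_def)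
  have close: "norm (T x - T q) \<le> \<epsilon>" if "x \<in> U" for x
    using that by (simp add: U_def dist_norm norm_minus_commute less_imp_le)
  have ass: "(X o\<^sub>L Y) o\<^sub>L Z = X o\<^sub>L (Y o\<^sub>L Z)" for X Y Z :: "'b \<Rightarrow>\<^sub>L 'b"
    by (rule blinfun_eqI) simp
  have idl: "id_blinfun o\<^sub>L X = X" "X o\<^sub>L id_blinfun = X" for X :: "'b \<Rightarrow>\<^sub>L 'b"
    by (rule blinfun_eqI, simp)+
  note bil = bounded_bilinear.diff_left[OF bounded_bilinear_blinfun_compose]
    bounded_bilinear.diff_right[OF bounded_bilinear_blinfun_compose]
  have ex: "\<exists>R. T x o\<^sub>L R = id_blinfun \<and> R o\<^sub>L T x = id_blinfun \<and> norm R \<le> 2 * norm R0" if "x \<in> U" for x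
  proof -
    define D where "D = T x - T q"
    have RD: "norm (R0 o\<^sub>L D) \<le> 1/2" "norm (D o\<^sub>L R0) \<le> 1/2"
      using norm_blinfun_compose[of R0 D] norm_blinfun_compose[of D R0] small
        mult_left_mono[OF close[OF that], of "norm R0"] unfolding D_def by (auto simp: mult.commute)
    have "\<exists>!X. R0 - ((R0 o\<^sub>L D) o\<^sub>L X) = X"
    proof (rule banach_fix_type[of "1/2"]; (intro allI)?)
      fix X Y :: "'b \<Rightarrow>\<^sub>L 'b"
      have "norm ((R0 o\<^sub>L D) o\<^sub>L (Y - X)) \<le> 1/2 * norm (Y - X)"
        by (rule order_trans[OF norm_blinfun_compose mult_right_mono[OF RD(1)]]) simp
      then show "dist (R0 - ((R0 o\<^sub>L D) o\<^sub>L X)) (R0 - ((R0 o\<^sub>L D) o\<^sub>L Y)) \<le> 1/2 * dist X Y"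
        by (simp add: dist_norm bil norm_minus_commute)
    qed auto
    then obtain X where X: "R0 - ((R0 o\<^sub>L D) o\<^sub>L X) = X" by blast
    have "\<exists>!Y. R0 - (Y o\<^sub>L (D o\<^sub>L R0)) = Y"
    proof (rule banach_fix_type[of "1/2"]; (intro allI)?)
      fix X Y :: "'b \<Rightarrow>\<^sub>L 'b"
      have "norm ((Y - X) o\<^sub>L (D o\<^sub>L R0)) \<le> norm (Y - X) * (1/2)"
        by (rule order_trans[OF norm_blinfun_compose mult_left_mono[OF RD(2)]]) simp
      then show "dist (R0 - (X o\<^sub>L (D o\<^sub>L R0))) (R0 - (Y o\<^sub>L (D o\<^sub>L R0))) \<le> 1/2 * dist X Y"
        by (simp add: dist_norm bil norm_minus_commute)
    qed auto
    then obtain Y where Y: "R0 - (Y o\<^sub>L (D o\<^sub>L R0)) = Y" by blast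
    have Tx: "T x = T q + D" by (simp add: D_def)
    have "T q o\<^sub>L (R0 - ((R0 o\<^sub>L D) o\<^sub>L X)) = id_blinfun - (D o\<^sub>L X)"
      by (simp add: bil R0 ass[symmetric] idl)
    then have TX: "T x o\<^sub>L X = id_blinfun"
      using X by (simp add: Tx bounded_bilinear.add_left[OF bounded_bilinear_blinfun_compose])
    have "(R0 - (Y o\<^sub>L (D o\<^sub>L R0))) o\<^sub>L T q = id_blinfun - (Y o\<^sub>L D)"
      by (simp add: bil R0 ass idl)
    then have YT: "Y o\<^sub>L T x = id_blinfun"
      using Y by (simp add: Tx bounded_bilinear.add_right[OF bounded_bilinear_blinfun_compose])
    have "Y = X" using TX YT ass[of Y "T x" X] by (simp add: idl)
    have "norm X \<le> norm R0 + norm ((R0 o\<^sub>L D) o\<^sub>L X)"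
      using norm_triangle_ineq4[of R0 "(R0 o\<^sub>L D) o\<^sub>L X"] X by simp
    also have "norm ((R0 o\<^sub>L D) o\<^sub>L X) \<le> 1/2 * norm X"
      by (rule order_trans[OF norm_blinfun_compose mult_right_mono[OF RD(1)]]) simp
    finally show ?thesis using TX YT \<open>Y = X\<close> by auto
  qed
  then obtain R where R: "\<And>x. x \<in> U \<Longrightarrow> T x o\<^sub>L R x = id_blinfun"
    "\<And>x. x \<in> U \<Longrightarrow> R x o\<^sub>L T x = id_blinfun" "\<And>x. x \<in> U \<Longrightarrow> norm (R x) \<le> 2 * norm R0"
    by metis
  have "continuous_on U R"
    unfolding continuous_on_def
  proof (intro ballI)
    fix x assume x: "x \<in> U"
    have "((\<lambda>y. R y - R x) \<longlongrightarrow> 0) (at x within U)"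
    proof (rule Lim_null_comparison)
      show "\<forall>\<^sub>F y in at x within U. norm (R y - R x) \<le> 2 * norm R0 * norm (T x - T y) * norm (R x)"
        unfolding eventually_at_filter
      proof (intro always_eventually allI impI)
        fix y assume y: "y \<in> U"
        have "R y - R x = R y o\<^sub>L (T x - T y) o\<^sub>L R x"
          by (simp add: bil ass R x y idl)
        also have "norm \<dots> \<le> norm (R y) * norm (T x - T y) * norm (R x)"
          by (rule order_trans[OF norm_blinfun_compose mult_right_mono[OF norm_blinfun_compose]]) simp
        also have "\<dots> \<le> 2 * norm R0 * norm (T x - T y) * norm (R x)"
          by (intro mult_right_mono R y) auto
        finally show "norm (R y - R x) \<le> 2 * norm R0 * norm (T x - T y) * norm (R x)" .
      qed
      have "(T \<longlongrightarrow> T x) (at x within U)"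
        using cont x by (auto simp: U_def continuous_on_def intro: tendsto_within_subset)
      then have "((\<lambda>y. 2 * norm R0 * norm (T x - T y) * norm (R x)) \<longlongrightarrow> 2 * norm R0 * norm (T x - T x) * norm (R x)) (at x within U)"
        by (intro tendsto_intros)
      then show "((\<lambda>y. 2 * norm R0 * norm (T x - T y) * norm (R x)) \<longlongrightarrow> 0) (at x within U)" by simp
    qed
    then show "(R \<longlongrightarrow> R x) (at x within U)" by (simp add: Lim_null[of R "R x"])
  qed
  with \<open>open U\<close> \<open>q \<in> U\<close> R(1,2) show ?thesis using that[of U R] by (auto simp: U_def)
qed

text \<open>Subtracting from \<open>w\<close> its projection onto the range leaves a vector
  orthogonal to the range, which must be 0. An orthonormal basis of the range makes the projection
  explicit.\<close>

lemma (in orthonormal_basis) surj_if_orthogonal_complement_trivial: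
  fixes f :: "'e \<Rightarrow> 'e"
  assumes "linear f" "\<And>a. (\<And>b. a \<bullet> f b = 0) \<Longrightarrow> a = 0"
  shows "surj f"
proof -
  obtain C where C: "finite C" "\<And>a b. a \<in> C \<Longrightarrow> b \<in> C \<Longrightarrow> a \<bullet> b = (if a = b then 1 else 0)"
    "span C = span (f ` B)"
    using orthonormal_basis_of_span[of "f ` B"] finite_B by auto
  have rng: "span C = range f"
    using linear_span_image[OF assms(1), of B] C(3) span_B by simp
  have "w \<in> range f" for w
  proof -
    define p where "p = (\<Sum>c\<in>C. (w \<bullet> c) *\<^sub>R c)"
    have p: "p \<in> span C" unfolding p_def by (intro span_sum span_scale span_base)
    have "(w - p) \<bullet> f b = 0" for b
    proof -
      have "f b \<in> span C" using rng by simp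
      then have fb: "f b = (\<Sum>c\<in>C. (f b \<bullet> c) *\<^sub>R c)" using orthonormal_expansion[OF C(1,2)] by simp
      have "w \<bullet> f b = (\<Sum>c\<in>C. (f b \<bullet> c) * (w \<bullet> c))"
        by (subst fb) (simp add: inner_sum_right)
      also have "\<dots> = p \<bullet> f b"
        unfolding p_def inner_sum_left by (intro sum.cong) (auto simp: inner_commute)
      finally show ?thesis by (simp add: inner_diff_left)
    qed
    then have "w - p = 0" by (rule assms(2))
    then show ?thesis using p rng by simp
  qed
  then show ?thesis by blast
qed

section \<open>Local integrability of the characteristic distribution\<close>

text \<open>\<open>P x\<close> is the map from covectors to vectors given by the bivector at \<open>x\<close>, covectors being
  identified with vectors.\<close>

locale local_poisson = orthonormal_basis B
  for B :: "'e::{real_inner,banach,heine_borel} set" +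
  fixes V :: "'e set" and P :: "'e \<Rightarrow> 'e \<Rightarrow>\<^sub>L 'e"
  assumes open_V: "open V" and smooth_P: "smooth_on V P"
    and skew_P: "x \<in> V \<Longrightarrow> a \<bullet> P x b = - (P x a \<bullet> b)"
    and jacobi: "x \<in> V \<Longrightarrow>
      c \<bullet> frechet_derivative P (at x) (P x a) b + a \<bullet> frechet_derivative P (at x) (P x b) c
        + b \<bullet> frechet_derivative P (at x) (P x c) a = 0"
begin

abbreviation dP :: "'e \<Rightarrow> 'e \<Rightarrow> 'e \<Rightarrow>\<^sub>L 'e" where
  "dP x v \<equiv> frechet_derivative P (at x) v"

lemma has_derivative_P: "x \<in> V \<Longrightarrow> (P has_derivative dP x) (at x)"
  using smooth_on_derivative(1)[OF smooth_P] .

lemma skew_dP: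
  assumes "x \<in> V"
  shows "a \<bullet> dP x v b = - (dP x v a \<bullet> b)"
proof -
  have 1: "((\<lambda>x. a \<bullet> P x b) has_derivative (\<lambda>v. a \<bullet> dP x v b)) (at x)"
    by (rule bounded_linear.has_derivative[OF bounded_linear_inner_right
          bounded_linear.has_derivative[OF blinfun.bounded_linear_left has_derivative_P[OF assms]]])
  have "((\<lambda>x. - (P x a \<bullet> b)) has_derivative (\<lambda>v. - (dP x v a \<bullet> b))) (at x)"
    by (rule has_derivative_minus[OF bounded_linear.has_derivative[OF bounded_linear_inner_left
          bounded_linear.has_derivative[OF blinfun.bounded_linear_left has_derivative_P[OF assms]]]])
  then have 2: "((\<lambda>x. a \<bullet> P x b) has_derivative (\<lambda>v. - (dP x v a \<bullet> b))) (at x)"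
    by (rule has_derivative_transform_within_open[OF _ open_V assms]) (simp add: skew_P)
  show ?thesis using fun_cong[OF has_derivative_unique[OF 1 2], of v] .
qed

text \<open>\<open>S x\<close> inverts the nondegenerate block \<open>Q \<circ> P x \<circ> Q\<close>, where \<open>Q\<close> is the orthogonal projection onto
  the range of \<open>P q\<close>.\<close>

lemma partial_inverse:
  assumes q: "q \<in> V"
  obtains Q :: "'e \<Rightarrow>\<^sub>L 'e" and S :: "'e \<Rightarrow> 'e \<Rightarrow>\<^sub>L 'e" and U
  where "open U" "q \<in> U" "U \<subseteq> V" "smooth_on U S"
    "\<And>x v. x \<in> U \<Longrightarrow> S x (Q v) = S x v"
    "\<And>x v. x \<in> U \<Longrightarrow> Q (S x v) = S x v"
    "\<And>x v. x \<in> U \<Longrightarrow> Q (P x (S x v)) = Q v"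
    "\<And>x v. x \<in> U \<Longrightarrow> S x (P x (Q v)) = Q v"
    "\<And>x. x \<in> U \<Longrightarrow> (S has_derivative (\<lambda>v. - (S x o\<^sub>L dP x v o\<^sub>L S x))) (at x)"
    "\<And>a b. a \<bullet> Q b = Q a \<bullet> b"
    "\<And>v. P q (S q (P q v)) = P q v"
proof -
  obtain C where C: "finite C" "\<And>a b. a \<in> C \<Longrightarrow> b \<in> C \<Longrightarrow> a \<bullet> b = (if a = b then 1 else 0)"
    "span C = span (P q ` B)"
    using orthonormal_basis_of_span[of "P q ` B"] finite_B by auto
  have linP: "linear (P q)" by (rule bounded_linear.linear[OF blinfun.bounded_linear_right])
  have rng: "span C = range (P q)"
    using linear_span_image[OF linP, of B] C(3) span_B by simp
  define Q where "Q = Blinfun (\<lambda>v. \<Sum>c\<in>C. (v \<bullet> c) *\<^sub>R c)"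
  have "bounded_linear (\<lambda>v. \<Sum>c\<in>C. (v \<bullet> c) *\<^sub>R c)"
    by (intro bounded_linear_intros)
  then have Q: "Q v = (\<Sum>c\<in>C. (v \<bullet> c) *\<^sub>R c)" for v
    by (simp add: Q_def bounded_linear_Blinfun_apply)
  have Qspan: "Q v = v" if "v \<in> span C" for v
    using orthonormal_expansion[OF C(1,2) that] by (simp add: Q)
  have Qin: "Q v \<in> span C" for v unfolding Q by (intro span_sum span_scale span_base)
  have QQ: "Q (Q v) = Q v" for v by (rule Qspan[OF Qin])
  have Qsym: "a \<bullet> Q b = Q a \<bullet> b" for a b
    unfolding Q inner_sum_left inner_sum_right by (intro sum.cong) (auto simp: inner_commute)
  have QP: "Q (P q v) = P q v" for v by (rule Qspan) (simp add: rng)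
  \<comment> \<open>Skewness of \<open>P q\<close> turns the statement about its range into one
    about its kernel: \<open>P q\<close> only sees the component \<open>Q v\<close>.\<close>
  have PQ: "P q (Q v) = P q v" for v
  proof -
    have "a \<bullet> P q (Q v) = a \<bullet> P q v" for a
    proof -
      have "a \<bullet> P q (Q v) = - (Q (P q a) \<bullet> v)" using skew_P[OF q, of a "Q v"] by (simp add: Qsym)
      then show ?thesis using skew_P[OF q, of a v] by (simp add: QP)
    qed
    then show ?thesis using vector_eq_ldot[of "P q (Q v)" "P q v"] by blast
  qed
  \<comment> \<open>Adding the identity on the orthogonal complement completes the block to an
    operator on the whole space, so that it can be inverted there.\<close>
  define T where "T x = (Q o\<^sub>L P x o\<^sub>L Q) + (id_blinfun - Q)" for x
  have T: "T x v = Q (P x (Q v)) + (v - Q v)" for x v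
    by (simp add: T_def blinfun.bilinear_simps)
  have T0: "T q v = P q v + (v - Q v)" for v by (simp add: T QP PQ)
  \<comment> \<open>The kernel of a skew operator is orthogonal to its range, so they meet only in
    0.\<close>
  have zero: "a = 0" if Pa: "P q a = 0" and Qa: "Q a = a" for a
  proof -
    obtain w where w: "a = P q w" using Qin[of a] Qa rng by auto
    have "a \<bullet> a = a \<bullet> P q w" by (simp add: w[symmetric])
    also have "\<dots> = 0" using skew_P[OF q, of a w] Pa by simp
    finally show ?thesis by simp
  qed
  have injT: "v = 0" if "T q v = 0" for v
  proof -
    have "Q (T q v) = P q v" by (simp add: T0 blinfun.bilinear_simps QP QQ)
    then have P0: "P q v = 0" using that by simp
    then have "Q v = v" using that by (simp add: T0)
    then show ?thesis using zero P0 by blast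
  qed
  have "surj (T q)"
  proof (rule surj_if_orthogonal_complement_trivial)
    show "linear (T q)" by (rule bounded_linear.linear[OF blinfun.bounded_linear_right])
    fix a assume a: "\<And>b. a \<bullet> T q b = 0"
    have "a \<bullet> T q b = (- P q a + (a - Q a)) \<bullet> b" for b
      using skew_P[OF q, of a b] Qsym[of a b] by (simp add: T0 inner_diff_left inner_diff_right inner_add_left inner_add_right)
    then have e: "- P q a + (a - Q a) = 0"
      using a inner_eq_zero_iff[of "- P q a + (a - Q a)"] by metis
    then have "Q (- P q a + (a - Q a)) = 0" by simp
    then have "P q a = 0" by (simp add: blinfun.bilinear_simps QP QQ)
    moreover then have "Q a = a" using e by simp
    ultimately show "a = 0" by (rule zero)
  qed
  define f where "f = inv (T q)"
  have Tf: "T q (f v) = v" for v using \<open>surj (T q)\<close> by (simp add: f_def surj_f_inv_f)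
  have inj: "v = w" if "T q v = T q w" for v w
    using injT[of "v - w"] that by (simp add: blinfun.diff_right)
  have "linear f"
    by (rule linearI; rule inj) (simp_all add: Tf blinfun.bilinear_simps)
  then have bf: "bounded_linear f" by (rule linear_imp_bounded_linear)
  define R0 where "R0 = Blinfun f"
  have R0: "R0 v = f v" for v using bf by (simp add: R0_def bounded_linear_Blinfun_apply)
  have "T q o\<^sub>L R0 = id_blinfun" by (rule blinfun_eqI) (simp add: R0 Tf)
  moreover have "R0 o\<^sub>L T q = id_blinfun" by (rule blinfun_eqI, rule inj) (simp add: R0 Tf)
  moreover have smT: "smooth_on V T"
    unfolding T_def
    by (intro smooth_on_add smooth_on_const open_V smooth_on_bilinear[OF bounded_bilinear_blinfun_compose] smooth_P)
  ultimately obtain U R where U: "open U" "q \<in> U" "U \<subseteq> V" "continuous_on U R"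
    and R: "\<And>x. x \<in> U \<Longrightarrow> T x o\<^sub>L R x = id_blinfun" "\<And>x. x \<in> U \<Longrightarrow> R x o\<^sub>L T x = id_blinfun"
    using continuous_inverse_operator[OF open_V q smooth_on_imp_continuous_on[OF smT]] by blast
  have smR: "smooth_on U R"
    by (rule smooth_on_inverse_operator[OF U(1) smooth_on_subset[OF smT U(3)] U(4) R])
  have TR: "T x (R x v) = v" and RT: "R x (T x v) = v" if "x \<in> U" for x v
    using R[OF that] by (metis blinfun_apply_blinfun_compose blinfun_apply_id_blinfun)+
  have TQ: "T x (Q v) = Q (P x (Q v))" "Q (T x v) = Q (P x (Q v))" for x v
    by (simp_all add: T QQ blinfun.bilinear_simps)
  \<comment> \<open>\<open>T x\<close> commutes with \<open>Q\<close>, since both products are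
    \<open>Q P x Q\<close>; hence so does its inverse.\<close>
  have QR: "Q (R x v) = R x (Q v)" if "x \<in> U" for x v
  proof -
    have "Q (R x v) = R x (T x (Q (R x v)))" by (simp add: RT that)
    also have "\<dots> = R x (Q (T x (R x v)))" by (simp only: TQ)
    finally show ?thesis by (simp add: TR that)
  qed
  \<comment> \<open>The inverse of the block, extended by 0 to the complement. The surrounding
    factors \<open>Q\<close> are absorbed by \<open>S\<close>, so its derivative contains
    \<open>dP\<close> without projections.\<close>
  define S where "S x = R x o\<^sub>L Q" for x
  have S: "S x v = R x (Q v)" for x v by (simp add: S_def)
  show ?thesis
  proof
    show "smooth_on U S" unfolding S_def
      by (intro smooth_on_bilinear[OF bounded_bilinear_blinfun_compose] smR smooth_on_const U)
    show "S x (Q v) = S x v" "Q (S x v) = S x v" if "x \<in> U" for x v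
      by (simp_all add: S QQ QR that)
    show 1: "Q (P x (S x v)) = Q v" if "x \<in> U" for x v
    proof -
      have e: "Q (S x v) = S x v" by (simp add: S QR that QQ)
      have "Q (P x (S x v)) = T x (S x v)" using TQ(1)[of x "S x v"] by (simp add: e)
      also have "\<dots> = Q v" by (simp add: S TR that)
      finally show ?thesis .
    qed
    show 2: "S x (P x (Q v)) = Q v" if "x \<in> U" for x v
      using RT[OF that, of "Q v"] by (simp add: S TQ)
    show "(S has_derivative (\<lambda>v. - (S x o\<^sub>L dP x v o\<^sub>L S x))) (at x)" if x: "x \<in> U" for x
    proof -
      have dT: "(T has_derivative (\<lambda>v. Q o\<^sub>L dP x v o\<^sub>L Q)) (at x)"
        unfolding T_def
      proof -
        have "((\<lambda>x. (Q o\<^sub>L P x o\<^sub>L Q) + (id_blinfun - Q)) has_derivative (\<lambda>v. (Q o\<^sub>L dP x v o\<^sub>L Q) + 0)) (at x)"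
          using x U(3)
          by (intro has_derivative_add has_derivative_const has_derivative_P
              bounded_linear.has_derivative[OF bounded_bilinear.bounded_linear_left[OF bounded_bilinear_blinfun_compose]]
              bounded_linear.has_derivative[OF bounded_bilinear.bounded_linear_right[OF bounded_bilinear_blinfun_compose]]) auto
        then show "((\<lambda>x. (Q o\<^sub>L P x o\<^sub>L Q) + (id_blinfun - Q)) has_derivative (\<lambda>v. Q o\<^sub>L dP x v o\<^sub>L Q)) (at x)" by simp
      qed
      have "(S has_derivative (\<lambda>v. - (R x o\<^sub>L (Q o\<^sub>L dP x v o\<^sub>L Q) o\<^sub>L R x) o\<^sub>L Q)) (at x)"
        unfolding S_def
        by (rule bounded_linear.has_derivative[OF bounded_bilinear.bounded_linear_left[OF bounded_bilinear_blinfun_compose]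
              has_derivative_inverse_operator[OF U(1) x dT U(4) R]])
      moreover have "- (R x o\<^sub>L (Q o\<^sub>L dP x v o\<^sub>L Q) o\<^sub>L R x) o\<^sub>L Q = - (S x o\<^sub>L dP x v o\<^sub>L S x)" for v
        by (rule blinfun_eqI) (simp add: S QR[OF x] QQ blinfun.bilinear_simps)
      ultimately show ?thesis by simp
    qed
    show "a \<bullet> Q b = Q a \<bullet> b" for a b by (rule Qsym)
    show "P q (S q (P q v)) = P q v" for v
    proof -
      obtain w where w: "S q (P q (Q v)) = w" "w = Q v" using 2[OF U(2)] by blast
      then show ?thesis by (simp add: PQ)
    qed
  qed (use U in auto)
qed

end

section \<open>The Dirac bracket and the plaque through a point\<close>

locale split_poisson = local_poisson B V P
  for B :: "'e::{real_inner,banach,heine_borel} set" and V P +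
  fixes q :: 'e and Q :: "'e \<Rightarrow>\<^sub>L 'e" and S :: "'e \<Rightarrow> 'e \<Rightarrow>\<^sub>L 'e" and U
  assumes open_U: "open U" and q_U: "q \<in> U" and U_V: "U \<subseteq> V" and smooth_S: "smooth_on U S"
    and SQ: "\<And>x v. x \<in> U \<Longrightarrow> S x (Q v) = S x v"
    and QS: "\<And>x v. x \<in> U \<Longrightarrow> Q (S x v) = S x v"
    and QPS: "\<And>x v. x \<in> U \<Longrightarrow> Q (P x (S x v)) = Q v"
    and SPQ: "\<And>x v. x \<in> U \<Longrightarrow> S x (P x (Q v)) = Q v"
    and has_derivative_S: "\<And>x. x \<in> U \<Longrightarrow> (S has_derivative (\<lambda>v. - (S x o\<^sub>L dP x v o\<^sub>L S x))) (at x)"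
    and Q_sym: "\<And>a b. a \<bullet> Q b = Q a \<bullet> b"
    and PSP_q: "\<And>v. P q (S q (P q v)) = P q v"
begin

lemma skew_S:
  assumes "x \<in> U"
  shows "a \<bullet> S x b = - (S x a \<bullet> b)"
proof -
  have xV: "x \<in> V" using assms U_V by blast
  have "a \<bullet> S x b = Q a \<bullet> S x b" using QS[OF assms] Q_sym by metis
  also have "\<dots> = P x (S x a) \<bullet> S x b" using QPS[OF assms] QS[OF assms] Q_sym by metis
  also have "\<dots> = - (S x a \<bullet> P x (S x b))" using skew_P[OF xV, of "S x a" "S x b"] by simp
  also have "\<dots> = - (S x a \<bullet> b)" using QPS[OF assms] QS[OF assms] Q_sym by metis
  finally show ?thesis .
qed

text \<open>The Dirac bracket of the linear coordinates, for which those on the range of \<open>P q\<close> are Casimirs.\<close>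

definition dirac :: "'e \<Rightarrow> 'e \<Rightarrow>\<^sub>L 'e" where
  "dirac x = P x - (P x o\<^sub>L S x o\<^sub>L P x)"

text \<open>\<open>lift x v\<close> is the vector over \<open>Q v\<close> that is spanned by the Hamiltonian vector fields of
  these coordinates.\<close>

definition lift :: "'e \<Rightarrow> 'e \<Rightarrow>\<^sub>L 'e" where
  "lift x = P x o\<^sub>L S x"

definition dlift :: "'e \<Rightarrow> 'e \<Rightarrow> 'e \<Rightarrow>\<^sub>L 'e" where
  "dlift x v = (dP x v o\<^sub>L S x) - (P x o\<^sub>L (S x o\<^sub>L dP x v o\<^sub>L S x))"

lemma has_derivative_lift:
  assumes "x \<in> U"
  shows "(lift has_derivative dlift x) (at x)"
proof -
  have "x \<in> V" using assms U_V by blast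
  then show ?thesis
    using bounded_bilinear.FDERIV[OF bounded_bilinear_blinfun_compose has_derivative_P has_derivative_S[OF assms]]
    by (simp add: lift_def[abs_def] dlift_def[abs_def] bounded_bilinear.minus_right[OF bounded_bilinear_blinfun_compose])
qed

lemma smooth_lift: "smooth_on U lift"
  unfolding lift_def
  by (intro smooth_on_bilinear[OF bounded_bilinear_blinfun_compose] smooth_S open_U smooth_on_subset[OF smooth_P U_V])

lemma lift_Q: "x \<in> U \<Longrightarrow> lift x (Q v) = lift x v"
  by (simp add: lift_def SQ)

text \<open>\<open>P\<close> and \<open>S\<close> are skew, so \<open>1 - S P\<close> is the adjoint
  of \<open>1 - P S\<close>. This moves the projection from a vector to the covector
  \<open>c - S (P c)\<close>, whose Hamiltonian vector is \<open>dirac x c\<close>.\<close>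

lemma adjoint_PS:
  assumes "x \<in> U"
  shows "c \<bullet> (v - P x (S x v)) = (c - S x (P x c)) \<bullet> v"
  using skew_P[of x c "S x v"] skew_S[OF assms, of "P x c" v] U_V assms
  by (auto simp: inner_diff_left inner_diff_right)

lemma P_complement: "P x (c - S x (P x c)) = dirac x c"
  by (simp add: dirac_def blinfun.bilinear_simps)

text \<open>Vanishing curvature of the horizontal distribution. Pairing with \<open>c\<close>
  replaces it by \<open>d = c - S (P c)\<close>, and \<open>P d = dirac c = 0\<close>. So one of the
  three terms of the Jacobi identity for \<open>d\<close>, \<open>S y\<close>, \<open>S v\<close>
  drops out, and by skewness the other two are the two sides here.\<close>

lemma lift_flat:
  assumes "x \<in> U" "dirac x = 0"
  shows "dlift x (lift x y) v = dlift x (lift x v) y"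
proof -
  have xV: "x \<in> V" using assms U_V by blast
  have "c \<bullet> dlift x (lift x y) v = c \<bullet> dlift x (lift x v) y" for c
  proof -
    define d where "d = c - S x (P x c)"
    have Pd: "P x d = 0" using P_complement[of x c] assms(2) by (simp add: d_def)
    have zero: "dP x 0 = 0"
      using has_derivative_bounded_linear[OF has_derivative_P[OF xV]] by (simp add: linear_simps)
    have eq: "c \<bullet> dlift x (lift x y) v = d \<bullet> dP x (P x (S x y)) (S x v)" for y v
      using adjoint_PS[OF assms(1), of c "dP x (P x (S x y)) (S x v)"]
      by (simp add: dlift_def lift_def d_def blinfun.bilinear_simps)
    show ?thesis
      unfolding eq
      using jacobi[OF xV, of d "S x y" "S x v"] skew_dP[OF xV, of "S x y" "P x (S x v)" d] Pd zero
      by (simp add: inner_commute)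
  qed
  then show ?thesis using vector_eq_ldot[of "dlift x (lift x y) v" "dlift x (lift x v) y"] by blast
qed

text \<open>The Lie derivative of \<open>P\<close> along a Hamiltonian vector field vanishes, hence the Dirac bracket
  satisfies a homogeneous linear equation along Hamiltonian curves.\<close>

lemma dirac_zero_along_curve:
  assumes K: "compact K" "K \<subseteq> U" and "t0 \<in> {a..b}" "\<gamma> t0 = q"
    and cont: "continuous_on {a..b} \<gamma>" and \<gamma>K: "\<And>t. t \<in> {a..b} \<Longrightarrow> \<gamma> t \<in> K"
    and deriv: "\<And>t. a < t \<Longrightarrow> t < b \<Longrightarrow> (\<gamma> has_vector_derivative P (\<gamma> t) (h t)) (at t)"
    and h: "\<And>t. a < t \<Longrightarrow> t < b \<Longrightarrow> norm (h t) \<le> M"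
    and t: "t \<in> {a..b}"
  shows "dirac (\<gamma> t) = 0"
proof -
  have cP: "continuous_on K P" and cS: "continuous_on K S"
    using smooth_on_imp_continuous_on[OF smooth_P] smooth_on_imp_continuous_on[OF smooth_S] K U_V
    by (auto intro: continuous_on_subset)
  obtain L where L: "L \<ge> 0" "\<And>x v. x \<in> K \<Longrightarrow> norm (dP x v) \<le> L * norm v"
    using C1_bounded_derivative[OF coordinate_system_B _ K(1), of V P] smooth_P K(2) U_V
    unfolding smooth_on_def by blast
  have "bounded ((\<lambda>x. S x o\<^sub>L P x) ` K)"
    by (intro compact_imp_bounded compact_continuous_image bounded_bilinear.continuous_on[OF bounded_bilinear_blinfun_compose] cP cS K)
  then obtain N where N: "\<And>x. x \<in> K \<Longrightarrow> norm (S x o\<^sub>L P x) \<le> N" by (auto simp: bounded_iff)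
  have "N \<ge> 0" using N[OF \<gamma>K[OF t]] norm_ge_zero order_trans by blast
  have comp: "norm (c - S x (P x c)) \<le> (1 + N) * norm c" if "x \<in> K" for x c
  proof -
    have "norm (S x (P x c)) \<le> norm (S x o\<^sub>L P x) * norm c"
      using norm_blinfun[of "S x o\<^sub>L P x" c] by simp
    also have "\<dots> \<le> N * norm c" using N[OF that] by (intro mult_right_mono) auto
    finally show ?thesis using norm_triangle_ineq4[of c "S x (P x c)"] by (simp add: algebra_simps)
  qed
  define E where "E x v = dP x v - ((P x o\<^sub>L S x o\<^sub>L dP x v) + ((P x o\<^sub>L - (S x o\<^sub>L dP x v o\<^sub>L S x)) + (dP x v o\<^sub>L S x) o\<^sub>L P x))" for x v
  have dE: "(dirac has_derivative E x) (at x)" if "x \<in> U" for x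
  proof -
    have xV: "x \<in> V" using that U_V by blast
    show ?thesis
      unfolding dirac_def[abs_def] E_def[abs_def]
      by (intro has_derivative_diff has_derivative_P[OF xV] has_derivative_S[OF that]
          bounded_bilinear.FDERIV[OF bounded_bilinear_blinfun_compose])
  qed
  \<comment> \<open>The product rule collapses to \<open>(1 - P S) P' (1 - S P)\<close>.\<close>
  have E: "c \<bullet> E x v b = (c - S x (P x c)) \<bullet> dP x v (b - S x (P x b))" if "x \<in> U" for x v c b
    using adjoint_PS[OF that, of c "dP x v (b - S x (P x b))"]
    by (simp add: E_def blinfun.bilinear_simps inner_diff_left inner_diff_right inner_add_left inner_add_right)
  define k where "k = 2 * (1 + N) * L * (\<bar>M\<bar> + 1)"
  have "k \<ge> 0" using L \<open>N \<ge> 0\<close> by (simp add: k_def)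
  have bound: "norm (E x (P x g)) \<le> k * norm (dirac x)" if x: "x \<in> K" and g: "norm g \<le> M" for x g
  proof (rule norm_blinfun_bound)
    show "0 \<le> k * norm (dirac x)" using \<open>k \<ge> 0\<close> by simp
    fix b
    have xU: "x \<in> U" and xV: "x \<in> V" using x K U_V by auto
    let ?w = "E x (P x g) b"
    have main: "\<bar>c \<bullet> ?w\<bar> \<le> norm c * (k * norm (dirac x) * norm b)" for c
    proof -
      define c' where "c' = c - S x (P x c)"
      define b' where "b' = b - S x (P x b)"
      have c'b': "P x c' = dirac x c" "P x b' = dirac x b" by (simp_all add: c'_def b'_def P_complement)
      have nc: "norm c' \<le> (1 + N) * norm c" "norm b' \<le> (1 + N) * norm b"
        using comp[OF x] by (simp_all add: c'_def b'_def)
      have dn: "\<bar>u \<bullet> dP x (dirac x w) g\<bar> \<le> norm u * (L * (norm (dirac x) * norm w) * \<bar>M\<bar>)" for u w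
      proof -
        have "\<bar>u \<bullet> dP x (dirac x w) g\<bar> \<le> norm u * norm (dP x (dirac x w) g)" by (rule Cauchy_Schwarz_ineq2)
        also have "\<dots> \<le> norm u * (norm (dP x (dirac x w)) * norm g)"
          by (intro mult_left_mono norm_blinfun) auto
        also have "\<dots> \<le> norm u * ((L * norm (dirac x w)) * \<bar>M\<bar>)"
          using L(2)[OF x, of "dirac x w"] L(1) g by (intro mult_left_mono mult_mono) auto
        also have "\<dots> \<le> norm u * ((L * (norm (dirac x) * norm w)) * \<bar>M\<bar>)"
          using L(1) by (intro mult_left_mono mult_right_mono norm_blinfun) auto
        finally show ?thesis .
      qed
      have "c \<bullet> ?w = c' \<bullet> dP x (P x g) b'" by (simp add: E[OF xU] c'_def b'_def)
      \<comment> \<open>The Jacobi identity for \<open>c'\<close>, \<open>g\<close>,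
        \<open>b'\<close> trades the derivative in the direction \<open>P x g\<close> for
        derivatives in the directions \<open>P x b' = dirac x b\<close> and
        \<open>P x c' = dirac x c\<close>. This makes the right-hand side linear in
        \<open>dirac x\<close>.\<close>
      also have "\<dots> = c' \<bullet> dP x (P x b') g - b' \<bullet> dP x (P x c') g"
        using jacobi[OF xV, of c' g b'] skew_dP[OF xV, of g "P x b'" c'] by (simp add: inner_commute)
      also have "\<bar>\<dots>\<bar> \<le> norm c' * (L * (norm (dirac x) * norm b) * \<bar>M\<bar>) + norm b' * (L * (norm (dirac x) * norm c) * \<bar>M\<bar>)"
        unfolding c'b' using dn[of c' b] dn[of b' c] by linarith
      also have "\<dots> \<le> ((1 + N) * norm c) * (L * (norm (dirac x) * norm b) * \<bar>M\<bar>) + ((1 + N) * norm b) * (L * (norm (dirac x) * norm c) * \<bar>M\<bar>)"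
        using nc L(1) by (intro add_mono mult_right_mono) auto
      also have "\<dots> = (2 * (1 + N) * L * \<bar>M\<bar>) * (norm c * norm (dirac x) * norm b)" by (simp add: algebra_simps)
      also have "\<dots> \<le> k * (norm c * norm (dirac x) * norm b)"
        unfolding k_def using L(1) \<open>N \<ge> 0\<close> by (intro mult_right_mono mult_left_mono) auto
      finally show ?thesis by (simp add: mult_ac)
    qed
    show "norm ?w \<le> k * norm (dirac x) * norm b"
    proof (cases "?w = 0")
      case True
      then show ?thesis using \<open>k \<ge> 0\<close> by simp
    next
      case False
      have "norm ?w * norm ?w \<le> norm ?w * (k * norm (dirac x) * norm b)"
        using main[of ?w] by (simp add: dot_square_norm power2_eq_square)
      then show ?thesis using False by simp
    qed
  qed
  \<comment> \<open>Gronwall with inhomogeneity 0, starting from \<open>dirac q = 0\<close>;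
    \<open>k + 1\<close> because the constant has to be positive.\<close>
  have "norm (dirac (\<gamma> t)) \<le> 2 * 0 * (b - a) * exp (2 * (k + 1) * (b - a))"
  proof (rule gronwall[where e = "\<lambda>t. dirac (\<gamma> t)" and e' = "\<lambda>t. E (\<gamma> t) (P (\<gamma> t) (h t))" and ?t0.0 = t0])
    show "k + 1 > 0" using \<open>k \<ge> 0\<close> by simp
    have "continuous_on K dirac"
      using dE K by (meson continuous_at_imp_continuous_on has_derivative_continuous subsetD)
    then show "continuous_on {a..b} (\<lambda>t. dirac (\<gamma> t))"
      by (rule continuous_on_compose2[OF _ cont]) (use \<gamma>K in auto)
    show "dirac (\<gamma> t0) = 0" using PSP_q \<open>\<gamma> t0 = q\<close>
      by (intro blinfun_eqI) (simp add: dirac_def blinfun.bilinear_simps)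
    fix s assume s: "a < s" "s < b"
    then have \<gamma>s: "\<gamma> s \<in> K" using \<gamma>K by simp
    then have "((dirac \<circ> \<gamma>) has_vector_derivative E (\<gamma> s) (P (\<gamma> s) (h s))) (at s)"
      using K by (intro vector_derivative_diff_chain_within[OF deriv[OF s]] has_derivative_at_withinI[OF dE]) auto
    then show "((\<lambda>t. dirac (\<gamma> t)) has_vector_derivative E (\<gamma> s) (P (\<gamma> s) (h s))) (at s)" by (simp add: o_def)
    have "norm (E (\<gamma> s) (P (\<gamma> s) (h s))) \<le> k * norm (dirac (\<gamma> s))" by (rule bound[OF \<gamma>s h[OF s]])
    also have "\<dots> \<le> (k + 1) * norm (dirac (\<gamma> s))" by (intro mult_right_mono) auto
    finally show "norm (E (\<gamma> s) (P (\<gamma> s) (h s))) \<le> (k + 1) * norm (dirac (\<gamma> s)) + 0" by simp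
  qed (use assms in auto)
  then show ?thesis by simp
qed

text \<open>The leaf through \<open>q\<close> is near \<open>q\<close> the graph of the map \<open>g\<close> that sends \<open>y\<close> to the endpoint of
  the horizontal curve over the segment from \<open>0\<close> to \<open>y\<close>. To see that \<open>g\<close> has derivative
  \<open>lift (g y)\<close>, note that for the horizontal curve \<open>u\<close> over \<open>s *\<^sub>R y\<close>, the curve
  \<open>u s + s *\<^sub>R lift (u s) v\<close> solves by flatness the equation of the horizontal curve over
  \<open>s *\<^sub>R (y + v)\<close> up to an error of order \<open>(norm v)\<^sup>2\<close>.\<close>

lemma plaque:
  obtains r R G where "0 < r" "cball q r \<subseteq> V" "0 < R" "cball q (4 * R) \<subseteq> V" "closed G"
    "\<And>a b t0 \<gamma> h M t. \<lbrakk>t0 \<in> {a..b}; \<gamma> t0 = q; continuous_on {a..b} \<gamma>; \<forall>t\<in>{a..b}. \<gamma> t \<in> cball q r;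
        \<forall>t\<in>{a<..<b}. (\<gamma> has_vector_derivative P (\<gamma> t) (h t)) (at t) \<and> norm (h t) \<le> M; t \<in> {a..b}\<rbrakk>
      \<Longrightarrow> \<gamma> t \<in> G"
    "\<And>x. x \<in> G \<Longrightarrow> \<exists>u h. u 0 = q \<and> u 1 = x \<and> smooth_on {-1<..<2} h \<and>
        (\<forall>t\<in>{-1<..<2::real}. u t \<in> cball q R \<and> (u has_vector_derivative P (u t) (h t)) (at t))"
proof -
  obtain R' where R': "R' > 0" "cball q R' \<subseteq> U"
    using open_U q_U open_contains_cball by blast
  \<comment> \<open>Solutions will live in radius \<open>R\<close> and the comparison curves in
    radius \<open>2 * R\<close>; radius \<open>4 * R\<close> leaves room for cutting off a
    Hamiltonian.\<close>
  define R where "R = R' / 4"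
  have "R > 0" and R4: "cball q (4 * R) \<subseteq> U" using R' by (auto simp: R_def)
  define K where "K = cball q (2 * R)"
  have K: "compact K" "convex K" by (auto simp: K_def)
  have KU: "K \<subseteq> U" using R4 \<open>R > 0\<close> by (intro order_trans[OF _ R4]) (auto simp: K_def)
  have RK: "cball q R \<subseteq> K" using \<open>R > 0\<close> by (auto simp: K_def)
  have C1: "Ck_on 1 U lift" using smooth_lift unfolding smooth_on_def by blast
  have fd: "frechet_derivative lift (at x) = dlift x" if "x \<in> U" for x
    using has_derivative_lift[OF that] by (simp add: frechet_derivative_at[symmetric])
  obtain L where L: "L \<ge> 0" "\<And>x y. x \<in> K \<Longrightarrow> y \<in> K \<Longrightarrow> norm (lift x - lift y) \<le> L * norm (x - y)"
    using C1_lipschitz[OF coordinate_system_B C1 K KU] by blast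
  have fdK: "frechet_derivative lift (at x) = dlift x" if "x \<in> K" for x
    using fd that KU by blast
  obtain D where D: "D \<ge> 0" "\<And>x v. x \<in> K \<Longrightarrow> norm (dlift x v) \<le> D * norm v"
    by (rule C1_bounded_derivative[OF coordinate_system_B C1 K(1) KU]) (simp add: fdK)
  obtain C where C: "C \<ge> 0"
    "\<And>x y. x \<in> K \<Longrightarrow> y \<in> K \<Longrightarrow> norm (lift y - lift x - dlift x (y - x)) \<le> C * (norm (y - x))\<^sup>2"
    by (rule smooth_taylor[OF coordinate_system_B smooth_lift K KU]) (simp add: fdK)
  have bdd: "\<exists>N\<ge>0. \<forall>x\<in>K. norm (f x) \<le> N" if "continuous_on U f" for f :: "'e \<Rightarrow> 'e \<Rightarrow>\<^sub>L 'e"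
  proof -
    have "bounded (f ` K)"
      using continuous_on_subset[OF that KU] K(1) by (intro compact_imp_bounded compact_continuous_image)
    then obtain N where "\<forall>x\<in>K. norm (f x) \<le> N" by (auto simp: bounded_iff)
    then have "\<forall>x\<in>K. norm (f x) \<le> max 0 N" by (auto simp: le_max_iff_disj)
    then show ?thesis using max.cobounded1 by blast
  qed
  obtain N where N: "N \<ge> 0" "\<And>x. x \<in> K \<Longrightarrow> norm (lift x) \<le> N"
    using bdd[OF smooth_on_imp_continuous_on[OF smooth_lift]] by blast
  obtain NS where NS: "NS \<ge> 0" "\<And>x. x \<in> K \<Longrightarrow> norm (S x) \<le> NS"
    using bdd[OF smooth_on_imp_continuous_on[OF smooth_S]] by blast
  obtain NP where NP: "NP \<ge> 0" "\<And>x. x \<in> K \<Longrightarrow> norm (P x) \<le> NP"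
    using bdd[OF smooth_on_imp_continuous_on[OF smooth_on_subset[OF smooth_P U_V]]] by blast
  \<comment> \<open>The first bound keeps horizontal curves over \<open>y\<close> within radius
    \<open>R\<close> for times up to 3, the second gives the contraction condition;
    \<open>N + 1\<close> and \<open>L + 1\<close> exclude zero denominators. The interval from
    \<open>-3\<close> to 3 contains with a margin the interval from \<open>-1\<close> to 2, which is
    invariant under the reversal \<open>t \<mapsto> 1 - t\<close>.\<close>
  define \<rho> where "\<rho> = min (R / (3 * (N + 1))) (1 / (6 * (L + 1)))"
  have "\<rho> > 0" using \<open>R > 0\<close> N L by (simp add: \<rho>_def)
  have \<rho>1: "N * \<rho> * 3 \<le> R"
  proof -
    have "N * \<rho> * 3 \<le> (N + 1) * \<rho> * 3" using \<open>\<rho> > 0\<close> by simp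
    also have "\<dots> \<le> (N + 1) * (R / (3 * (N + 1))) * 3"
      using N by (intro mult_right_mono mult_left_mono) (auto simp: \<rho>_def)
    also have "\<dots> = R" using N by (simp add: field_simps)
    finally show ?thesis .
  qed
  have \<rho>2: "L * \<rho> * 3 < 1"
  proof -
    have "L * \<rho> * 3 \<le> (L + 1) * \<rho> * 3" using \<open>\<rho> > 0\<close> by simp
    also have "\<dots> \<le> (L + 1) * (1 / (6 * (L + 1))) * 3"
      using L by (intro mult_right_mono mult_left_mono) (auto simp: \<rho>_def)
    also have "\<dots> < 1" using L by (simp add: field_simps)
    finally show ?thesis .
  qed
  have lift_le: "norm (lift x y) \<le> N * norm y" if "x \<in> K" for x y
    by (rule order_trans[OF norm_blinfun mult_right_mono[OF N(2)[OF that]]]) simp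
  have lift_diff: "norm (lift x y - lift x' y) \<le> L * norm (x - x') * norm y" if "x \<in> K" "x' \<in> K" for x x' y
    using order_trans[OF norm_blinfun[of "lift x - lift x'" y] mult_right_mono[OF L(2)[OF that]]]
    by (simp add: blinfun.diff_left)
  have "\<exists>u. norm y \<le> \<rho> \<longrightarrow> u 0 = q \<and> (\<forall>t\<in>{-3..3::real}. u t \<in> cball q R \<and>
      (u has_vector_derivative lift (u t) y) (at t within {-3..3}))" for y
  proof (cases "norm y \<le> \<rho>")
    case True
    obtain u where "u 0 = q" "\<And>t. t \<in> {-3..3} \<Longrightarrow> u t \<in> cball q R"
      "\<And>t. t \<in> {-3..3} \<Longrightarrow> (u has_vector_derivative lift (u t) y) (at t within {-3..3})"
    proof (rule autonomous_ode_solution[of 3 "N * \<rho>" "L * \<rho>" R q "\<lambda>x. lift x y"])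
      fix x assume x: "x \<in> cball q R"
      show "norm (lift x y) \<le> N * \<rho>"
        using lift_le[of x y] mult_left_mono[OF True N(1)] x RK by auto
      fix x' assume x': "x' \<in> cball q R"
      have "norm (lift x y - lift x' y) \<le> L * norm (x - x') * norm y"
        using x x' RK by (intro lift_diff) auto
      also have "\<dots> \<le> L * norm (x - x') * \<rho>" using True L by (intro mult_left_mono) auto
      finally show "norm (lift x y - lift x' y) \<le> L * \<rho> * norm (x - x')" by (simp add: mult_ac)
    qed (use N L \<open>\<rho> > 0\<close> \<rho>1 \<rho>2 in auto)
    then show ?thesis by blast
  qed auto
  then obtain u where u: "\<And>y. norm y \<le> \<rho> \<Longrightarrow> u y 0 = q"
    "\<And>y t. norm y \<le> \<rho> \<Longrightarrow> t \<in> {-3..3} \<Longrightarrow> u y t \<in> cball q R"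
    "\<And>y t. norm y \<le> \<rho> \<Longrightarrow> t \<in> {-3..3} \<Longrightarrow> (u y has_vector_derivative lift (u y t) y) (at t within {-3..3})"
    by metis
  have uK: "u y t \<in> K" if "norm y \<le> \<rho>" "t \<in> {-3..3}" for y t using u(2)[OF that] RK by auto
  have ud: "(u y has_vector_derivative lift (u y t) y) (at t)" if "norm y \<le> \<rho>" "-3 < t" "t < 3" for y t
    using u(3)[of y t] that at_within_Icc_at[of "-3" t 3] by auto
  have uc: "continuous_on {-3..3} (u y)" if "norm y \<le> \<rho>" for y
    using u(3)[OF that] has_vector_derivative_continuous continuous_on_eq_continuous_within by blast
  \<comment> \<open>A horizontal curve is driven by the covector \<open>S (u y s) y\<close>, so it
    is a curve through \<open>q\<close> to which the propagation of the Dirac bracket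
    applies.\<close>
  have dirac0: "dirac (u y t) = 0" if y: "norm y \<le> \<rho>" and t: "t \<in> {-3..3}" for y t
  proof (rule dirac_zero_along_curve[OF K(1) KU _ u(1)[OF y] uc[OF y] uK[OF y] _ _ t])
    fix s :: real assume s: "-3 < s" "s < 3"
    show "(u y has_vector_derivative P (u y s) (S (u y s) y)) (at s)"
      using ud[OF y s] by (simp add: lift_def)
    show "norm (S (u y s) y) \<le> NS * norm y"
      using s by (intro order_trans[OF norm_blinfun mult_right_mono[OF NS(2)]] uK y) auto
  qed auto
  define g where "g y = u y 1" for y
  have gK: "g y \<in> K" if "norm y \<le> \<rho>" for y using uK[OF that] by (simp add: g_def)
  have g0: "g 0 = q"
  proof -
    have "(u 0 has_vector_derivative 0) (at t within {-3..3})" if "t \<in> {-3..3}" for t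
      using u(3)[of 0 t] that \<open>\<rho> > 0\<close> by (simp add: blinfun.zero_right)
    then obtain c where "\<And>t. t \<in> {-3..3} \<Longrightarrow> u 0 t = c"
      using has_vector_derivative_zero_constant[of "{-3..3}" "u 0"] by auto
    then have "u 0 1 = u 0 0" by simp
    then show ?thesis using u(1)[of 0] \<open>\<rho> > 0\<close> by (simp add: g_def)
  qed
  \<comment> \<open>The two quadratic errors: \<open>D * N\<close> from
    \<open>dlift x (lift x v) v\<close>, and \<open>C * N\<^sup>2 * \<rho>\<close> from the Taylor
    remainder of \<open>lift\<close> between \<open>x\<close> and \<open>w s\<close>, applied to
    \<open>y + v\<close>.\<close>
  define k where "k = D * N + C * N\<^sup>2 * \<rho>"
  have "k \<ge> 0" using C D N \<open>\<rho> > 0\<close> by (simp add: k_def)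
  define c where "c = L * \<rho> + 1"
  have "c > 0" using L \<open>\<rho> > 0\<close> by (simp add: c_def add_nonneg_pos)
  have quad: "norm (g (y + v) - g y - lift (g y) v) \<le> (2 * k * exp (2 * c)) * (norm v)\<^sup>2"
    if y: "norm y \<le> \<rho>" and yv: "norm (y + v) \<le> \<rho>" for y v
  proof -
    have nv: "norm v \<le> 2 * \<rho>" using norm_triangle_ineq4[of "y + v" y] y yv by simp
    define w where "w s = u y s + s *\<^sub>R lift (u y s) v" for s :: real
    define w' where "w' s = lift (u y s) y + (s *\<^sub>R dlift (u y s) (lift (u y s) y) v + lift (u y s) v)" for s :: real
    have wd: "(w has_vector_derivative w' s) (at s)" if s: "-3 < s" "s < 3" for s
    proof -
      have uU: "u y s \<in> U" using uK[OF y, of s] KU s by auto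
      have "((lift \<circ> u y) has_vector_derivative dlift (u y s) (lift (u y s) y)) (at s)"
        by (rule vector_derivative_diff_chain_within[OF ud[OF y s] has_derivative_at_withinI[OF has_derivative_lift[OF uU]]])
      then have "((\<lambda>s. lift (u y s) v) has_vector_derivative dlift (u y s) (lift (u y s) y) v) (at s)"
        using bounded_linear.has_vector_derivative[OF blinfun.bounded_linear_left, of "lift \<circ> u y" _ _ v]
        by (simp add: o_def)
      then have "((\<lambda>s. s *\<^sub>R lift (u y s) v) has_vector_derivative
          (s *\<^sub>R dlift (u y s) (lift (u y s) y) v + 1 *\<^sub>R lift (u y s) v)) (at s)"
        by (intro has_vector_derivative_scaleR DERIV_ident)
      then show ?thesis
        unfolding w_def[abs_def] w'_def using has_vector_derivative_add[OF ud[OF y s]] by simp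
    qed
    have "norm (w 1 - u (y + v) 1) \<le> 2 * (k * (norm v)\<^sup>2) * (1 - 0) * exp (2 * c * (1 - 0))"
    proof (rule gronwall[where e = "\<lambda>s. w s - u (y + v) s" and e' = "\<lambda>s. w' s - lift (u (y + v) s) (y + v)" and ?t0.0 = 0])
      show "0 \<le> k * (norm v)\<^sup>2" using \<open>k \<ge> 0\<close> by simp
      have "continuous_on {0..1} w"
        by (rule continuous_at_imp_continuous_on) (auto intro: has_vector_derivative_continuous[OF wd])
      then show "continuous_on {0..1} (\<lambda>s. w s - u (y + v) s)"
        using uc[OF yv] by (intro continuous_on_diff) (auto intro: continuous_on_subset)
      show "w 0 - u (y + v) 0 = 0" using u(1)[OF y] u(1)[OF yv] by (simp add: w_def)
      fix s :: real assume s: "0 < s" "s < 1"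
      show "((\<lambda>s. w s - u (y + v) s) has_vector_derivative w' s - lift (u (y + v) s) (y + v)) (at s)"
        using s by (intro has_vector_derivative_diff wd ud yv) auto
      have s3: "s \<in> {-3..3}" using s by simp
      define x where "x = u y s"
      define x' where "x' = u (y + v) s"
      have xK: "x \<in> K" and x'K: "x' \<in> K" using uK[OF y s3] uK[OF yv s3] by (simp_all add: x_def x'_def)
      have nsv: "norm (s *\<^sub>R lift x v) \<le> N * norm v"
        using mult_mono[of "\<bar>s\<bar>" 1, OF _ lift_le[OF xK]] s by simp
      have wx: "w s = x + s *\<^sub>R lift x v" by (simp add: w_def x_def)
      have wK: "w s \<in> K"
      proof -
        have "norm (s *\<^sub>R lift x v) \<le> N * (2 * \<rho>)"
          using nsv mult_left_mono[OF nv N(1)] by linarith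
        also have "\<dots> \<le> R" using \<rho>1 N \<open>\<rho> > 0\<close> mult_nonneg_nonneg[of N \<rho>] by linarith
        finally have "dist x (w s) \<le> R" by (simp add: wx dist_norm)
        moreover have "dist q x \<le> R" using u(2)[OF y s3] by (simp add: x_def)
        ultimately show ?thesis using dist_triangle[of q "w s" x] by (simp add: K_def)
      qed
      have 1: "norm (lift (w s) (y + v) - lift x' (y + v)) \<le> L * norm (w s - x') * \<rho>"
        using lift_diff[OF wK x'K, of "y + v"] mult_left_mono[OF yv, of "L * norm (w s - x')"] L by simp
      have flat: "dlift x (lift x y) v = dlift x (lift x v) y"
        using lift_flat[of x y v] dirac0[OF y s3] xK KU by (auto simp: x_def)
      have xU: "x \<in> U" using xK KU by blast
      interpret dl: bounded_linear "dlift x"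
        using has_derivative_lift[OF xU] by (rule has_derivative_bounded_linear)
      \<comment> \<open>Expand \<open>lift (w s)\<close> around \<open>x\<close>, where
        \<open>w s - x = s *\<^sub>R lift x v\<close>. The zeroth order terms cancel at once;
        flatness lets \<open>dlift x (lift x y) v\<close> cancel
        \<open>dlift x (lift x v) y\<close>, the only remaining terms that are linear in
        \<open>v\<close> before the Taylor remainder.\<close>
      have eq: "w' s - lift (w s) (y + v) = - (s *\<^sub>R dlift x (lift x v) v)
          - (lift (w s) - lift x - dlift x (w s - x)) (y + v)"
        using flat
        by (simp add: w'_def x_def[symmetric] blinfun.bilinear_simps wx dl.scaleR algebra_simps)
      have 2: "norm (w' s - lift (w s) (y + v)) \<le> k * (norm v)\<^sup>2"
      proof -
        have "norm (s *\<^sub>R dlift x (lift x v) v) \<le> norm (dlift x (lift x v) v)"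
          using s by (simp add: mult_left_le_one_le)
        also have "\<dots> \<le> norm (dlift x (lift x v)) * norm v" by (rule norm_blinfun)
        also have "\<dots> \<le> (D * norm (lift x v)) * norm v" by (intro mult_right_mono D xK) auto
        also have "\<dots> \<le> (D * (N * norm v)) * norm v"
          using D lift_le[OF xK] by (intro mult_right_mono mult_left_mono) auto
        finally have a: "norm (s *\<^sub>R dlift x (lift x v) v) \<le> D * N * (norm v)\<^sup>2" by (simp add: power2_eq_square mult_ac)
        have "norm ((lift (w s) - lift x - dlift x (w s - x)) (y + v))
            \<le> norm (lift (w s) - lift x - dlift x (w s - x)) * norm (y + v)" by (rule norm_blinfun)
        also have "\<dots> \<le> (C * (norm (w s - x))\<^sup>2) * \<rho>"
          using C(2)[OF xK wK] yv C(1) by (intro mult_mono) auto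
        also have "\<dots> \<le> (C * (N * norm v)\<^sup>2) * \<rho>"
          using nsv C(1) \<open>\<rho> > 0\<close> by (intro mult_right_mono mult_left_mono power_mono) (auto simp: wx)
        finally have b: "norm ((lift (w s) - lift x - dlift x (w s - x)) (y + v)) \<le> C * N\<^sup>2 * \<rho> * (norm v)\<^sup>2"
          by (simp add: power_mult_distrib mult_ac)
        have "norm (w' s - lift (w s) (y + v)) \<le> norm (s *\<^sub>R dlift x (lift x v) v)
            + norm ((lift (w s) - lift x - dlift x (w s - x)) (y + v))"
          unfolding eq
          using norm_triangle_ineq4[of "- (s *\<^sub>R dlift x (lift x v) v)" "(lift (w s) - lift x - dlift x (w s - x)) (y + v)"]
          by (simp only: norm_minus_cancel)
        then have "norm (w' s - lift (w s) (y + v)) \<le> D * N * (norm v)\<^sup>2 + C * N\<^sup>2 * \<rho> * (norm v)\<^sup>2"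
          using a b by linarith
        then show ?thesis by (simp add: k_def algebra_simps)
      qed
      have "norm (w' s - lift x' (y + v)) \<le> norm (w' s - lift (w s) (y + v)) + norm (lift (w s) (y + v) - lift x' (y + v))"
        using norm_triangle_ineq[of "w' s - lift (w s) (y + v)" "lift (w s) (y + v) - lift x' (y + v)"] by simp
      also have "\<dots> \<le> k * (norm v)\<^sup>2 + L * norm (w s - x') * \<rho>" using 1 2 by linarith
      also have "\<dots> \<le> c * norm (w s - x') + k * (norm v)\<^sup>2"
        by (simp add: c_def algebra_simps)
      finally show "norm (w' s - lift (u (y + v) s) (y + v)) \<le> c * norm (w s - u (y + v) s) + k * (norm v)\<^sup>2"
        by (simp add: x'_def)
    qed (use \<open>c > 0\<close> in auto)
    moreover have "g (y + v) - g y - lift (g y) v = - (w 1 - u (y + v) 1)" by (simp add: g_def w_def)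
    ultimately show ?thesis by (simp add: norm_minus_commute mult_ac)
  qed
  have gd: "(g has_derivative lift (g y)) (at y)" if "y \<in> ball 0 \<rho>" for y
  proof (rule has_derivative_quadratic[OF blinfun.bounded_linear_right open_ball that])
    fix z :: 'e assume "z \<in> ball 0 \<rho>"
    then show "norm (g z - g y - lift (g y) (z - y)) \<le> (2 * k * exp (2 * c)) * (norm (z - y))\<^sup>2"
      using quad[of y "z - y"] that by auto
  qed
  have gc: "continuous_on (ball 0 \<rho>) g"
    by (intro continuous_at_imp_continuous_on ballI has_derivative_continuous[OF gd])
  \<comment> \<open>Makes \<open>Q (x - q)\<close> at most \<open>\<rho> / 2\<close> in norm, hence
    inside the open ball on which \<open>g\<close> is differentiable.\<close>
  define r where "r = min R (\<rho> / (2 * (norm Q + 1)))"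
  have "r > 0" using \<open>R > 0\<close> \<open>\<rho> > 0\<close> by (simp add: r_def add_nonneg_pos)
  have Qr: "Q (x - q) \<in> ball 0 \<rho>" if "x \<in> cball q r" for x
  proof -
    have "norm (Q (x - q)) \<le> norm Q * norm (x - q)" by (rule norm_blinfun)
    also have "\<dots> \<le> (norm Q + 1) * (\<rho> / (2 * (norm Q + 1)))"
      using that by (intro mult_mono) (auto simp: r_def dist_norm norm_minus_commute)
    also have "\<dots> = \<rho> / 2" by (simp add: add_nonneg_eq_0_iff field_simps)
    finally show ?thesis using \<open>\<rho> > 0\<close> by simp
  qed
  have rK: "cball q r \<subseteq> K" using RK by (auto simp: r_def)
  \<comment> \<open>The graph condition written as an equation between continuous functions on a
    closed ball, which makes closedness immediate.\<close>
  define G where "G = {x \<in> cball q r. g (Q (x - q)) - x = 0}"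
  show ?thesis
  proof
    show "0 < r" "0 < R" by fact+
    show "cball q r \<subseteq> V" using rK KU U_V by blast
    show "cball q (4 * R) \<subseteq> V" using R4 U_V by blast
    show "closed G"
      unfolding G_def
    proof (rule continuous_closed_preimage_constant[OF _ closed_cball])
      have "continuous_on (cball q r) (\<lambda>x. g (Q (x - q)))"
        by (rule continuous_on_compose2[OF gc]) (use Qr in \<open>auto intro!: continuous_intros\<close>)
      then show "continuous_on (cball q r) (\<lambda>x. g (Q (x - q)) - x)"
        by (rule continuous_on_diff[OF _ continuous_on_id])
    qed
  next
    fix a b t0 \<gamma> h M and t :: real
    assume t0: "t0 \<in> {a..b}" "\<gamma> t0 = q" and cont: "continuous_on {a..b} \<gamma>"
      and \<gamma>r: "\<forall>t\<in>{a..b}. \<gamma> t \<in> cball q r"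
      and d: "\<forall>t\<in>{a<..<b}. (\<gamma> has_vector_derivative P (\<gamma> t) (h t)) (at t) \<and> norm (h t) \<le> M"
      and t: "t \<in> {a..b}"
    have \<gamma>K: "\<gamma> s \<in> K" if "s \<in> {a..b}" for s using \<gamma>r rK that by blast
    have D0: "dirac (\<gamma> s) = 0" if "s \<in> {a..b}" for s
      using d by (intro dirac_zero_along_curve[OF K(1) KU t0 cont \<gamma>K, of h M s]) (use that in auto)
    \<comment> \<open>The deviation of the curve from the graph point with the same base coordinate
      \<open>Q (\<gamma> s - q)\<close>. Both curves turn out to be horizontal lifts of the same
      base curve, so the deviation satisfies a linear estimate.\<close>
    define e where "e s = \<gamma> s - g (Q (\<gamma> s - q))" for s
    define e' where "e' s = P (\<gamma> s) (h s) - lift (g (Q (\<gamma> s - q))) (Q (P (\<gamma> s) (h s)))" for s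
    have gdo: "((\<lambda>s. g (Q (\<gamma> s - q))) has_vector_derivative lift (g (Q (\<gamma> s - q))) (Q (P (\<gamma> s) (h s)))) (at s)"
      if s: "s \<in> {a<..<b}" for s
    proof -
      have "(\<gamma> has_vector_derivative P (\<gamma> s) (h s)) (at s)" using d s by blast
      then have "((\<lambda>s. \<gamma> s - q) has_vector_derivative P (\<gamma> s) (h s)) (at s)"
        using has_vector_derivative_diff[OF _ has_vector_derivative_const] by fastforce
      then have 1: "((\<lambda>s. Q (\<gamma> s - q)) has_vector_derivative Q (P (\<gamma> s) (h s))) (at s)"
        by (rule bounded_linear.has_vector_derivative[OF blinfun.bounded_linear_right])
      have "Q (\<gamma> s - q) \<in> ball 0 \<rho>" using \<gamma>r s by (intro Qr) auto
      then show ?thesis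
        using vector_derivative_diff_chain_within[OF 1 has_derivative_at_withinI[OF gd]] by (simp add: o_def)
    qed
    have "norm (e t) \<le> 2 * 0 * (b - a) * exp (2 * (L * (NP * \<bar>M\<bar>) + 1) * (b - a))"
    proof (rule gronwall[where e = e and e' = e' and ?t0.0 = t0])
      show "0 < L * (NP * \<bar>M\<bar>) + 1" using L NP by (simp add: add_nonneg_pos)
      have "continuous_on {a..b} (\<lambda>s. g (Q (\<gamma> s - q)))"
        by (rule continuous_on_compose2[OF gc]) (use Qr \<gamma>r in \<open>auto intro!: continuous_intros cont\<close>)
      then show "continuous_on {a..b} e"
        unfolding e_def by (rule continuous_on_diff[OF cont])
      show "e t0 = 0" by (simp add: e_def t0 g0 blinfun.zero_right)
      fix s assume s: "a < s" "s < b"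
      show "(e has_vector_derivative e' s) (at s)"
        unfolding e_def[abs_def] e'_def using d s by (intro has_vector_derivative_diff gdo) auto
      define v where "v = P (\<gamma> s) (h s)"
      have sI: "s \<in> {a..b}" using s by simp
      have yB: "Q (\<gamma> s - q) \<in> ball 0 \<rho>" using \<gamma>r sI by (intro Qr) auto
      then have gk: "g (Q (\<gamma> s - q)) \<in> K" by (intro gK) auto
      \<comment> \<open>Where \<open>dirac\<close> vanishes, \<open>P = P S P\<close>, so every
        Hamiltonian velocity is horizontal.\<close>
      have "v = P (\<gamma> s) (S (\<gamma> s) v)"
        using arg_cong[OF D0[OF sI], of "\<lambda>f. blinfun_apply f (h s)"]
        by (simp add: dirac_def v_def blinfun.bilinear_simps)
      then have vl: "v = lift (\<gamma> s) v" by (simp add: lift_def)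
      have "e' s = lift (\<gamma> s) v - lift (g (Q (\<gamma> s - q))) v"
        using lift_Q[of "g (Q (\<gamma> s - q))" v] gk KU vl by (auto simp: e'_def v_def[symmetric])
      then have "norm (e' s) \<le> L * norm (e s) * norm v"
        using lift_diff[OF \<gamma>K[OF sI] gk, of v] by (simp add: e_def)
      also have "norm v \<le> NP * \<bar>M\<bar>"
      proof -
        have "norm (h s) \<le> \<bar>M\<bar>" using d s by force
        then show ?thesis unfolding v_def
          using NP(1) by (intro order_trans[OF norm_blinfun mult_mono[OF NP(2)[OF \<gamma>K[OF sI]]]]) auto
      qed
      finally have "norm (e' s) \<le> L * norm (e s) * (NP * \<bar>M\<bar>)"
        using L by (simp add: mult_left_mono)
      also have "\<dots> \<le> (L * (NP * \<bar>M\<bar>) + 1) * norm (e s) + 0" by (simp add: algebra_simps)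
      finally show "norm (e' s) \<le> (L * (NP * \<bar>M\<bar>) + 1) * norm (e s) + 0" .
    qed (use t t0 in auto)
    then have "e t = 0" by simp
    then show "\<gamma> t \<in> G" using \<gamma>r t by (simp add: G_def e_def)
  next
    fix x assume x: "x \<in> G"
    define y where "y = Q (x - q)"
    have y: "norm y \<le> \<rho>" using Qr[of x] x by (simp add: G_def y_def)
    have sub: "t \<in> {-3..3}" "-3 < t" "t < 3" if "t \<in> {-1<..<2}" for t :: real using that by auto
    have dy: "(u y has_vector_derivative lift (u y t) y) (at t)" if "t \<in> {-1<..<2}" for t
      by (rule ud[OF y sub(2,3)[OF that]])
    have U': "u y ` {-1<..<2} \<subseteq> U" using uK[OF y sub(1)] KU by auto
    \<comment> \<open>The driving covector \<open>S (u y t) y\<close> must be smooth in time,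
      because it will be the differential of a time-dependent Hamiltonian.\<close>
    have "smooth_on {-1<..<2} (u y)"
      by (rule smooth_on_integral_curve[OF coordinate_system_B open_greaterThanLessThan open_U U' _ dy])
         (rule smooth_on_bounded_linear[OF blinfun.bounded_linear_left open_U smooth_lift])
    then have "smooth_on {-1<..<2} (\<lambda>t. S (u y t))"
      by (rule smooth_on_compose[OF coordinate_system_B open_greaterThanLessThan open_U U' smooth_S])
    then have "smooth_on {-1<..<2} (\<lambda>t. S (u y t) y)"
      by (rule smooth_on_bounded_linear[OF blinfun.bounded_linear_left open_greaterThanLessThan])
    moreover have "u y 1 = x" using x by (simp add: G_def y_def g_def)
    ultimately show "\<exists>u h. u 0 = q \<and> u 1 = x \<and> smooth_on {-1<..<2} h \<and>
        (\<forall>t\<in>{-1<..<2::real}. u t \<in> cball q R \<and> (u has_vector_derivative P (u t) (h t)) (at t))"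
      using u(1)[OF y] u(2)[OF y sub(1)] dy by (intro exI[of _ "u y"] exI[of _ "\<lambda>t. S (u y t) y"]) (simp add: lift_def)
  qed
qed

end

section \<open>Poisson manifolds in charts\<close>

lemma (in orthonormal_basis) coordinate_system_prod:
  "coordinate_system (insert (1, 0) (Pair 0 ` B)) (\<lambda>b v. (b :: real \<times> 'e) \<bullet> v)"
proof -
  have "v = (\<Sum>b\<in>insert (1, 0) (Pair 0 ` B). (b \<bullet> v) *\<^sub>R b)" for v :: "real \<times> 'e"
  proof -
    have "(\<Sum>b\<in>Pair 0 ` B. (b \<bullet> v) *\<^sub>R b) = (\<Sum>b\<in>B. (0, (snd v \<bullet> b) *\<^sub>R b))"
      by (subst sum.reindex) (auto simp: inj_on_def inner_prod_def inner_commute)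
    also have "\<dots> = (0, snd v)"
      using expansion[of "snd v"] by (simp add: sum_prod)
    finally show ?thesis
      using finite_B by (subst sum.insert) (auto simp: inner_prod_def prod_eq_iff)
  qed
  then show ?thesis
    using finite_B by (auto simp: coordinate_system_def bounded_linear_inner_right)
qed

lemma (in orthonormal_basis) riesz:
  fixes \<beta> :: "'e \<Rightarrow>\<^sub>L real"
  shows "\<beta> = blinfun_inner_left (\<Sum>b\<in>B. \<beta> b *\<^sub>R b)"
proof (rule blinfun_eqI)
  fix v
  have "\<beta> v = \<beta> (\<Sum>b\<in>B. (v \<bullet> b) *\<^sub>R b)" by (simp add: expansion)
  also have "\<dots> = (\<Sum>b\<in>B. \<beta> b * (v \<bullet> b))" by (simp add: blinfun.bilinear_simps blinfun.sum_right mult.commute)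
  finally show "\<beta> v = blinfun_inner_left (\<Sum>b\<in>B. \<beta> b *\<^sub>R b) v" by (simp add: inner_sum_right)
qed

locale poisson_charts = orthonormal_basis B
  for B :: "'e::{real_inner,banach,heine_borel} set" +
  fixes A :: "('m::{t2_space,second_countable_topology}, 'e) chart set" and P :: "('m, 'e) bivector"
  assumes poisson: "poisson_manifold A P"
begin

lemma
  assumes "c \<in> A"
  shows open_dom: "open (chart_dom c)" and open_img: "open (chart_img c)"
    and inv_map: "p \<in> chart_dom c \<Longrightarrow> chart_inv c (chart_map c p) = p"
    and map_inv: "x \<in> chart_img c \<Longrightarrow> chart_map c (chart_inv c x) = x"
    and inv_dom: "x \<in> chart_img c \<Longrightarrow> chart_inv c x \<in> chart_dom c"
    and cont_map: "continuous_on (chart_dom c) (chart_map c)"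
    and cont_inv: "continuous_on (chart_img c) (chart_inv c)"
  using assms poisson
  unfolding poisson_manifold_def smooth_atlas_def is_chart_def homeomorphism_def by auto

lemma chart_exists: obtains c where "c \<in> A" "p \<in> chart_dom c"
  using poisson unfolding poisson_manifold_def smooth_atlas_def by blast

lemma smooth_transition:
  "c \<in> A \<Longrightarrow> c' \<in> A \<Longrightarrow>
    smooth_on (chart_map c ` (chart_dom c \<inter> chart_dom c')) (chart_map c' \<circ> chart_inv c)"
  using poisson unfolding poisson_manifold_def smooth_atlas_def by blast

lemma open_chart_image:
  assumes "c \<in> A" "open W"
  shows "open (chart_map c ` (chart_dom c \<inter> W))"
proof -
  have "chart_map c ` (chart_dom c \<inter> W) = chart_inv c -` W \<inter> chart_img c"
    using inv_map[OF assms(1)] map_inv[OF assms(1)] inv_dom[OF assms(1)] by force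
  moreover have "open (chart_inv c -` W \<inter> chart_img c)"
    using continuous_on_open_vimage[OF open_img[OF assms(1)], of "chart_inv c"] cont_inv[OF assms(1)] assms(2) by blast
  ultimately show ?thesis by simp
qed

lemma open_chart_preimage:
  assumes "c \<in> A" "open W"
  shows "open {p \<in> chart_dom c. chart_map c p \<in> W}"
proof -
  have "{p \<in> chart_dom c. chart_map c p \<in> W} = chart_map c -` W \<inter> chart_dom c" by auto
  then show ?thesis
    using continuous_on_open_vimage[OF open_dom[OF assms(1)], of "chart_map c"] cont_map[OF assms(1)] assms(2) by simp
qed

section \<open>The bivector in a chart as a smooth family of skew operators\<close>

lemma bilinear_P: "c \<in> A \<Longrightarrow> p \<in> chart_dom c \<Longrightarrow> bilinear (P c p)"
  and alternating_P: "c \<in> A \<Longrightarrow> p \<in> chart_dom c \<Longrightarrow> P c p \<alpha> \<alpha> = 0"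
  and smooth_P_components: "c \<in> A \<Longrightarrow> smooth_on (chart_img c) (\<lambda>x. P c (chart_inv c x) \<alpha> \<beta>)"
  and P_change: "c \<in> A \<Longrightarrow> c' \<in> A \<Longrightarrow> p \<in> chart_dom c \<inter> chart_dom c' \<Longrightarrow>
    P c' p \<alpha> \<beta> = P c p (\<alpha> o\<^sub>L Blinfun (coord_change c c' p)) (\<beta> o\<^sub>L Blinfun (coord_change c c' p))"
  using poisson unfolding poisson_manifold_def bivector_field_def by blast+

lemma skew_bivector:
  assumes "c \<in> A" "p \<in> chart_dom c"
  shows "P c p \<alpha> \<beta> = - P c p \<beta> \<alpha>"
proof -
  note b = bilinear_P[OF assms]
  have "0 = P c p (\<alpha> + \<beta>) (\<alpha> + \<beta>)" by (simp only: alternating_P[OF assms])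
  also have "\<dots> = P c p \<alpha> \<alpha> + P c p \<alpha> \<beta> + (P c p \<beta> \<alpha> + P c p \<beta> \<beta>)"
    by (simp only: bilinear_ladd[OF b] bilinear_radd[OF b] ac_simps)
  finally show ?thesis by (simp add: alternating_P[OF assms])
qed

text \<open>\<open>contract\<close> with covectors identified with vectors by the inner product of
  the model space. The component sum exhibits it as an operator-valued smooth map, which the
  definite description in \<open>contract\<close> does not.\<close>

definition sharp :: "('m, 'e) chart \<Rightarrow> 'e \<Rightarrow> 'e \<Rightarrow>\<^sub>L 'e" where
  "sharp c x = (\<Sum>a\<in>B. \<Sum>b\<in>B. P c (chart_inv c x) (blinfun_inner_left a) (blinfun_inner_left b)
     *\<^sub>R (blinfun_scaleR_left b o\<^sub>L blinfun_inner_left a))"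

lemma inner_left_expansion: "blinfun_inner_left v = (\<Sum>b\<in>B. (v \<bullet> b) *\<^sub>R blinfun_inner_left b)"
proof (rule blinfun_eqI)
  fix w
  have "w \<bullet> v = w \<bullet> (\<Sum>b\<in>B. (v \<bullet> b) *\<^sub>R b)" by (simp add: expansion)
  then show "blinfun_inner_left v w = (\<Sum>b\<in>B. (v \<bullet> b) *\<^sub>R blinfun_inner_left b) w"
    by (simp add: inner_sum_right blinfun.sum_left blinfun.scaleR_left)
qed

lemma inner_sharp:
  assumes "c \<in> A" "x \<in> chart_img c"
  shows "b \<bullet> sharp c x a = P c (chart_inv c x) (blinfun_inner_left a) (blinfun_inner_left b)"
proof -
  note bl = bilinear_P[OF assms(1) inv_dom[OF assms]]
  let ?P = "P c (chart_inv c x)"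
  have l: "linear (\<lambda>\<alpha>. ?P \<alpha> \<beta>)" and r: "linear (?P \<alpha>)" for \<alpha> \<beta>
    using bl by (auto simp: bilinear_def)
  have "?P (blinfun_inner_left a) (blinfun_inner_left b) =
      (\<Sum>a'\<in>B. \<Sum>b'\<in>B. (a \<bullet> a') * ((b \<bullet> b') * ?P (blinfun_inner_left a') (blinfun_inner_left b')))"
    unfolding inner_left_expansion[of a] inner_left_expansion[of b]
      linear_sum[OF l] linear_scale[OF l] linear_sum[OF r] linear_scale[OF r]
    by (subst sum.swap) (simp add: sum_distrib_left mult_ac)
  also have "\<dots> = b \<bullet> sharp c x a"
    unfolding sharp_def
    by (simp add: blinfun.sum_left blinfun.scaleR_left inner_sum_right mult_ac)
  finally show ?thesis by simp
qed

text \<open>\<open>sharp\<close> supplies the vector whose existence the definite description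
  presupposes; uniqueness follows by testing against inner products.\<close>

lemma contract_characterization:
  assumes "c \<in> A" "p \<in> chart_dom c"
  shows "blinfun_apply \<beta> (contract P c p \<alpha>) = P c p \<alpha> \<beta>"
    and "(\<And>\<beta>. blinfun_apply \<beta> v = P c p \<alpha> \<beta>) \<Longrightarrow> contract P c p \<alpha> = v"
proof -
  have uniq: "v = w" if "\<forall>\<beta>. blinfun_apply \<beta> v = P c p \<alpha> \<beta>" "\<forall>\<beta>. blinfun_apply \<beta> w = P c p \<alpha> \<beta>" for v w
  proof -
    have "v \<bullet> z = w \<bullet> z" for z
      using that[THEN spec, of "blinfun_inner_left z"] by simp
    then show ?thesis using vector_eq_rdot[of v w] by blast
  qed
  define a where "a = (\<Sum>b\<in>B. \<alpha> b *\<^sub>R b)"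
  have ex: "\<forall>\<beta>. blinfun_apply \<beta> (sharp c (chart_map c p) a) = P c p \<alpha> \<beta>"
  proof
    fix \<beta> :: "'e \<Rightarrow>\<^sub>L real"
    let ?b = "\<Sum>b\<in>B. \<beta> b *\<^sub>R b"
    have "\<beta> (sharp c (chart_map c p) a) = ?b \<bullet> sharp c (chart_map c p) a"
      by (subst riesz[of \<beta>]) (simp add: inner_commute)
    also have "\<dots> = P c p \<alpha> \<beta>"
      using inner_sharp[OF assms(1), of "chart_map c p" ?b a] assms
      by (simp add: inv_map a_def riesz[symmetric])
    finally show "\<beta> (sharp c (chart_map c p) a) = P c p \<alpha> \<beta>" .
  qed
  have "\<forall>\<beta>. blinfun_apply \<beta> (contract P c p \<alpha>) = P c p \<alpha> \<beta>"
    unfolding contract_def by (rule theI[of _ "sharp c (chart_map c p) a"]) (use ex uniq in auto)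
  then show "blinfun_apply \<beta> (contract P c p \<alpha>) = P c p \<alpha> \<beta>"
    and "(\<And>\<beta>. blinfun_apply \<beta> v = P c p \<alpha> \<beta>) \<Longrightarrow> contract P c p \<alpha> = v"
    using uniq by blast+
qed

lemma contract_eq_sharp:
  assumes "c \<in> A" "p \<in> chart_dom c"
  shows "contract P c p (blinfun_inner_left a) = sharp c (chart_map c p) a"
proof (rule contract_characterization(2)[OF assms])
  fix \<beta> :: "'e \<Rightarrow>\<^sub>L real"
  let ?b = "\<Sum>b\<in>B. \<beta> b *\<^sub>R b"
  have "\<beta> (sharp c (chart_map c p) a) = ?b \<bullet> sharp c (chart_map c p) a"
    by (subst riesz[of \<beta>]) (simp add: inner_commute)
  then show "\<beta> (sharp c (chart_map c p) a) = P c p (blinfun_inner_left a) \<beta>"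
    using inner_sharp[OF assms(1), of "chart_map c p" ?b a] assms
    by (simp add: inv_map riesz[symmetric])
qed

lemma smooth_sharp: "c \<in> A \<Longrightarrow> smooth_on (chart_img c) (sharp c)"
  unfolding sharp_def
  by (intro smooth_on_sum smooth_on_bounded_linear[OF bounded_linear_scaleR_left] open_img smooth_P_components)

text \<open>On constant covectors the components of the bivector are the matrix entries of
  \<open>sharp\<close>. The two terms in each \<open>schouten_term\<close> coincide, so the bracket
  is twice the cyclic sum in \<open>jacobi\<close>.\<close>

lemma local_poisson_sharp:
  assumes "c \<in> A"
  shows "local_poisson B (chart_img c) (sharp c)"
proof (intro local_poisson.intro orthonormal_basis_axioms local_poisson_axioms.intro)
  show "open (chart_img c)" "smooth_on (chart_img c) (sharp c)"
    by (rule open_img[OF assms], rule smooth_sharp[OF assms])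
  fix x assume x: "x \<in> chart_img c"
  show "a \<bullet> sharp c x b = - (sharp c x a \<bullet> b)" for a b
    using inner_sharp[OF assms x] skew_bivector[OF assms inv_dom[OF assms x]] by (metis inner_commute)
  let ?D = "\<lambda>v. frechet_derivative (sharp c) (at x) v"
  let ?i = "blinfun_inner_left :: 'e \<Rightarrow> 'e \<Rightarrow>\<^sub>L real"
  have fd: "frechet_derivative (\<lambda>x. P c (chart_inv c x) (?i b) (?i d)) (at x) v = d \<bullet> ?D v b" for b d v
  proof -
    have "((\<lambda>x. d \<bullet> sharp c x b) has_derivative (\<lambda>v. d \<bullet> ?D v b)) (at x)"
      by (rule bounded_linear.has_derivative[OF bounded_linear_inner_right
            bounded_linear.has_derivative[OF blinfun.bounded_linear_left smooth_on_derivative(1)[OF smooth_sharp[OF assms] x]]])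
    then have "((\<lambda>x. P c (chart_inv c x) (?i b) (?i d)) has_derivative (\<lambda>v. d \<bullet> ?D v b)) (at x)"
      by (rule has_derivative_transform_within_open[OF _ open_img[OF assms] x]) (simp add: inner_sharp assms)
    then show ?thesis by (simp add: frechet_derivative_at[symmetric])
  qed
  have con: "contract P c (chart_inv c x) (?i a) = sharp c x a" for a
    using contract_eq_sharp[OF assms inv_dom[OF assms x]] by (simp add: map_inv assms x)
  fix a b d
  have "schouten_bracket P P c (chart_inv c x) (?i a) (?i b) (?i d) = 0"
    using poisson assms inv_dom[OF assms x] unfolding poisson_manifold_def by blast
  then show "d \<bullet> ?D (sharp c x a) b + a \<bullet> ?D (sharp c x b) d + b \<bullet> ?D (sharp c x d) a = 0"
    unfolding schouten_bracket_def schouten_term_def con map_inv[OF assms x] fd by simp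
qed

text \<open>The differential as a vector of the model space, by its fixed inner product; unrelated
  to the Riemannian metric on the manifold.\<close>

definition gradient :: "('m, 'e) chart \<Rightarrow> ('m \<Rightarrow> real) \<Rightarrow> 'e \<Rightarrow> 'e" where
  "gradient c f x = (\<Sum>b\<in>B. frechet_derivative (f \<circ> chart_inv c) (at x) b *\<^sub>R b)"

lemma gradient_eqI:
  assumes "((f \<circ> chart_inv c) has_derivative (\<lambda>v. v \<bullet> w)) (at x)"
  shows "gradient c f x = w"
  using expansion[of w] frechet_derivative_at[OF assms, symmetric] by (simp add: gradient_def inner_commute)

lemma ham_vector_field_eq_sharp:
  assumes "c \<in> A" "p \<in> chart_dom c" "(f \<circ> chart_inv c) differentiable (at (chart_map c p))"
  shows "ham_vector_field P f c p = sharp c (chart_map c p) (gradient c f (chart_map c p))"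
proof -
  let ?D = "frechet_derivative (f \<circ> chart_inv c) (at (chart_map c p))"
  have "bounded_linear ?D"
    using assms(3) frechet_derivative_works has_derivative_bounded_linear by blast
  then have "chart_differential c f p = blinfun_inner_left (gradient c f (chart_map c p))"
    using riesz[of "chart_differential c f p"]
    by (simp add: chart_differential_def gradient_def bounded_linear_Blinfun_apply)
  then show ?thesis by (simp add: ham_vector_field_def contract_eq_sharp assms)
qed

text \<open>Smoothness on \<open>[0,1] \<times> M\<close> only provides local extensions
  \<open>F\<close>. The map \<open>G\<close> is the spatial part of the derivative of
  \<open>F\<close>, so it is smooth on an open set, and at times in \<open>[0,1]\<close>, end points
  included, it is determined by \<open>H\<close> because only space is differentiated.\<close>

lemma gradient_local_extension:
  assumes H: "smooth_time_dependent A H" and "c \<in> A" "t \<in> {0..1}" "x \<in> chart_img c"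
  obtains W G where "open W" "(t, x) \<in> W" "smooth_on W G"
    "\<And>s y. (s, y) \<in> W \<Longrightarrow> s \<in> {0..1} \<Longrightarrow> y \<in> chart_img c \<Longrightarrow>
      (H s \<circ> chart_inv c) differentiable (at y) \<and> gradient c (H s) y = G (s, y)"
proof -
  have "\<exists>W F. open W \<and> (t, x) \<in> W \<and> smooth_on W F \<and>
      (\<forall>(s, y)\<in>W \<inter> ({0..1} \<times> chart_img c). F (s, y) = H s (chart_inv c y))"
    by (rule bspec[OF bspec[OF bspec[OF H[unfolded smooth_time_dependent_def] assms(2)] assms(3)]
          inv_dom[OF assms(2,4)], unfolded map_inv[OF assms(2,4)]])
  then obtain W F where W: "open W" "(t, x) \<in> W" "smooth_on W F"
    and F': "\<forall>(s, y)\<in>W \<inter> ({0..1} \<times> chart_img c). F (s, y) = H s (chart_inv c y)"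
    by blast
  have F: "F (s, y) = H s (chart_inv c y)" if "(s, y) \<in> W" "s \<in> {0..1}" "y \<in> chart_img c" for s y
    using bspec[OF F', of "(s, y)"] that by simp
  define G where "G z = (\<Sum>b\<in>B. frechet_derivative F (at z) (0, b) *\<^sub>R b)" for z
  have "smooth_on W G"
    unfolding G_def
    by (intro smooth_on_sum W(1) smooth_on_bounded_linear[OF bounded_linear_scaleR_left] smooth_on_derivative(2)[OF W(3)])
  moreover have "(H s \<circ> chart_inv c) differentiable (at y) \<and> gradient c (H s) y = G (s, y)"
    if sy: "(s, y) \<in> W" "s \<in> {0..1}" "y \<in> chart_img c" for s y
  proof -
    have "((\<lambda>y. F (s, y)) has_derivative (\<lambda>v. frechet_derivative F (at (s, y)) (0, v))) (at y)"
      using has_derivative_compose[of "\<lambda>y. (s, y)" "\<lambda>v. (0, v)" y UNIV F, OF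
          has_derivative_Pair[OF has_derivative_const has_derivative_ident] smooth_on_derivative(1)[OF W(3) sy(1)]] .
    moreover have "open (Pair s -` W \<inter> chart_img c)"
      by (intro open_Int open_img assms(2) open_vimage[OF W(1)] continuous_intros)
    ultimately have d: "((H s \<circ> chart_inv c) has_derivative (\<lambda>v. frechet_derivative F (at (s, y)) (0, v))) (at y)"
      by (rule has_derivative_transform_within_open[of _ _ _ _ "Pair s -` W \<inter> chart_img c"])
         (use sy F in auto)
    then have "gradient c (H s) y = G (s, y)"
      using frechet_derivative_at[OF d, symmetric] by (simp add: gradient_def G_def)
    then show ?thesis using d by (auto simp: differentiable_def)
  qed
  ultimately show ?thesis using that[of W G] W by blast
qed

lemma smooth_time_dependent_differentiable:
  assumes "smooth_time_dependent A H" "c \<in> A" "t \<in> {0..1}" "x \<in> chart_img c"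
  shows "(H t \<circ> chart_inv c) differentiable (at x)"
  using gradient_local_extension[OF assms] assms by metis

lemma continuous_on_gradient:
  assumes "smooth_time_dependent A H" "c \<in> A"
  shows "continuous_on ({0..1} \<times> chart_img c) (\<lambda>(t, x). gradient c (H t) x)"
  unfolding continuous_on_eq_continuous_within
proof (intro ballI)
  fix z :: "real \<times> 'e" assume z: "z \<in> {0..1} \<times> chart_img c"
  obtain t :: real and x where tx: "z = (t, x)" "t \<in> {0..1}" "x \<in> chart_img c" using z by auto
  obtain W G where W: "open W" "(t, x) \<in> W" "smooth_on W G"
    "\<And>s y. (s, y) \<in> W \<Longrightarrow> s \<in> {0..1} \<Longrightarrow> y \<in> chart_img c \<Longrightarrow>
      (H s \<circ> chart_inv c) differentiable (at y) \<and> gradient c (H s) y = G (s, y)"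
    using gradient_local_extension[OF assms tx(2,3)] by blast
  have "continuous (at (t, x)) G"
    using smooth_on_imp_continuous_on[OF W(3)] W(1,2) continuous_on_eq_continuous_at by blast
  then have "(G \<longlongrightarrow> G (t, x)) (at (t, x) within {0..1} \<times> chart_img c)"
    unfolding continuous_at by (rule tendsto_within_subset) simp
  then have "((\<lambda>(t, x). gradient c (H t) x) \<longlongrightarrow> G (t, x)) (at (t, x) within {0..1} \<times> chart_img c)"
  proof (rule Lim_transform_eventually)
    show "\<forall>\<^sub>F y in at (t, x) within {0..1} \<times> chart_img c. G y = (case y of (t, x) \<Rightarrow> gradient c (H t) x)"
      unfolding eventually_at_topological using W by (intro exI[of _ W]) auto
  qed
  then show "continuous (at z within {0..1} \<times> chart_img c) (\<lambda>(t, x). gradient c (H t) x)"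
    using W(4)[OF W(2) tx(2,3)] by (simp add: continuous_within tx)
qed

lemma local_lipschitz_gradient:
  assumes "smooth_time_dependent A H" "c \<in> A"
  shows "local_lipschitz {0..1} (chart_img c) (\<lambda>t. gradient c (H t))"
proof (rule local_lipschitzI)
  fix t x assume tx: "t \<in> {0..1::real}" "x \<in> chart_img c"
  obtain W G where W: "open W" "(t, x) \<in> W" "smooth_on W G"
    "\<And>s y. (s, y) \<in> W \<Longrightarrow> s \<in> {0..1} \<Longrightarrow> y \<in> chart_img c \<Longrightarrow>
      (H s \<circ> chart_inv c) differentiable (at y) \<and> gradient c (H s) y = G (s, y)"
    using gradient_local_extension[OF assms tx] by blast
  obtain e where e: "e > 0" "ball (t, x) e \<subseteq> W" using W(1,2) open_contains_ball by blast
  define u where "u = e / 3"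
  have "u > 0" using e by (simp add: u_def)
  let ?K = "cball t u \<times> cball x u"
  have KW: "?K \<subseteq> W"
  proof
    fix z assume "z \<in> ?K"
    then have "dist t (fst z) \<le> u" "dist x (snd z) \<le> u" by auto
    then have "dist (t, x) z \<le> u + u"
      unfolding dist_prod_def by (intro order_trans[OF sqrt_sum_squares_le_sum_abs]) auto
    then have "z \<in> ball (t, x) e" using \<open>u > 0\<close> by (simp add: u_def)
    then show "z \<in> W" using e by blast
  qed
  obtain L where L: "L \<ge> 0" "\<And>z z'. z \<in> ?K \<Longrightarrow> z' \<in> ?K \<Longrightarrow> norm (G z - G z') \<le> L * norm (z - z')"
  proof (rule C1_lipschitz[OF coordinate_system_prod _ _ _ KW])
    show "Ck_on 1 W G" using W(3) unfolding smooth_on_def by blast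
  qed (auto intro: compact_Times convex_Times)
  have "L-lipschitz_on (cball x u \<inter> chart_img c) (gradient c (H s))" if s: "s \<in> cball t u \<inter> {0..1}" for s
  proof (rule lipschitz_onI)
    fix y y' assume y: "y \<in> cball x u \<inter> chart_img c" "y' \<in> cball x u \<inter> chart_img c"
    have "gradient c (H s) y = G (s, y)" "gradient c (H s) y' = G (s, y')"
      using y s by (auto intro!: conjunct2[OF W(4)] subsetD[OF KW])
    then show "dist (gradient c (H s) y) (gradient c (H s) y') \<le> L * dist y y'"
      using L(2)[of "(s, y)" "(s, y')"] s y by (simp add: dist_norm norm_prod_def)
  qed (rule L(1))
  then show "\<exists>u>0. \<exists>L. \<forall>s\<in>cball t u \<inter> {0..1}. L-lipschitz_on (cball x u \<inter> chart_img c) (gradient c (H s))"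
    using \<open>u > 0\<close> by blast
qed

section \<open>Change of charts and Hamiltonian curves on the manifold\<close>

lemma has_derivative_transition:
  assumes "c \<in> A" "c' \<in> A" "p \<in> chart_dom c" "p \<in> chart_dom c'"
  shows "((chart_map c' \<circ> chart_inv c) has_derivative coord_change c c' p) (at (chart_map c p))"
  unfolding coord_change_def
  by (rule smooth_on_derivative(1)[OF smooth_transition[OF assms(1,2)]]) (use assms in auto)

text \<open>An integral curve must satisfy its equation in every chart, while curves are constructed
  in one. The chain rule for the differential and the transformation law of the bivector combine to
  that of a vector.\<close>

lemma ham_vector_field_change:
  assumes cc: "c \<in> A" "c' \<in> A" and p: "p \<in> chart_dom c" "p \<in> chart_dom c'"
    and d: "(f \<circ> chart_inv c') differentiable (at (chart_map c' p))"
  shows "ham_vector_field P f c' p = coord_change c c' p (ham_vector_field P f c p)"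
proof -
  let ?J = "coord_change c c' p"
  let ?D' = "frechet_derivative (f \<circ> chart_inv c') (at (chart_map c' p))"
  have J: "((chart_map c' \<circ> chart_inv c) has_derivative ?J) (at (chart_map c p))"
    by (rule has_derivative_transition[OF cc p])
  have D': "((f \<circ> chart_inv c') has_derivative ?D') (at (chart_map c' p))"
    using d frechet_derivative_works by blast
  have e: "(chart_map c' \<circ> chart_inv c) (chart_map c p) = chart_map c' p"
    using cc p by (simp add: inv_map)
  have "((\<lambda>x. (f \<circ> chart_inv c') ((chart_map c' \<circ> chart_inv c) x)) has_derivative (\<lambda>v. ?D' (?J v))) (at (chart_map c p))"
    by (rule has_derivative_compose[OF J]) (unfold e, rule D')
  then have "((f \<circ> chart_inv c) has_derivative (\<lambda>v. ?D' (?J v))) (at (chart_map c p))"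
  proof (rule has_derivative_transform_within_open)
    show "open (chart_map c ` (chart_dom c \<inter> chart_dom c'))"
      by (rule open_chart_image[OF cc(1) open_dom[OF cc(2)]])
  qed (use p cc in \<open>auto simp: inv_map\<close>)
  then have fd: "frechet_derivative (f \<circ> chart_inv c) (at (chart_map c p)) = (\<lambda>v. ?D' (?J v))"
    by (simp add: frechet_derivative_at[symmetric])
  have bl: "bounded_linear ?J" "bounded_linear ?D'"
    using J D' has_derivative_bounded_linear by blast+
  have cd: "chart_differential c f p = chart_differential c' f p o\<^sub>L Blinfun ?J"
    unfolding chart_differential_def fd
    by (rule blinfun_eqI) (simp add: bounded_linear_Blinfun_apply bl bounded_linear_compose[OF bl(2,1)])
  show ?thesis
    unfolding ham_vector_field_def
  proof (rule contract_characterization(2)[OF cc(2) p(2)])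
    fix \<beta> :: "'e \<Rightarrow>\<^sub>L real"
    have "\<beta> (?J (contract P c p (chart_differential c f p)))
        = (\<beta> o\<^sub>L Blinfun ?J) (contract P c p (chart_differential c f p))"
      by (simp add: bounded_linear_Blinfun_apply bl)
    also have "\<dots> = P c p (chart_differential c f p) (\<beta> o\<^sub>L Blinfun ?J)"
      by (rule contract_characterization(1)[OF cc(1) p(1)])
    also have "\<dots> = P c' p (chart_differential c' f p) \<beta>"
      unfolding cd by (rule P_change[symmetric]) (use cc p in auto)
    finally show "\<beta> (?J (contract P c p (chart_differential c f p))) = P c' p (chart_differential c' f p) \<beta>" .
  qed
qed

text \<open>The Hamiltonian is the linear function with differential \<open>h t\<close>, multiplied
  by a bump function. The bump is 1 on radius \<open>2 * R\<close>, a neighbourhood of the curve in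
  radius \<open>R\<close>, and 0 outside radius \<open>4 * R\<close>, so that the product extends by
  0 to the manifold.\<close>

lemma ham_reachable_chart_curve:
  assumes c: "c \<in> A" and "0 < R" and ball: "cball q (4 * R) \<subseteq> chart_img c"
    and h: "smooth_on {-1<..<2::real} h"
    and u: "\<And>t. t \<in> {-1<..<2} \<Longrightarrow> u t \<in> cball q R"
    and ud: "\<And>t. t \<in> {-1<..<2} \<Longrightarrow> (u has_vector_derivative sharp c (u t) (h t)) (at t)"
  shows "ham_reachable A P (chart_inv c (u 0)) (chart_inv c (u 1))"
proof -
  obtain \<psi> :: "'e \<Rightarrow> real" where \<psi>: "smooth_on UNIV \<psi>" "\<And>x. x \<in> ball q (2 * R) \<Longrightarrow> \<psi> x = 1"
    "\<And>x. x \<notin> ball q (4 * R) \<Longrightarrow> \<psi> x = 0"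
    using smooth_bump[of "2 * R" q] \<open>0 < R\<close> by auto
  define H where "H t p = (if p \<in> chart_dom c then \<psi> (chart_map c p) * (h t \<bullet> chart_map c p) else 0)" for t p
  have smH: "smooth_time_dependent A H"
    unfolding smooth_time_dependent_def
  proof (intro ballI)
    fix c' t p assume c': "c' \<in> A" and t: "t \<in> {0..1::real}" and p: "p \<in> chart_dom c'"
    have tI: "t \<in> {-1<..<2}" using t by auto
    show "\<exists>W F. open W \<and> (t, chart_map c' p) \<in> W \<and> smooth_on W F \<and>
        (\<forall>(s, y)\<in>W \<inter> ({0..1} \<times> chart_img c'). F (s, y) = H s (chart_inv c' y))"
    proof (cases "p \<in> chart_dom c")
      case True
      define N where "N = chart_map c' ` (chart_dom c' \<inter> chart_dom c)"
      have "open N" unfolding N_def by (rule open_chart_image[OF c' open_dom[OF c]])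
      define W where "W = {-1<..<2::real} \<times> N"
      have "open W" unfolding W_def by (intro open_Times \<open>open N\<close> open_greaterThanLessThan)
      define \<tau> where "\<tau> = chart_map c \<circ> chart_inv c'"
      have sN: "smooth_on N \<tau>" unfolding N_def \<tau>_def by (rule smooth_transition[OF c' c])
      have s\<tau>: "smooth_on W (\<lambda>z. \<tau> (snd z))"
        by (rule smooth_on_compose[OF coordinate_system_B \<open>open W\<close> \<open>open N\<close> _ sN])
           (auto simp: W_def intro!: smooth_on_bounded_linear[OF bounded_linear_snd] smooth_on_id open_Times \<open>open N\<close>)
      have sh: "smooth_on W (\<lambda>z. h (fst z))"
        by (rule smooth_on_compose[OF coordinate_system_real \<open>open W\<close> open_greaterThanLessThan _ h])
           (auto simp: W_def intro!: smooth_on_bounded_linear[OF bounded_linear_fst] smooth_on_id open_Times \<open>open N\<close>)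
      have s\<psi>: "smooth_on W (\<lambda>z. \<psi> (\<tau> (snd z)))"
        by (rule smooth_on_compose[OF coordinate_system_B \<open>open W\<close> open_UNIV subset_UNIV \<psi>(1) s\<tau>])
      have "smooth_on W (\<lambda>z. \<psi> (\<tau> (snd z)) * (h (fst z) \<bullet> \<tau> (snd z)))"
        by (intro smooth_on_bilinear[OF bounded_bilinear_mult] smooth_on_bilinear[OF bounded_bilinear_inner] \<open>open W\<close> s\<psi> sh s\<tau>)
      moreover have "(t, chart_map c' p) \<in> W" using tI p True by (auto simp: W_def N_def)
      moreover have "\<forall>(s, y)\<in>W \<inter> ({0..1} \<times> chart_img c'). \<psi> (\<tau> (snd (s, y))) * (h (fst (s, y)) \<bullet> \<tau> (snd (s, y))) = H s (chart_inv c' y)"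
      proof -
        have "chart_inv c' y \<in> chart_dom c" if "y \<in> N" for y
          using that inv_map[OF c'] by (auto simp: N_def)
        then show ?thesis by (auto simp: W_def H_def \<tau>_def)
      qed
      ultimately show ?thesis
        using \<open>open W\<close> by (intro exI[of _ W] exI[of _ "\<lambda>z. \<psi> (\<tau> (snd z)) * (h (fst z) \<bullet> \<tau> (snd z))"]) auto
    next
      case False
      \<comment> \<open>The support lies in this compact set, which is closed because the manifold
        is Hausdorff. A point outside the domain of \<open>c\<close> therefore has a neighbourhood
        on which \<open>H\<close> is 0.\<close>
      define K where "K = chart_inv c ` cball q (4 * R)"
      have "compact K" unfolding K_def
        by (intro compact_continuous_image continuous_on_subset[OF cont_inv[OF c] ball] compact_cball)
      then have "open (- K)" by (simp add: compact_imp_closed open_Compl)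
      have "K \<subseteq> chart_dom c" unfolding K_def using inv_dom[OF c] ball by blast
      define W where "W = {-1<..<2::real} \<times> chart_map c' ` (chart_dom c' \<inter> - K)"
      have "open W" unfolding W_def
        by (intro open_Times open_greaterThanLessThan open_chart_image[OF c' \<open>open (- K)\<close>])
      moreover have "(t, chart_map c' p) \<in> W" using tI p False \<open>K \<subseteq> chart_dom c\<close> by (auto simp: W_def)
      moreover have H0: "H s p' = 0" if "p' \<notin> K" for s p'
      proof (cases "p' \<in> chart_dom c")
        case True
        then have "chart_map c p' \<notin> cball q (4 * R)"
          using that inv_map[OF c True] unfolding K_def by (metis imageI)
        then show ?thesis using \<psi>(3)[of "chart_map c p'"] by (auto simp: H_def)
      qed (simp add: H_def)
      moreover have "\<forall>(s, y)\<in>W \<inter> ({0..1} \<times> chart_img c'). 0 = H s (chart_inv c' y)"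
      proof -
        have "chart_inv c' y \<notin> K" if "y \<in> chart_map c' ` (chart_dom c' \<inter> - K)" for y
          using that inv_map[OF c'] by auto
        then show ?thesis using H0 by (auto simp: W_def)
      qed
      ultimately show ?thesis
        by (intro exI[of _ W] exI[of _ "\<lambda>_. 0"]) (auto intro: smooth_on_const)
    qed
  qed
  define \<gamma> where "\<gamma> t = chart_inv c (u t)" for t
  have uimg: "u t \<in> chart_img c" if "t \<in> {-1<..<2}" for t
    using u[OF that] ball \<open>0 < R\<close> by auto
  have sub: "t \<in> {-1<..<2}" if "t \<in> {0..1}" for t :: real using that by auto
  have ucont: "continuous_on {0..1} u"
    using ud[OF sub] by (meson continuous_at_imp_continuous_on has_vector_derivative_continuous)
  have "ham_integral_curve A P H {0..1} \<gamma>"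
    unfolding ham_integral_curve_def
  proof (intro conjI ballI impI)
    show "continuous_on {0..1} \<gamma>"
      unfolding \<gamma>_def by (rule continuous_on_compose2[OF cont_inv[OF c] ucont]) (use uimg[OF sub] in auto)
    fix t c' assume t: "t \<in> {0..1::real}" and c': "c' \<in> A" and \<gamma>c': "\<gamma> t \<in> chart_dom c'"
    have \<gamma>c: "\<gamma> t \<in> chart_dom c" unfolding \<gamma>_def by (rule inv_dom[OF c uimg[OF sub[OF t]]])
    have mu: "chart_map c (\<gamma> t) = u t" unfolding \<gamma>_def by (rule map_inv[OF c uimg[OF sub[OF t]]])
    have "((\<lambda>x. h t \<bullet> x) has_derivative (\<lambda>v. v \<bullet> h t)) (at (u t))"
      using bounded_linear.has_derivative[OF bounded_linear_inner_right has_derivative_ident, of "h t"]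
      by (simp add: inner_commute)
    then have dH: "((H t \<circ> chart_inv c) has_derivative (\<lambda>v. v \<bullet> h t)) (at (u t))"
    proof (rule has_derivative_transform_within_open)
      show "u t \<in> ball q (2 * R)" using u[OF sub[OF t]] \<open>0 < R\<close> by auto
      fix x assume x: "x \<in> ball q (2 * R)"
      then have "x \<in> chart_img c" using ball \<open>0 < R\<close> by (intro subsetD[OF ball]) auto
      then show "h t \<bullet> x = (H t \<circ> chart_inv c) x"
        using \<psi>(2)[OF x] inv_dom[OF c] map_inv[OF c] by (simp add: H_def)
    qed simp
    have "ham_vector_field P (H t) c (\<gamma> t) = sharp c (u t) (h t)"
      using ham_vector_field_eq_sharp[OF c \<gamma>c, of "H t"] dH gradient_eqI[OF dH] by (auto simp: mu differentiable_def)
    then have "(u has_vector_derivative ham_vector_field P (H t) c (\<gamma> t)) (at t)"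
      using ud[OF sub[OF t]] by simp
    then have "((chart_map c' \<circ> chart_inv c \<circ> u) has_vector_derivative coord_change c c' (\<gamma> t) (ham_vector_field P (H t) c (\<gamma> t))) (at t)"
      by (rule vector_derivative_diff_chain_within[OF _ has_derivative_at_withinI])
         (rule has_derivative_transition[OF c c' \<gamma>c \<gamma>c', unfolded mu])
    moreover have "ham_vector_field P (H t) c' (\<gamma> t) = coord_change c c' (\<gamma> t) (ham_vector_field P (H t) c (\<gamma> t))"
      by (rule ham_vector_field_change[OF c c' \<gamma>c \<gamma>c'])
         (rule smooth_time_dependent_differentiable[OF smH c' t], use \<gamma>c' in auto)
    ultimately show "((\<lambda>s. chart_map c' (\<gamma> s)) has_vector_derivative ham_vector_field P (H t) c' (\<gamma> t)) (at t within {0..1})"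
      by (simp add: \<gamma>_def o_def has_vector_derivative_at_within)
  qed
  then show ?thesis
    unfolding ham_reachable_def using smH by (intro exI[of _ H] exI[of _ 1] exI[of _ \<gamma>]) (auto simp: \<gamma>_def)
qed

lemma ham_integral_curve_in_chart:
  assumes H: "smooth_time_dependent A H" and curve: "ham_integral_curve A P H {0..1} \<gamma>"
    and c: "c \<in> A" and t: "0 < t" "t < 1" "\<gamma> t \<in> chart_dom c"
  shows "((\<lambda>s. chart_map c (\<gamma> s)) has_vector_derivative
    sharp c (chart_map c (\<gamma> t)) (gradient c (H t) (chart_map c (\<gamma> t)))) (at t)"
proof -
  have "((\<lambda>s. chart_map c (\<gamma> s)) has_vector_derivative ham_vector_field P (H t) c (\<gamma> t)) (at t within {0..1})"
    using curve c t unfolding ham_integral_curve_def by auto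
  moreover have "ham_vector_field P (H t) c (\<gamma> t) = sharp c (chart_map c (\<gamma> t)) (gradient c (H t) (chart_map c (\<gamma> t)))"
    using c t by (intro ham_vector_field_eq_sharp smooth_time_dependent_differentiable[OF H]) auto
  ultimately show ?thesis using at_within_Icc_at[of 0 t 1] t by simp
qed

text \<open>\<open>G\<close> captures curves through \<open>p\<close> only: the leaf may return to
  the coordinate ball along other plaques. Closedness of the leaf is neither claimed nor true in
  general.\<close>

lemma leaf_locally_closed:
  assumes c: "c \<in> A" "p \<in> chart_dom c"
  obtains r G where "0 < r" "cball (chart_map c p) r \<subseteq> chart_img c" "closed G"
    "\<And>a b t0 \<gamma> H t. \<lbrakk>smooth_time_dependent A H; ham_integral_curve A P H {0..1} \<gamma>; {a..b} \<subseteq> {0..1};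
        t0 \<in> {a..b}; \<gamma> t0 = p; \<forall>t\<in>{a..b}. \<gamma> t \<in> chart_dom c \<and> chart_map c (\<gamma> t) \<in> cball (chart_map c p) r;
        t \<in> {a..b}\<rbrakk> \<Longrightarrow> chart_map c (\<gamma> t) \<in> G"
    "\<And>x. x \<in> G \<Longrightarrow> ham_reachable A P p (chart_inv c x) \<and> ham_reachable A P (chart_inv c x) p"
proof -
  define q where "q = chart_map c p"
  have qi: "q \<in> chart_img c" using c by (simp add: q_def)
  interpret lp: local_poisson B "chart_img c" "sharp c" by (rule local_poisson_sharp[OF c(1)])
  obtain Q S U where "split_poisson B (chart_img c) (sharp c) q Q S U"
    by (rule lp.partial_inverse[OF qi])
       (rule that, intro split_poisson.intro lp.local_poisson_axioms split_poisson_axioms.intro)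
  then interpret sp: split_poisson B "chart_img c" "sharp c" q Q S U .
  obtain r R G where G: "0 < r" "cball q r \<subseteq> chart_img c" "0 < R" "cball q (4 * R) \<subseteq> chart_img c" "closed G"
    and stay: "\<And>a b t0 \<gamma> h M t. \<lbrakk>t0 \<in> {a..b}; \<gamma> t0 = q; continuous_on {a..b} \<gamma>; \<forall>t\<in>{a..b}. \<gamma> t \<in> cball q r;
        \<forall>t\<in>{a<..<b}. (\<gamma> has_vector_derivative sharp c (\<gamma> t) (h t)) (at t) \<and> norm (h t) \<le> M; t \<in> {a..b}\<rbrakk>
      \<Longrightarrow> \<gamma> t \<in> G"
    and reach: "\<And>x. x \<in> G \<Longrightarrow> \<exists>u h. u 0 = q \<and> u 1 = x \<and> smooth_on {-1<..<2} h \<and>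
        (\<forall>t\<in>{-1<..<2::real}. u t \<in> cball q R \<and> (u has_vector_derivative sharp c (u t) (h t)) (at t))"
    by (rule sp.plaque) (rule that)
  show ?thesis
  proof
    show "0 < r" "closed G" by fact+
    show "cball (chart_map c p) r \<subseteq> chart_img c" using G(2) by (simp add: q_def)
  next
    fix a b t0 \<gamma> H and t :: real
    assume H: "smooth_time_dependent A H" and curve: "ham_integral_curve A P H {0..1} \<gamma>"
      and ab: "{a..b} \<subseteq> {0..1}" and t0: "t0 \<in> {a..b}" "\<gamma> t0 = p"
      and dom: "\<forall>t\<in>{a..b}. \<gamma> t \<in> chart_dom c \<and> chart_map c (\<gamma> t) \<in> cball (chart_map c p) r"
      and t: "t \<in> {a..b}"
    have cont: "continuous_on {a..b} (\<lambda>s. chart_map c (\<gamma> s))"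
      using curve ab dom unfolding ham_integral_curve_def
      by (intro continuous_on_compose2[OF cont_map[OF c(1)]]) (auto intro: continuous_on_subset)
    define h where "h s = gradient c (H s) (chart_map c (\<gamma> s))" for s
    have "continuous_on {a..b} (\<lambda>s. (\<lambda>(t, x). gradient c (H t) x) (s, chart_map c (\<gamma> s)))"
      by (rule continuous_on_compose2[OF continuous_on_gradient[OF H c(1)]])
         (use dom ab cont in \<open>auto intro!: continuous_intros\<close>)
    then have "bounded (h ` {a..b})"
      unfolding h_def by (intro compact_imp_bounded compact_continuous_image) auto
    then obtain M where M: "\<forall>s\<in>{a..b}. norm (h s) \<le> M" by (auto simp: bounded_iff)
    have t01: "0 < s" "s < 1" if "s \<in> {a<..<b}" for s
      using ab that by (auto simp: subset_iff) (metis atLeastAtMost_iff less_le_trans le_less_trans less_imp_le order_refl)+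
    show "chart_map c (\<gamma> t) \<in> G"
    proof (rule stay[OF t0(1) _ cont _ _ t, of h M])
      show "chart_map c (\<gamma> t0) = q" by (simp add: t0 q_def)
      show "\<forall>t\<in>{a..b}. chart_map c (\<gamma> t) \<in> cball q r" using dom by (simp add: q_def)
      show "\<forall>t\<in>{a<..<b}. ((\<lambda>s. chart_map c (\<gamma> s)) has_vector_derivative sharp c (chart_map c (\<gamma> t)) (h t)) (at t) \<and> norm (h t) \<le> M"
        unfolding h_def[symmetric]
        using ham_integral_curve_in_chart[OF H curve c(1)] t01 dom M by (auto simp: h_def)
    qed
  next
    fix x assume "x \<in> G"
    then obtain u h where u: "u 0 = q" "u 1 = x" and h: "smooth_on {-1<..<2} h"
      and ud: "\<And>t. t \<in> {-1<..<2::real} \<Longrightarrow> u t \<in> cball q R \<and> (u has_vector_derivative sharp c (u t) (h t)) (at t)"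
      using reach by blast
    have "ham_reachable A P (chart_inv c (u 0)) (chart_inv c (u 1))"
      using ud by (intro ham_reachable_chart_curve[OF c(1) G(3,4) h]) auto
    then have 1: "ham_reachable A P p (chart_inv c x)" using u c by (simp add: q_def inv_map)
    \<comment> \<open>The way back runs the same curve in reverse, driven by
      \<open>- h (1 - t)\<close>; the time interval is symmetric about \<open>1 / 2\<close>.\<close>
    have refl: "1 - t \<in> {-1<..<2}" if "t \<in> {-1<..<2}" for t :: real using that by auto
    have smr: "smooth_on {-1<..<2::real} (\<lambda>t. 1 + (- 1) * t)"
      by (intro smooth_on_add smooth_on_const smooth_on_bounded_linear[OF bounded_linear_mult_right] smooth_on_id open_greaterThanLessThan)
    have "smooth_on {-1<..<2::real} (\<lambda>t. h (1 + (- 1) * t))"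
      by (rule smooth_on_compose[OF coordinate_system_real open_greaterThanLessThan open_greaterThanLessThan _ h smr]) auto
    then have smh: "smooth_on {-1<..<2} (\<lambda>t. - h (1 - t))"
      using smooth_on_bounded_linear[OF bounded_linear_minus[OF bounded_linear_ident] open_greaterThanLessThan] by fastforce
    have "ham_reachable A P (chart_inv c (u (1 - 0))) (chart_inv c (u (1 - 1)))"
    proof (rule ham_reachable_chart_curve[OF c(1) G(3,4) smh, of "\<lambda>t. u (1 - t)"])
      fix t :: real assume t: "t \<in> {-1<..<2}"
      show "u (1 - t) \<in> cball q R" using ud[OF refl[OF t]] by simp
      have "(u has_vector_derivative sharp c (u (1 - t)) (h (1 - t))) (at (1 - t))" using ud[OF refl[OF t]] by simp
      then show "((\<lambda>t. u (1 - t)) has_vector_derivative sharp c (u (1 - t)) (- h (1 - t))) (at t)"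
        using vector_diff_chain_at[OF has_vector_derivative_diff[OF has_vector_derivative_const has_vector_derivative_id], of u _ 1 t]
        by (simp add: o_def blinfun.minus_right)
    qed
    then have "ham_reachable A P (chart_inv c x) p" using u c by (simp add: q_def inv_map)
    with 1 show "ham_reachable A P p (chart_inv c x) \<and> ham_reachable A P (chart_inv c x) p" by simp
  qed
qed

end

section \<open>Riemannian distance and coordinates\<close>

lemma piecewise_interval:
  fixes \<tau> :: "nat \<Rightarrow> real"
  assumes "\<tau> 0 < t" "t < \<tau> m" "t \<notin> \<tau> ` {..m}"
  shows "\<exists>i<m. \<tau> i < t \<and> t < \<tau> (Suc i)"
  using assms
proof (induction m)
  case (Suc m)
  show ?case
  proof (cases "t < \<tau> m")
    case True
    then have "\<exists>i<m. \<tau> i < t \<and> t < \<tau> (Suc i)" using Suc by (intro Suc.IH) auto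
    then show ?thesis using less_SucI by blast
  next
    case False
    then have "\<tau> m < t" using Suc.prems(3) by (auto simp: less_le)
    then show ?thesis using Suc.prems by blast
  qed
qed simp

lemma piecewise_C1_curve_continuous_on:
  assumes "piecewise_C1_curve A \<gamma>"
  shows "continuous_on {0..1} \<gamma>"
proof -
  obtain n \<tau> where \<tau>: "\<tau> 0 = 0" "\<tau> n = 1"
    "\<And>i. i < n \<Longrightarrow> \<tau> i < \<tau> (Suc i)" "\<And>i. i < n \<Longrightarrow> C1_curve A {\<tau> i..\<tau> (Suc i)} \<gamma>"
    using assms unfolding piecewise_C1_curve_def by blast
  have "\<tau> 0 \<le> \<tau> m \<and> continuous_on {\<tau> 0..\<tau> m} \<gamma>" if "m \<le> n" for m
    using that
  proof (induction m)
    case (Suc m)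
    then have m: "m < n" by simp
    have IH: "\<tau> 0 \<le> \<tau> m" "continuous_on {\<tau> 0..\<tau> m} \<gamma>" using Suc by auto
    have "continuous_on {\<tau> m..\<tau> (Suc m)} \<gamma>" using \<tau>(4)[OF m] by (simp add: C1_curve_def)
    then have "continuous_on ({\<tau> 0..\<tau> m} \<union> {\<tau> m..\<tau> (Suc m)}) \<gamma>"
      using IH by (intro continuous_on_closed_Un) auto
    moreover have "{\<tau> 0..\<tau> m} \<union> {\<tau> m..\<tau> (Suc m)} = {\<tau> 0..\<tau> (Suc m)}"
      using IH(1) \<tau>(3)[OF m] by (intro ivl_disj_un_two_touch) auto
    ultimately show ?case using IH(1) \<tau>(3)[OF m] by auto
  qed (simp add: continuous_on_sing)
  from this[of n] show ?thesis using \<tau> by simp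
qed

context poisson_charts
begin

text \<open>The metric attains a positive minimum on unit vectors over the ball, and homogeneity
  extends this to all vectors.\<close>

lemma riemannian_metric_lower_bound:
  assumes g: "riemannian_metric A g" and c: "c \<in> A" and R: "cball x0 R \<subseteq> chart_img c"
  obtains \<kappa> where "\<kappa> > 0"
    "\<And>p u. p \<in> chart_dom c \<Longrightarrow> chart_map c p \<in> cball x0 R \<Longrightarrow> \<kappa> * norm u \<le> sqrt (g c p u u)"
proof -
  define G where "G z = g c (chart_inv c (fst z)) (snd z) (snd z)" for z
  have bil: "bilinear (g c p)" and pos: "u \<noteq> 0 \<Longrightarrow> g c p u u > 0" if "p \<in> chart_dom c" for p u
    using g c that unfolding riemannian_metric_def by blast+
  have cg: "continuous_on (chart_img c) (\<lambda>x. g c (chart_inv c x) u v)" for u v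
    using g c unfolding riemannian_metric_def by (intro smooth_on_imp_continuous_on) blast
  let ?K = "cball x0 R \<times> sphere (0::'e) 1"
  \<comment> \<open>Smoothness is given for fixed vectors; the expansion turns it into joint
    continuity in point and vector.\<close>
  have exp: "g c p u u = (\<Sum>a\<in>B. \<Sum>b\<in>B. (u \<bullet> a) * ((u \<bullet> b) * g c p a b))" if "p \<in> chart_dom c" for p u
  proof -
    have l: "linear (\<lambda>v. g c p v w)" and r: "linear (g c p v)" for v w
      using bil[OF that] by (auto simp: bilinear_def)
    have "g c p u u = g c p (\<Sum>a\<in>B. (u \<bullet> a) *\<^sub>R a) (\<Sum>b\<in>B. (u \<bullet> b) *\<^sub>R b)" by (simp add: expansion)
    also have "\<dots> = (\<Sum>a\<in>B. \<Sum>b\<in>B. (u \<bullet> a) * ((u \<bullet> b) * g c p a b))"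
      unfolding linear_sum[OF l] linear_scale[OF l] linear_sum[OF r] linear_scale[OF r]
      by (subst sum.swap) (simp add: sum_distrib_left mult_ac)
    finally show ?thesis .
  qed
  have G: "G z = (\<Sum>a\<in>B. \<Sum>b\<in>B. (snd z \<bullet> a) * ((snd z \<bullet> b) * g c (chart_inv c (fst z)) a b))" if "z \<in> ?K" for z
    unfolding G_def using that R by (intro exp inv_dom[OF c]) auto
  have contG: "continuous_on ?K G"
  proof -
    have "continuous_on ?K (\<lambda>z. \<Sum>a\<in>B. \<Sum>b\<in>B. (snd z \<bullet> a) * ((snd z \<bullet> b) * g c (chart_inv c (fst z)) a b))"
      by (intro continuous_intros continuous_on_compose2[OF cg]) (use R in auto)
    then show ?thesis using G by (simp cong: continuous_on_cong)
  qed
  show ?thesis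
  proof (cases "?K = {}")
    case True
    \<comment> \<open>If the ball is nonempty, \<open>?K\<close> is empty only in dimension 0, where
      every vector is 0.\<close>
    have "\<exists>u::'e. norm u = 1" if "v \<noteq> 0" for v :: 'e
      using that by (intro exI[of _ "v /\<^sub>R norm v"]) simp
    then have zero: "u = 0 \<or> cball x0 R = {}" for u :: 'e using True by (auto simp: sphere_def)
    show ?thesis
    proof (rule that[of 1])
      fix p and u :: 'e assume p: "p \<in> chart_dom c" "chart_map c p \<in> cball x0 R"
      then have "u = 0" using zero[of u] by blast
      then show "1 * norm u \<le> sqrt (g c p u u)" using bil[OF p(1)] by (simp add: bilinear_lzero)
    qed simp
  next
    case False
    have "\<exists>z0\<in>?K. \<forall>z\<in>?K. G z0 \<le> G z"
    proof (rule continuous_attains_inf[OF _ False contG])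
      have "closed {u::'e. norm u = 1}" by (intro closed_Collect_eq continuous_intros)
      then have cl: "closed (sphere (0::'e) 1)" by (simp add: sphere_def)
      have "compact (sphere (0::'e) 1)"
        unfolding compact_eq_bounded_closed
        by (intro conjI cl bounded_subset[OF bounded_cball sphere_cball])
      then show "compact ?K" by (intro compact_Times compact_cball)
    qed
    then obtain z0 where z0: "z0 \<in> ?K" "\<And>z. z \<in> ?K \<Longrightarrow> G z0 \<le> G z" by blast
    have "G z0 > 0"
      unfolding G_def using z0(1) R by (intro pos inv_dom[OF c]) auto
    show ?thesis
    proof (rule that[of "sqrt (G z0)"])
      show "sqrt (G z0) > 0" using \<open>G z0 > 0\<close> by simp
      fix p u assume p: "p \<in> chart_dom c" "chart_map c p \<in> cball x0 R"
      show "sqrt (G z0) * norm u \<le> sqrt (g c p u u)"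
      proof (cases "u = 0")
        case True
        then show ?thesis using bil[OF p(1)] by (simp add: bilinear_lzero)
      next
        case False
        define e where "e = u /\<^sub>R norm u"
        have u: "u = norm u *\<^sub>R e" using False by (simp add: e_def)
        have "G z0 \<le> G (chart_map c p, e)" using p False by (intro z0) (auto simp: e_def)
        also have "\<dots> = g c p e e" by (simp add: G_def inv_map c p)
        finally have "G z0 * (norm u)\<^sup>2 \<le> g c p e e * (norm u)\<^sup>2" by (intro mult_right_mono) auto
        also have "\<dots> = g c p u u"
          using bilinear_lmul[OF bil[OF p(1)], of "norm u" e u] bilinear_rmul[OF bil[OF p(1)], of e "norm u" e] u
          by (simp add: power2_eq_square)
        finally have "sqrt (G z0 * (norm u)\<^sup>2) \<le> sqrt (g c p u u)" by simp
        then show ?thesis by (simp add: real_sqrt_mult)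
      qed
    qed
  qed
qed

text \<open>\<open>curve_speed\<close> uses an arbitrarily chosen chart; the transformation law of
  the metric carries the value to \<open>c\<close>.\<close>

lemma curve_speed_in_chart:
  assumes g: "riemannian_metric A g" and c: "c \<in> A" and "open I" "t \<in> I"
    and dom: "\<And>s. s \<in> I \<Longrightarrow> \<gamma> s \<in> chart_dom c"
    and w: "((\<lambda>s. chart_map c (\<gamma> s)) has_vector_derivative w) (at t)"
  shows "curve_speed A g \<gamma> t = sqrt (g c (\<gamma> t) w w)"
proof -
  define c' where "c' = (SOME c. c \<in> A \<and> \<gamma> t \<in> chart_dom c)"
  have c': "c' \<in> A" "\<gamma> t \<in> chart_dom c'"
    using someI[of "\<lambda>c. c \<in> A \<and> \<gamma> t \<in> chart_dom c" c] c dom[OF \<open>t \<in> I\<close>] by (auto simp: c'_def)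
  have "((chart_map c' \<circ> chart_inv c \<circ> (\<lambda>s. chart_map c (\<gamma> s))) has_vector_derivative coord_change c c' (\<gamma> t) w) (at t)"
    by (rule vector_derivative_diff_chain_within[OF w has_derivative_at_withinI])
       (rule has_derivative_transition[OF c c'(1) dom[OF \<open>t \<in> I\<close>] c'(2)])
  then have "((\<lambda>s. chart_map c' (\<gamma> s)) has_vector_derivative coord_change c c' (\<gamma> t) w) (at t)"
    by (rule has_vector_derivative_transform_within_open[OF _ \<open>open I\<close> \<open>t \<in> I\<close>]) (simp add: inv_map c dom)
  then have "vector_derivative (\<lambda>s. chart_map c' (\<gamma> s)) (at t) = coord_change c c' (\<gamma> t) w"
    by (rule vector_derivative_at)
  moreover have "g c (\<gamma> t) w w = g c' (\<gamma> t) (coord_change c c' (\<gamma> t) w) (coord_change c c' (\<gamma> t) w)"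
    using g c c' dom[OF \<open>t \<in> I\<close>] unfolding riemannian_metric_def by blast
  ultimately show ?thesis
    unfolding curve_speed_def c'_def[symmetric] by (simp add: Let_def)
qed

text \<open>A curve that ends at \<open>q\<close> and leaves the coordinate ball of radius \<open>\<rho>\<close> around \<open>q\<close> has length
  at least \<open>\<kappa> * \<rho>\<close>: after its last exit, the coordinate in the direction of its displacement
  grows by \<open>\<rho>\<close>. The speed of a curve need not be measurable, so it is only compared with the
  derivative of that coordinate.\<close>

lemma riemannian_dist_controls_coordinates:
  assumes g: "riemannian_metric A g" and c: "c \<in> A" and "R > 0" and R: "cball x0 R \<subseteq> chart_img c"
  obtains \<kappa> where "\<kappa> > 0"
    "\<And>p q \<rho>. \<lbrakk>q \<in> chart_dom c; chart_map c q \<in> cball x0 (R / 2); 0 < \<rho>; \<rho> \<le> R / 2;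
       riemannian_dist A g p q < ennreal (\<kappa> * \<rho>)\<rbrakk>
      \<Longrightarrow> p \<in> chart_dom c \<and> norm (chart_map c p - chart_map c q) \<le> \<rho>"
proof -
  obtain \<kappa> where \<kappa>: "\<kappa> > 0"
    "\<And>p u. p \<in> chart_dom c \<Longrightarrow> chart_map c p \<in> cball x0 R \<Longrightarrow> \<kappa> * norm u \<le> sqrt (g c p u u)"
    using riemannian_metric_lower_bound[OF g c R] by metis
  have "p \<in> chart_dom c \<and> norm (chart_map c p - chart_map c q) \<le> \<rho>"
    if q: "q \<in> chart_dom c" "chart_map c q \<in> cball x0 (R / 2)" and \<rho>: "0 < \<rho>" "\<rho> \<le> R / 2"
      and dist: "riemannian_dist A g p q < ennreal (\<kappa> * \<rho>)" for p q \<rho>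
  proof (rule ccontr)
    assume neg: "\<not> (p \<in> chart_dom c \<and> norm (chart_map c p - chart_map c q) \<le> \<rho>)"
    obtain \<gamma> where \<gamma>: "piecewise_C1_curve A \<gamma>" "\<gamma> 0 = p" "\<gamma> 1 = q"
      and len: "curve_length A g \<gamma> < ennreal (\<kappa> * \<rho>)"
      using dist unfolding riemannian_dist_def INF_less_iff by blast
    have cont: "continuous_on {0..1} \<gamma>" by (rule piecewise_C1_curve_continuous_on[OF \<gamma>(1)])
    define D where "D = {p \<in> chart_dom c. chart_map c p \<in> ball (chart_map c q) \<rho>}"
    define C where "C = chart_inv c ` cball (chart_map c q) \<rho>"
    have qR: "cball (chart_map c q) \<rho> \<subseteq> cball x0 R"
    proof
      fix x assume "x \<in> cball (chart_map c q) \<rho>"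
      then show "x \<in> cball x0 R" using q(2) \<rho>(2) dist_triangle[of x0 x "chart_map c q"] by auto
    qed
    have "open D" unfolding D_def by (rule open_chart_preimage[OF c open_ball])
    have "compact C" unfolding C_def
      using qR R by (intro compact_continuous_image continuous_on_subset[OF cont_inv[OF c]] compact_cball) auto
    then have "closed C" by (rule compact_imp_closed)
    have DC: "D \<subseteq> C"
    proof
      fix p' assume "p' \<in> D"
      then have "p' = chart_inv c (chart_map c p')" "chart_map c p' \<in> cball (chart_map c q) \<rho>"
        by (auto simp: D_def inv_map c)
      then show "p' \<in> C" unfolding C_def by blast
    qed
    have CD: "p' \<in> chart_dom c" "chart_map c p' \<in> cball (chart_map c q) \<rho>" if "p' \<in> C" for p'
      using that qR R inv_dom[OF c] map_inv[OF c] unfolding C_def by (auto simp: subset_iff)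
    have "\<gamma> 0 \<notin> D" using neg by (auto simp: \<gamma> D_def dist_norm norm_minus_commute)
    define X where "X = {0..1} \<inter> \<gamma> -` (- D)"
    have "closed X"
      unfolding X_def by (rule continuous_closed_preimage[OF cont]) (use \<open>open D\<close> in auto)
    then have "compact X" using compact_Int_closed[of "{0..1}" X] by (simp add: X_def Int_absorb1)
    moreover have "X \<noteq> {}" using \<open>\<gamma> 0 \<notin> D\<close> unfolding X_def by force
    ultimately obtain t1 where t1: "t1 \<in> X" "\<And>t. t \<in> X \<Longrightarrow> t \<le> t1"
      using compact_attains_sup[of X] by auto
    have "\<gamma> 1 \<in> D" using q \<rho> by (simp add: \<gamma> D_def)
    then have "t1 \<noteq> 1" using t1(1) by (auto simp: X_def)
    then have t01: "0 \<le> t1" "t1 < 1" using t1(1) by (auto simp: X_def)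
    have afterD: "\<gamma> t \<in> D" if "t1 < t" "t \<le> 1" for t
      using t1(2)[of t] that t01 by (auto simp: X_def)
    \<comment> \<open>The point at time \<open>t1\<close> is a limit of points of \<open>D\<close>,
      hence in the closed set \<open>C\<close>. As it is not in \<open>D\<close>, its coordinate
      distance from \<open>q\<close> is exactly \<open>\<rho>\<close>.\<close>
    have "\<gamma> t1 \<in> C"
    proof (rule ccontr)
      assume "\<gamma> t1 \<notin> C"
      have "continuous (at t1 within {0..1}) \<gamma>" using cont t01 by (simp add: continuous_on_eq_continuous_within)
      then have "\<forall>\<^sub>F t in at t1 within {0..1}. \<gamma> t \<in> - C"
        using \<open>\<gamma> t1 \<notin> C\<close> \<open>closed C\<close> by (intro topological_tendstoD[of \<gamma> "\<gamma> t1"]) (auto simp: continuous_within)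
      then obtain e where e: "e > 0" "\<And>t. t \<in> {0..1} \<Longrightarrow> t \<noteq> t1 \<Longrightarrow> dist t t1 < e \<Longrightarrow> \<gamma> t \<notin> C"
        unfolding eventually_at by auto
      define t where "t = t1 + min (e / 2) ((1 - t1) / 2)"
      have t: "t1 < t" "t < 1" "t - t1 < e" using e(1) t01 by (auto simp: t_def min_def field_simps)
      then have "\<gamma> t \<notin> C" using t01 by (intro e(2)) (auto simp: dist_real_def)
      then show False using afterD[of t] t DC by auto
    qed
    define x where "x t = chart_map c (\<gamma> t)" for t
    have x1: "x 1 = chart_map c q" by (simp add: x_def \<gamma>)
    have xdist: "norm (x 1 - x t1) = \<rho>"
      using CD[OF \<open>\<gamma> t1 \<in> C\<close>] t1(1) by (auto simp: X_def D_def x_def \<gamma> dist_norm)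
    define e where "e = (x 1 - x t1) /\<^sub>R \<rho>"
    have e: "norm e = 1" "e \<bullet> (x 1 - x t1) = \<rho>"
      using xdist \<rho>(1) by (auto simp: e_def dot_square_norm power2_eq_square)
    obtain n \<tau> where \<tau>: "\<tau> 0 = (0::real)" "\<tau> n = 1" "\<And>i. i < n \<Longrightarrow> C1_curve A {\<tau> i..\<tau> (Suc i)} \<gamma>"
      using \<gamma>(1) unfolding piecewise_C1_curve_def by blast
    \<comment> \<open>All times at which differentiability may fail. The set is finite, hence
      harmless both for the fundamental theorem of calculus and for the integral.\<close>
    define Z where "Z = insert 0 (insert 1 (insert t1 (\<tau> ` {..n})))"
    have "finite Z" by (simp add: Z_def)
    define w where "w t = vector_derivative x (at t)" for t
    have inC: "\<gamma> t \<in> C" if "t \<in> {t1..1}" for t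
      using that \<open>\<gamma> t1 \<in> C\<close> afterD[of t] DC by (cases "t = t1") auto
    have xd: "(x has_vector_derivative w t) (at t)" if t: "t \<in> {t1..1} - Z" for t
    proof -
      have "0 < t" "t < 1" using t t01 by (auto simp: Z_def less_le)
      moreover have "t \<notin> \<tau> ` {..n}" using t by (auto simp: Z_def)
      ultimately obtain i where i: "i < n" "\<tau> i < t" "t < \<tau> (Suc i)"
        using piecewise_interval[of \<tau> t n] \<tau> by auto
      have "\<exists>v. (x has_vector_derivative v) (at t within {\<tau> i..\<tau> (Suc i)})"
        using \<tau>(3)[OF i(1)] c i CD(1)[OF inC[of t]] t unfolding C1_curve_def x_def by fastforce
      then obtain v where "(x has_vector_derivative v) (at t)"
        using at_within_Icc_at[OF i(2,3)] by auto
      then show ?thesis by (simp add: w_def vector_derivative_at)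
    qed
    have speed: "\<kappa> * (e \<bullet> w t) \<le> curve_speed A g \<gamma> t" if t: "t \<in> {t1..1} - Z" for t
    proof -
      have tI: "t \<in> {t1<..<1}" using t by (auto simp: Z_def less_le)
      have "curve_speed A g \<gamma> t = sqrt (g c (\<gamma> t) (w t) (w t))"
      proof (rule curve_speed_in_chart[OF g c open_greaterThanLessThan tI])
        show "\<gamma> s \<in> chart_dom c" if "s \<in> {t1<..<1}" for s using CD(1)[OF inC[of s]] that by auto
        show "((\<lambda>s. chart_map c (\<gamma> s)) has_vector_derivative w t) (at t)" using xd[OF t] by (simp add: x_def[abs_def])
      qed
      also have "\<dots> \<ge> \<kappa> * norm (w t)"
        using CD[OF inC[of t]] qR t by (intro \<kappa>(2)) auto
      also have "\<kappa> * norm (w t) \<ge> \<kappa> * (e \<bullet> w t)"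
        using norm_cauchy_schwarz[of e "w t"] e(1) \<kappa>(1) by (intro mult_left_mono) auto
      finally show ?thesis .
    qed
    define f where "f t = e \<bullet> w t" for t
    have xcont: "continuous_on {t1..1} (\<lambda>t. e \<bullet> x t)"
      unfolding x_def
      by (intro continuous_intros continuous_on_compose2[OF cont_map[OF c]] continuous_on_subset[OF cont])
         (use CD(1)[OF inC] t01 in auto)
    have fint: "(f has_integral \<rho>) {t1..1}"
    proof -
      have "(f has_integral (e \<bullet> x 1 - e \<bullet> x t1)) {t1..1}"
      proof (rule fundamental_theorem_of_calculus_interior_strong[OF \<open>finite Z\<close> _ _ xcont])
        fix t assume "t \<in> {t1<..<1} - Z"
        then show "((\<lambda>t. e \<bullet> x t) has_vector_derivative f t) (at t)"
          unfolding f_def by (intro bounded_linear.has_vector_derivative[OF bounded_linear_inner_right] xd) auto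
      qed (use t01 in auto)
      then show ?thesis using e(2) by (simp add: inner_diff_right)
    qed
    \<comment> \<open>The positive part dominates \<open>f\<close> and may enter a non-negative
      integral; its measurability is inherited from the integrable \<open>f\<close>.\<close>
    define h where "h t = max 0 (indicator {t1..1} t *\<^sub>R f t)" for t
    have hm: "h \<in> borel_measurable lebesgue"
      unfolding h_def using has_integral_implies_lebesgue_measurable[OF fint] by (intro borel_measurable_max) auto
    have "negligible Z" using \<open>finite Z\<close> by (rule negligible_finite)
    then have "AE t in lebesgue. t \<notin> Z" by (simp add: negligible_iff_null_sets AE_not_in)
    then have "AE t in lebesgue. ennreal \<kappa> * ennreal (h t) \<le> ennreal (curve_speed A g \<gamma> t) * indicator {0..1} t"
    proof eventually_elim
      case (elim t)
      show ?case
      proof (cases "t \<in> {t1..1} \<and> f t > 0")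
        case True
        then have "\<kappa> * f t \<le> curve_speed A g \<gamma> t" using speed[of t] elim by (simp add: f_def)
        then show ?thesis using True t01 \<kappa>(1) by (simp add: h_def ennreal_mult[symmetric] ennreal_leI)
      next
        case False
        then have "h t = 0" by (auto simp: h_def indicator_def)
        then show ?thesis by simp
      qed
    qed
    then have "(\<integral>\<^sup>+t. ennreal \<kappa> * ennreal (h t) \<partial>lebesgue) \<le> (\<integral>\<^sup>+t. ennreal (curve_speed A g \<gamma> t) * indicator {0..1} t \<partial>lebesgue)"
      by (rule nn_integral_mono_AE)
    also have "\<dots> = curve_length A g \<gamma>"
      unfolding curve_length_def by (simp add: nn_integral_completion)
    also note len
    finally have lt: "ennreal \<kappa> * (\<integral>\<^sup>+t. ennreal (h t) \<partial>lebesgue) < ennreal \<kappa> * ennreal \<rho>"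
      using hm \<kappa>(1) \<rho>(1) by (simp add: nn_integral_cmult ennreal_mult)
    then have lt: "(\<integral>\<^sup>+t. ennreal (h t) \<partial>lebesgue) < ennreal \<rho>"
      by (meson linorder_not_le mult_left_mono zero_le)
    then obtain I where I: "(\<integral>\<^sup>+t. ennreal (h t) \<partial>lebesgue) = ennreal I" "I \<ge> 0"
      by (cases "\<integral>\<^sup>+t. ennreal (h t) \<partial>lebesgue") auto
    have hI: "(h has_integral I) UNIV"
      using hm I by (subst has_integral_iff_nn_integral_lebesgue) (auto simp: h_def)
    have "((\<lambda>t. if t \<in> {t1..1} then f t else 0) has_integral \<rho>) UNIV"
      using fint unfolding has_integral_restrict_UNIV .
    then have "\<rho> \<le> I"
      by (rule has_integral_le[OF _ hI]) (auto simp: h_def)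
    moreover have "I < \<rho>" using lt I by (simp add: ennreal_less_iff)
    ultimately show False by simp
  qed
  then show ?thesis using that \<kappa>(1) by blast
qed

text \<open>Trades the Riemannian distance for coordinates. Limit points are taken in the ball of
  half radius, so that the ball of radius \<open>R / 2\<close> around them stays in the chart; hence
  the truncation of \<open>\<rho>\<close> to \<open>\<sigma>\<close>.\<close>

lemma C0_convergence_in_chart:
  assumes g: "riemannian_metric A g" and conv: "C0_converges_unif (riemannian_dist A g) {0..1} \<Phi> \<phi>"
    and c: "c \<in> A" and "R > 0" and R: "cball x0 R \<subseteq> chart_img c" and "compact K" "\<rho> > 0"
  obtains I where "\<And>i t p. \<lbrakk>i \<ge> I; t \<in> {0..1}; p \<in> K; \<phi> t p \<in> chart_dom c; chart_map c (\<phi> t p) \<in> cball x0 (R / 2)\<rbrakk>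
    \<Longrightarrow> \<Phi> i t p \<in> chart_dom c \<and> norm (chart_map c (\<Phi> i t p) - chart_map c (\<phi> t p)) \<le> \<rho>"
proof -
  obtain \<kappa> where \<kappa>: "\<kappa> > 0"
    "\<And>p q \<rho>. \<lbrakk>q \<in> chart_dom c; chart_map c q \<in> cball x0 (R / 2); 0 < \<rho>; \<rho> \<le> R / 2;
       riemannian_dist A g p q < ennreal (\<kappa> * \<rho>)\<rbrakk>
      \<Longrightarrow> p \<in> chart_dom c \<and> norm (chart_map c p - chart_map c q) \<le> \<rho>"
    using riemannian_dist_controls_coordinates[OF g c \<open>R > 0\<close> R] by metis
  define \<sigma> where "\<sigma> = min \<rho> (R / 2)"
  have \<sigma>: "0 < \<sigma>" "\<sigma> \<le> R / 2" "\<sigma> \<le> \<rho>" using \<open>R > 0\<close> \<open>\<rho> > 0\<close> by (auto simp: \<sigma>_def)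
  have "(\<lambda>i. SUP t\<in>{0..1}. SUP p\<in>K. riemannian_dist A g (\<Phi> i t p) (\<phi> t p)) \<longlonglongrightarrow> 0"
    using conv \<open>compact K\<close> unfolding C0_converges_unif_def by blast
  moreover have "0 < ennreal (\<kappa> * \<sigma>)" using \<kappa> \<sigma> by simp
  ultimately have "\<forall>\<^sub>F i in sequentially. (SUP t\<in>{0..1}. SUP p\<in>K. riemannian_dist A g (\<Phi> i t p) (\<phi> t p)) < ennreal (\<kappa> * \<sigma>)"
    by (rule order_tendstoD(2))
  then obtain I where I: "\<And>i. i \<ge> I \<Longrightarrow> (SUP t\<in>{0..1}. SUP p\<in>K. riemannian_dist A g (\<Phi> i t p) (\<phi> t p)) < ennreal (\<kappa> * \<sigma>)"
    by (auto simp: eventually_sequentially)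
  show ?thesis
  proof (rule that[of I])
    fix i t p assume *: "i \<ge> I" "t \<in> {0..1}" "p \<in> K" "\<phi> t p \<in> chart_dom c" "chart_map c (\<phi> t p) \<in> cball x0 (R / 2)"
    have "riemannian_dist A g (\<Phi> i t p) (\<phi> t p) \<le> (SUP t\<in>{0..1}. SUP p\<in>K. riemannian_dist A g (\<Phi> i t p) (\<phi> t p))"
      using *(2,3) by (intro SUP_upper2[of t] SUP_upper2[of p]) auto
    also have "\<dots> < ennreal (\<kappa> * \<sigma>)" by (rule I[OF *(1)])
    finally have "\<Phi> i t p \<in> chart_dom c \<and> norm (chart_map c (\<Phi> i t p) - chart_map c (\<phi> t p)) \<le> \<sigma>"
      by (intro \<kappa>(2) * \<sigma>)
    then show "\<Phi> i t p \<in> chart_dom c \<and> norm (chart_map c (\<Phi> i t p) - chart_map c (\<phi> t p)) \<le> \<rho>"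
      using \<sigma>(3) by auto
  qed
qed

end

section \<open>Limits of Hamiltonian flows\<close>

context poisson_charts
begin

lemma compact_neighbourhood:
  fixes p :: 'm
  obtains K N where "compact K" "open N" "p \<in> N" "N \<subseteq> K"
proof -
  obtain c where c: "c \<in> A" "p \<in> chart_dom c" by (rule chart_exists)
  then obtain e where e: "e > 0" "cball (chart_map c p) e \<subseteq> chart_img c"
    using open_img[OF c(1)] open_contains_cball by blast
  show ?thesis
  proof
    show "compact (chart_inv c ` cball (chart_map c p) e)"
      by (intro compact_continuous_image continuous_on_subset[OF cont_inv[OF c(1)] e(2)] compact_cball)
    show "open {p' \<in> chart_dom c. chart_map c p' \<in> ball (chart_map c p) e}"
      by (rule open_chart_preimage[OF c(1) open_ball])
    show "p \<in> {p' \<in> chart_dom c. chart_map c p' \<in> ball (chart_map c p) e}" using c e by simp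
    show "{p' \<in> chart_dom c. chart_map c p' \<in> ball (chart_map c p) e} \<subseteq> chart_inv c ` cball (chart_map c p) e"
    proof
      fix p' assume "p' \<in> {p' \<in> chart_dom c. chart_map c p' \<in> ball (chart_map c p) e}"
      then have "p' = chart_inv c (chart_map c p')" "chart_map c p' \<in> cball (chart_map c p) e"
        by (auto simp: inv_map c)
      then show "p' \<in> chart_inv c ` cball (chart_map c p) e" by blast
    qed
  qed
qed

text \<open>\<open>ham_flow\<close> makes every orbit an integral curve but does not mention
  dependence on the initial point. As long as two orbits stay in the ball, Gronwall bounds their
  distance at time \<open>s\<close> by \<open>k\<close> times that at time \<open>t\<close>, in
  either order of the times.\<close>

lemma continuous_flow_in_chart:
  assumes H: "smooth_time_dependent A H" and flow: "ham_flow A P H \<Phi>" and c: "c \<in> A"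
    and R: "cball x0 R \<subseteq> chart_img c" and ab: "{a..b} \<subseteq> {0..1}"
    and dom: "\<And>s p. s \<in> {a..b} \<Longrightarrow> p \<in> N \<Longrightarrow> \<Phi> s p \<in> chart_dom c \<and> chart_map c (\<Phi> s p) \<in> cball x0 R"
    and ts: "t \<in> {a..b}" "s \<in> {a..b}" and cont: "continuous_on N (\<Phi> t)"
  shows "continuous_on N (\<Phi> s)"
proof -
  let ?K = "cball x0 R"
  define G where "G t = gradient c (H t)" for t
  have Gc: "continuous_on ({a..b} \<times> ?K) (\<lambda>(t, x). G t x)"
    unfolding G_def by (rule continuous_on_subset[OF continuous_on_gradient[OF H c]]) (use ab R in auto)
  obtain LG where LG: "\<And>t. t \<in> {a..b} \<Longrightarrow> LG-lipschitz_on ?K (G t)"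
  proof (rule local_lipschitz_compact_implies_lipschitz[of "{a..b}" ?K G])
    show "local_lipschitz {a..b} ?K G"
      unfolding G_def by (rule local_lipschitz_subset[OF local_lipschitz_gradient[OF H c] ab R])
    fix x assume x: "x \<in> ?K"
    have "continuous_on {a..b} (\<lambda>t. (\<lambda>(t, x). G t x) (t, x))"
      by (rule continuous_on_compose2[OF Gc]) (use x in \<open>auto intro!: continuous_intros\<close>)
    then show "continuous_on {a..b} (\<lambda>t. G t x)" by simp
  qed auto
  have "LG \<ge> 0" using LG[OF ts(1)] by (rule lipschitz_on_nonneg)
  have "bounded ((\<lambda>(t, x). G t x) ` ({a..b} \<times> ?K))"
    by (intro compact_imp_bounded compact_continuous_image Gc compact_Times) auto
  then obtain MG where MG: "\<And>t x. t \<in> {a..b} \<Longrightarrow> x \<in> ?K \<Longrightarrow> norm (G t x) \<le> MG"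
    unfolding bounded_iff by fastforce
  obtain LP where LP: "LP \<ge> 0" "\<And>x y. x \<in> ?K \<Longrightarrow> y \<in> ?K \<Longrightarrow> norm (sharp c x - sharp c y) \<le> LP * norm (x - y)"
    using C1_lipschitz[OF coordinate_system_B _ compact_cball convex_cball R, of "sharp c"] smooth_sharp[OF c]
    unfolding smooth_on_def by metis
  have "bounded (sharp c ` ?K)"
    using continuous_on_subset[OF smooth_on_imp_continuous_on[OF smooth_sharp[OF c]] R]
    by (intro compact_imp_bounded compact_continuous_image) auto
  then obtain MP where MP: "\<forall>x\<in>?K. norm (sharp c x) \<le> MP" by (auto simp: bounded_iff)
  define L where "L = LP * \<bar>MG\<bar> + \<bar>MP\<bar> * LG + 1"
  have "L > 0" using LP(1) \<open>LG \<ge> 0\<close> by (simp add: L_def add_nonneg_pos)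
  have lip: "norm (sharp c x (G t x) - sharp c y (G t y)) \<le> L * norm (x - y)"
    if "t \<in> {a..b}" "x \<in> ?K" "y \<in> ?K" for t x y
  proof -
    have "sharp c x (G t x) - sharp c y (G t y) = (sharp c x - sharp c y) (G t x) + sharp c y (G t x - G t y)"
      by (simp add: blinfun.bilinear_simps)
    also have "norm \<dots> \<le> norm (sharp c x - sharp c y) * norm (G t x) + norm (sharp c y) * norm (G t x - G t y)"
      by (intro norm_triangle_mono norm_blinfun)
    also have "\<dots> \<le> (LP * norm (x - y)) * \<bar>MG\<bar> + \<bar>MP\<bar> * (LG * norm (x - y))"
      using LP MG[OF that(1,2)] bspec[OF MP that(3)] lipschitz_onD[OF LG[OF that(1)] that(2,3)] that \<open>LG \<ge> 0\<close>
      by (intro add_mono mult_mono) (auto simp: dist_norm)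
    also have "\<dots> \<le> L * norm (x - y)" by (simp add: L_def algebra_simps)
    finally show ?thesis .
  qed
  define m where "m s p = chart_map c (\<Phi> s p)" for s p
  have curve: "ham_integral_curve A P H {0..1} (\<lambda>s. \<Phi> s p)" for p
    using flow by (simp add: ham_flow_def)
  have mc: "continuous_on {a..b} (\<lambda>s. m s p)" if "p \<in> N" for p
  proof -
    have "continuous_on {a..b} (\<lambda>s. \<Phi> s p)"
      using curve[of p] ab unfolding ham_integral_curve_def by (auto intro: continuous_on_subset)
    then show ?thesis
      unfolding m_def by (rule continuous_on_compose2[OF cont_map[OF c]]) (use dom that in auto)
  qed
  have md: "((\<lambda>s. m s p) has_vector_derivative sharp c (m s p) (G s (m s p))) (at s)"
    if "p \<in> N" "a < s" "s < b" for p s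
    unfolding m_def G_def
    using ab that dom[of s p]
    by (intro ham_integral_curve_in_chart[OF H curve c]) (auto simp: subset_iff intro: le_less_trans less_le_trans)
  define k where "k = 2 * L * (b - a) * exp (2 * L * (b - a)) + 1"
  have main: "norm (m s p - m s p') \<le> k * norm (m t p - m t p')" if p: "p \<in> N" "p' \<in> N" for p p'
  proof -
    define \<delta> where "\<delta> = norm (m t p - m t p')"
    \<comment> \<open>Subtracting the difference at time \<open>t\<close> makes the function vanish
      there, as Gronwall requires, at the price of the inhomogeneity
      \<open>L * \<delta>\<close>.\<close>
    have "norm ((m s p - m s p') - (m t p - m t p')) \<le> 2 * (L * \<delta>) * (b - a) * exp (2 * L * (b - a))"
    proof (rule gronwall[where e = "\<lambda>s. (m s p - m s p') - (m t p - m t p')" and ?t0.0 = t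
          and e' = "\<lambda>s. sharp c (m s p) (G s (m s p)) - sharp c (m s p') (G s (m s p'))"])
      show "L > 0" "0 \<le> L * \<delta>" using \<open>L > 0\<close> by (auto simp: \<delta>_def)
      show "continuous_on {a..b} (\<lambda>s. (m s p - m s p') - (m t p - m t p'))"
        by (intro continuous_intros mc p)
      fix r assume r: "a < r" "r < b"
      have "((\<lambda>s. (m s p - m s p') - (m t p - m t p')) has_vector_derivative
          (sharp c (m r p) (G r (m r p)) - sharp c (m r p') (G r (m r p'))) - 0) (at r)"
        by (intro has_vector_derivative_diff has_vector_derivative_const md p r)
      then show "((\<lambda>s. (m s p - m s p') - (m t p - m t p')) has_vector_derivative
          sharp c (m r p) (G r (m r p)) - sharp c (m r p') (G r (m r p'))) (at r)" by simp
      have "norm (sharp c (m r p) (G r (m r p)) - sharp c (m r p') (G r (m r p'))) \<le> L * norm (m r p - m r p')"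
        using dom[of r] p r by (intro lip) (auto simp: m_def)
      also have "\<dots> \<le> L * (norm ((m r p - m r p') - (m t p - m t p')) + \<delta>)"
        using \<open>L > 0\<close> norm_triangle_ineq[of "(m r p - m r p') - (m t p - m t p')" "m t p - m t p'"]
        by (intro mult_left_mono) (auto simp: \<delta>_def)
      finally show "norm (sharp c (m r p) (G r (m r p)) - sharp c (m r p') (G r (m r p')))
          \<le> L * norm ((m r p - m r p') - (m t p - m t p')) + L * \<delta>" by (simp add: algebra_simps)
    qed (use ts in auto)
    then have "norm (m s p - m s p') \<le> 2 * (L * \<delta>) * (b - a) * exp (2 * L * (b - a)) + \<delta>"
      using norm_triangle_ineq[of "(m s p - m s p') - (m t p - m t p')" "m t p - m t p'"] by (simp add: \<delta>_def)
    then show ?thesis by (simp add: k_def \<delta>_def algebra_simps)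
  qed
  have "continuous_on N (m t)"
    unfolding m_def[abs_def]
    by (rule continuous_on_compose2[OF cont_map[OF c] cont]) (use dom ts in auto)
  have "continuous_on N (m s)"
    unfolding continuous_on_def
  proof
    fix p assume p: "p \<in> N"
    have "((\<lambda>p'. m s p' - m s p) \<longlongrightarrow> 0) (at p within N)"
    proof (rule Lim_null_comparison)
      show "\<forall>\<^sub>F p' in at p within N. norm (m s p' - m s p) \<le> k * norm (m t p' - m t p)"
        unfolding eventually_at_filter using main p by (auto intro: always_eventually)
      have "(m t \<longlongrightarrow> m t p) (at p within N)"
        using \<open>continuous_on N (m t)\<close> p by (simp add: continuous_on_def)
      then have "((\<lambda>p'. k * norm (m t p' - m t p)) \<longlongrightarrow> k * norm (m t p - m t p)) (at p within N)"
        by (intro tendsto_mult tendsto_norm tendsto_diff tendsto_const)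
      then show "((\<lambda>p'. k * norm (m t p' - m t p)) \<longlongrightarrow> 0) (at p within N)" by simp
    qed
    then show "(m s \<longlongrightarrow> m s p) (at p within N)" by (simp add: Lim_null[of "m s" "m s p"])
  qed
  then have "continuous_on N (\<lambda>p. chart_inv c (m s p))"
    by (rule continuous_on_compose2[OF cont_inv[OF c]]) (use dom ts R in \<open>auto simp: m_def\<close>)
  then show ?thesis
    by (rule continuous_on_eq) (use dom ts in \<open>auto simp: m_def inv_map c\<close>)
qed

end

section \<open>The limit isotopy\<close>

locale hameotopy_limit = poisson_charts B A P
  for B :: "'e::{real_inner,banach,heine_borel} set"
    and A :: "('m::{t2_space,second_countable_topology}, 'e) chart set" and P +
  fixes \<phi> :: "real \<Rightarrow> 'm \<Rightarrow> 'm" and H :: "nat \<Rightarrow> real \<Rightarrow> 'm \<Rightarrow> real" and \<Phi> :: "nat \<Rightarrow> real \<Rightarrow> 'm \<Rightarrow> 'm" and g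
  assumes isotopy: "isotopy_of_homeomorphisms \<phi>"
    and smooth_H: "smooth_time_dependent A (H i)" and flow: "ham_flow A P (H i) (\<Phi> i)"
    and metric: "riemannian_metric A g"
    and conv: "C0_converges_unif (riemannian_dist A g) {0..1} \<Phi> \<phi>"
begin

lemma cont_\<phi>: "continuous_on ({0..1} \<times> UNIV) (\<lambda>(t, p). \<phi> t p)"
  using isotopy by (simp add: isotopy_of_homeomorphisms_def)

lemma cont_\<phi>_at:
  assumes "t \<in> {0..1}"
  shows "continuous_on UNIV (\<phi> t)"
proof -
  have "continuous_on UNIV (\<lambda>p. (\<lambda>(t, p). \<phi> t p) (t, p))"
    by (rule continuous_on_compose2[OF cont_\<phi>]) (use assms in \<open>auto intro!: continuous_intros\<close>)
  then show ?thesis by simp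
qed

text \<open>Continuity of the limit accounts for half of the radius, convergence on the compact
  neighbourhood \<open>K\<close> for the other half. One chart then serves all late flows at
  once.\<close>

lemma window:
  assumes t0: "t0 \<in> {0..1}" and c: "c \<in> A" "\<phi> t0 p \<in> chart_dom c"
    and "R > 0" and R: "cball (chart_map c (\<phi> t0 p)) R \<subseteq> chart_img c"
  obtains \<epsilon> N K I where "\<epsilon> > 0" "open N" "p \<in> N" "N \<subseteq> K" "compact K"
    "\<And>t p'. t \<in> {0..1} \<Longrightarrow> \<bar>t - t0\<bar> < \<epsilon> \<Longrightarrow> p' \<in> N \<Longrightarrow>
      \<phi> t p' \<in> chart_dom c \<and> chart_map c (\<phi> t p') \<in> ball (chart_map c (\<phi> t0 p)) (R / 2)"
    "\<And>i t p'. i \<ge> I \<Longrightarrow> t \<in> {0..1} \<Longrightarrow> \<bar>t - t0\<bar> < \<epsilon> \<Longrightarrow> p' \<in> N \<Longrightarrow>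
      \<Phi> i t p' \<in> chart_dom c \<and> chart_map c (\<Phi> i t p') \<in> cball (chart_map c (\<phi> t0 p)) R"
proof -
  let ?x0 = "chart_map c (\<phi> t0 p)"
  define D where "D = {p' \<in> chart_dom c. chart_map c p' \<in> ball ?x0 (R / 2)}"
  have "open D" unfolding D_def by (rule open_chart_preimage[OF c(1) open_ball])
  obtain K N1 where K: "compact K" "open N1" "p \<in> N1" "N1 \<subseteq> K" by (rule compact_neighbourhood)
  obtain W where W: "open W" "W \<inter> ({0..1} \<times> UNIV) = (\<lambda>(t, p). \<phi> t p) -` D \<inter> ({0..1} \<times> UNIV)"
    using cont_\<phi> \<open>open D\<close> unfolding continuous_on_open_invariant by blast
  have "(t0, p) \<in> W" using W(2) t0 c \<open>R > 0\<close> by (auto simp: D_def)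
  then obtain T N2 where TN: "open T" "open N2" "t0 \<in> T" "p \<in> N2" "T \<times> N2 \<subseteq> W"
    using open_prod_elim[OF W(1)] by (metis mem_Sigma_iff)
  obtain \<epsilon> where \<epsilon>: "\<epsilon> > 0" "ball t0 \<epsilon> \<subseteq> T" using TN(1,3) open_contains_ball by blast
  have inD: "\<phi> t p' \<in> D" if "t \<in> {0..1}" "\<bar>t - t0\<bar> < \<epsilon>" "p' \<in> N2" for t p'
  proof -
    have "(t, p') \<in> T \<times> N2" using that \<epsilon>(2) by (auto simp: dist_real_def abs_minus_commute subset_iff)
    then have "(t, p') \<in> W \<inter> ({0..1} \<times> UNIV)" using TN(5) that(1) by auto
    then show ?thesis using W(2) by auto
  qed
  obtain I where I: "\<And>i t p. \<lbrakk>i \<ge> I; t \<in> {0..1}; p \<in> K; \<phi> t p \<in> chart_dom c; chart_map c (\<phi> t p) \<in> cball ?x0 (R / 2)\<rbrakk>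
    \<Longrightarrow> \<Phi> i t p \<in> chart_dom c \<and> norm (chart_map c (\<Phi> i t p) - chart_map c (\<phi> t p)) \<le> R / 2"
    using C0_convergence_in_chart[OF metric conv c(1) \<open>R > 0\<close> R K(1), of "R / 2"] \<open>R > 0\<close> by auto
  show ?thesis
  proof (rule that[of \<epsilon> "N1 \<inter> N2" K I])
    fix i t p' assume *: "i \<ge> I" "t \<in> {0..1}" "\<bar>t - t0\<bar> < \<epsilon>" "p' \<in> N1 \<inter> N2"
    have "\<phi> t p' \<in> D" using * by (intro inD) auto
    then have d: "\<phi> t p' \<in> chart_dom c" "dist ?x0 (chart_map c (\<phi> t p')) < R / 2" by (auto simp: D_def)
    then have **: "\<Phi> i t p' \<in> chart_dom c" "norm (chart_map c (\<Phi> i t p') - chart_map c (\<phi> t p')) \<le> R / 2"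
      using I[of i t p'] * K(4) by auto
    have "dist ?x0 (chart_map c (\<Phi> i t p')) \<le> R / 2 + R / 2"
      using dist_triangle[of ?x0 "chart_map c (\<Phi> i t p')" "chart_map c (\<phi> t p')"] d(2) **(2)
      by (simp add: dist_norm norm_minus_commute)
    with ** show "\<Phi> i t p' \<in> chart_dom c \<and> chart_map c (\<Phi> i t p') \<in> cball ?x0 R" by simp
  next
    fix t p' assume "t \<in> {0..1}" "\<bar>t - t0\<bar> < \<epsilon>" "p' \<in> N1 \<inter> N2"
    then show "\<phi> t p' \<in> chart_dom c \<and> chart_map c (\<phi> t p') \<in> ball ?x0 (R / 2)"
      using inD by (auto simp: D_def)
  qed (use \<epsilon>(1) K TN in auto)
qed

lemma chart_around:
  obtains c R where "c \<in> A" "p \<in> chart_dom c" "R > 0" "cball (chart_map c p) R \<subseteq> chart_img c"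
proof -
  obtain c where c: "c \<in> A" "p \<in> chart_dom c" by (rule chart_exists)
  then obtain R where "R > 0" "cball (chart_map c p) R \<subseteq> chart_img c"
    using open_img[OF c(1)] open_contains_cball by blast
  with c show ?thesis using that by blast
qed

lemma openin_window: "openin (top_of_set {0..1}) {t \<in> {0..1}. \<bar>t - t0\<bar> < \<epsilon>}" for t0 \<epsilon> :: real
proof -
  have "{t \<in> {0..1}. \<bar>t - t0\<bar> < \<epsilon>} = {0..1} \<inter> ball t0 \<epsilon>" by (auto simp: dist_real_def abs_minus_commute)
  then show ?thesis by (simp add: openin_open_Int)
qed

text \<open>For large \<open>i\<close> the flows near \<open>p\<close> stay in charts that do not depend on \<open>i\<close>, by \<open>C\<^sup>0\<close> convergence.\<close>

lemma flows_eventually_continuous: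
  assumes "t \<in> {0..1}"
  shows "\<exists>N I. open N \<and> p \<in> N \<and> (\<forall>i\<ge>I. continuous_on N (\<Phi> i t))"
proof -
  define C where "C t \<longleftrightarrow> (\<exists>N I. open N \<and> p \<in> N \<and> (\<forall>i\<ge>I. continuous_on N (\<Phi> i t)))" for t
  have "C t"
  proof (rule connected_induction_simple[of "{0..1::real}" 0 t])
    have "continuous_on UNIV (\<Phi> i 0)" for i
      using flow[of i] by (intro continuous_on_eq[OF continuous_on_id]) (auto simp: ham_flow_def)
    then show "C 0"
      unfolding C_def by (intro exI[of _ UNIV] exI[of _ 0]) auto
  next
    fix t0 :: real assume t0: "t0 \<in> {0..1}"
    obtain c R where c: "c \<in> A" "\<phi> t0 p \<in> chart_dom c" "R > 0" "cball (chart_map c (\<phi> t0 p)) R \<subseteq> chart_img c"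
      by (rule chart_around)
    obtain \<epsilon> N K I where w: "\<epsilon> > 0" "open N" "p \<in> N" "N \<subseteq> K" "compact K"
      "\<And>i t p'. i \<ge> I \<Longrightarrow> t \<in> {0..1} \<Longrightarrow> \<bar>t - t0\<bar> < \<epsilon> \<Longrightarrow> p' \<in> N \<Longrightarrow>
        \<Phi> i t p' \<in> chart_dom c \<and> chart_map c (\<Phi> i t p') \<in> cball (chart_map c (\<phi> t0 p)) R"
      using window[OF t0 c] by metis
    \<comment> \<open>Between two times in the window the orbits stay in one chart ball, so
      continuity passes from either time to the other; connectedness of \<open>[0,1]\<close> then
      carries it from time 0 to \<open>t\<close>.\<close>
    have step: "C y"
      if xy: "x \<in> {0..1}" "\<bar>x - t0\<bar> < \<epsilon>" "y \<in> {0..1}" "\<bar>y - t0\<bar> < \<epsilon>"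
        and ex: "C x" for x y
    proof -
      obtain N' I' where N': "open N'" "p \<in> N'" "\<And>i. i \<ge> I' \<Longrightarrow> continuous_on N' (\<Phi> i x)" using ex unfolding C_def by blast
      have "continuous_on (N \<inter> N') (\<Phi> i y)" if i: "i \<ge> max I I'" for i
      proof (rule continuous_flow_in_chart[OF smooth_H flow c(1,4), of "min x y" "max x y" "N \<inter> N'" _ x])
        show "continuous_on (N \<inter> N') (\<Phi> i x)" using N'(3)[of i] i by (auto intro: continuous_on_subset)
        fix s p' assume s: "s \<in> {min x y..max x y}" and p': "p' \<in> N \<inter> N'"
        have "s \<in> {0..1}" "\<bar>s - t0\<bar> < \<epsilon>" using s xy by (auto simp: min_def max_def split: if_splits)
        then show "\<Phi> i s p' \<in> chart_dom c \<and> chart_map c (\<Phi> i s p') \<in> cball (chart_map c (\<phi> t0 p)) R"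
          using p' i by (intro w(6)) auto
      qed (use xy in auto)
      then show ?thesis unfolding C_def using w N' by (intro exI[of _ "N \<inter> N'"] exI[of _ "max I I'"]) auto
    qed
    show "\<exists>T. openin (top_of_set {0..1}) T \<and> t0 \<in> T \<and> (\<forall>x\<in>T. \<forall>y\<in>T. C x \<longrightarrow> C y)"
    proof (intro exI[of _ "{t \<in> {0..1}. \<bar>t - t0\<bar> < \<epsilon>}"] conjI ballI impI openin_window)
      show "t0 \<in> {t \<in> {0..1}. \<bar>t - t0\<bar> < \<epsilon>}" using t0 w(1) by simp
    next
      fix x y assume "x \<in> {t \<in> {0..1}. \<bar>t - t0\<bar> < \<epsilon>}" "y \<in> {t \<in> {0..1}. \<bar>t - t0\<bar> < \<epsilon>}" "C x"
      then show "C y" by (intro step[of x y]) auto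
    qed
  qed (use assms in auto)
  then show ?thesis by (simp add: C_def)
qed

text \<open>\<open>\<Phi> i t0 \<circ> (\<phi> t0)\<inverse>\<close> is continuous and close to the identity near \<open>\<phi> t0 p\<close>, hence
  covers this point by the Poincare--Miranda theorem.\<close>

lemma flows_eventually_hit:
  assumes t0: "t0 \<in> {0..1}" and N': "open N'" "p \<in> N'"
  shows "\<exists>I. \<forall>i\<ge>I. \<exists>p'\<in>N'. \<Phi> i t0 p' = \<phi> t0 p"
proof -
  obtain \<psi> where \<psi>: "homeomorphism UNIV UNIV (\<phi> t0) \<psi>"
    using isotopy t0 unfolding isotopy_of_homeomorphisms_def by blast
  have \<psi>c: "continuous_on UNIV \<psi>" and \<psi>1: "\<psi> (\<phi> t0 x) = x" and \<psi>2: "\<phi> t0 (\<psi> x) = x" for x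
    using \<psi> by (auto simp: homeomorphism_def)
  obtain c R where c: "c \<in> A" "\<phi> t0 p \<in> chart_dom c" and "R > 0" and R: "cball (chart_map c (\<phi> t0 p)) R \<subseteq> chart_img c"
    by (rule chart_around)
  define q where "q = chart_map c (\<phi> t0 p)"
  obtain N1 I1 where N1: "open N1" "p \<in> N1" "\<And>i. i \<ge> I1 \<Longrightarrow> continuous_on N1 (\<Phi> i t0)"
    using flows_eventually_continuous[OF t0] by blast
  obtain K N2 where K: "compact K" "open N2" "p \<in> N2" "N2 \<subseteq> K" by (rule compact_neighbourhood)
  define N where "N = N1 \<inter> N2 \<inter> N'"
  have "open N" "p \<in> N" using N1 K N' by (auto simp: N_def)
  \<comment> \<open>The inverse of \<open>\<phi> t0\<close>, read in the chart at its
    target.\<close>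
  define f where "f x = \<psi> (chart_inv c x)" for x
  have fc: "continuous_on (chart_img c) f"
    unfolding f_def by (rule continuous_on_compose2[OF \<psi>c cont_inv[OF c(1)]]) auto
  have "open (f -` N \<inter> chart_img c)"
    using fc open_img[OF c(1)] \<open>open N\<close> by (simp add: continuous_on_open_vimage)
  moreover have "q \<in> f -` N \<inter> chart_img c"
    using c \<open>p \<in> N\<close> by (simp add: f_def q_def inv_map \<psi>1)
  ultimately obtain d where d: "d > 0" "ball q d \<subseteq> f -` N \<inter> chart_img c"
    using open_contains_ball by blast
  define \<delta> where "\<delta> = min (d / 2) (R / 2)"
  have "\<delta> > 0" using d \<open>R > 0\<close> by (simp add: \<delta>_def)
  \<comment> \<open>The cube of half side \<open>r\<close> lies within distance
    \<open>card B * r < \<delta>\<close> of \<open>q\<close>; the summand 1 covers an empty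
    \<open>B\<close>.\<close>
  define r where "r = \<delta> / (card B + 1)"
  have "r > 0" using \<open>\<delta> > 0\<close> by (simp add: r_def)
  define Q where "Q = {x. \<forall>b\<in>B. \<bar>(x - q) \<bullet> b\<bar> \<le> r}"
  have Q\<delta>: "Q \<subseteq> cball q \<delta>"
  proof
    fix x assume x: "x \<in> Q"
    have "norm (x - q) \<le> (\<Sum>b\<in>B. \<bar>(x - q) \<bullet> b\<bar>)" by (rule norm_le_coords)
    also have "\<dots> \<le> card B * r"
      using sum_bounded_above[of B "\<lambda>b. \<bar>(x - q) \<bullet> b\<bar>" r] x by (simp add: Q_def)
    also have "\<dots> \<le> (card B + 1) * r" using \<open>r > 0\<close> by simp
    also have "\<dots> = \<delta>" by (simp add: r_def)
    finally show "x \<in> cball q \<delta>" by (simp add: dist_norm norm_minus_commute)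
  qed
  have QN: "x \<in> chart_img c" "f x \<in> N" "x \<in> cball q (R / 2)" if "x \<in> Q" for x
    using subsetD[OF Q\<delta> that] d by (auto simp: \<delta>_def subset_iff)
  have "closed Q"
  proof -
    have "Q = (\<Inter>b\<in>B. {x. \<bar>(x - q) \<bullet> b\<bar> \<le> r})" by (auto simp: Q_def)
    then show ?thesis by (auto intro!: closed_INT closed_Collect_le continuous_intros)
  qed
  then have "compact Q"
    using Q\<delta> bounded_subset[OF bounded_cball] by (auto simp: compact_eq_bounded_closed)
  obtain I2 where I2: "\<And>i t p. \<lbrakk>i \<ge> I2; t \<in> {0..1}; p \<in> K; \<phi> t p \<in> chart_dom c; chart_map c (\<phi> t p) \<in> cball q (R / 2)\<rbrakk>
    \<Longrightarrow> \<Phi> i t p \<in> chart_dom c \<and> norm (chart_map c (\<Phi> i t p) - chart_map c (\<phi> t p)) \<le> r / 2"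
    using C0_convergence_in_chart[OF metric conv c(1) \<open>R > 0\<close> R K(1), of "r / 2"] \<open>r > 0\<close> unfolding q_def by auto
  have "\<exists>p'\<in>N'. \<Phi> i t0 p' = \<phi> t0 p" if i: "i \<ge> max I1 I2" for i
  proof -
    \<comment> \<open>\<open>m\<close> is \<open>\<Phi> i t0\<close> after the inverse of
      \<open>\<phi> t0\<close>, in coordinates. It moves points of the cube by at most
      \<open>r / 2\<close>, so on each face \<open>m x - q\<close> keeps the sign of
      \<open>x - q\<close> in the normal direction.\<close>
    define m where "m x = chart_map c (\<Phi> i t0 (f x))" for x
    have close: "\<Phi> i t0 (f x) \<in> chart_dom c" "norm (m x - x) \<le> r / 2" if "x \<in> Q" for x
    proof -
      have "\<phi> t0 (f x) = chart_inv c x" by (simp add: f_def \<psi>2)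
      then have "\<phi> t0 (f x) \<in> chart_dom c" "chart_map c (\<phi> t0 (f x)) = x"
        using inv_dom[OF c(1)] map_inv[OF c(1)] QN(1)[OF that] by auto
      then show "\<Phi> i t0 (f x) \<in> chart_dom c" "norm (m x - x) \<le> r / 2"
        using I2[of i t0 "f x"] i t0 QN[OF that] K(4) by (auto simp: N_def m_def)
    qed
    have coord: "\<bar>(m x - x) \<bullet> b\<bar> \<le> r / 2" if "x \<in> Q" "b \<in> B" for x b
      using close(2)[OF that(1)] inner_B_le_norm[OF that(2), of "m x - x"] by linarith
    have split: "(m x - q) \<bullet> b = (m x - x) \<bullet> b + (x - q) \<bullet> b" for x b
      by (simp add: inner_diff_left)
    obtain x where x: "x \<in> Q" "m x - q = 0"
    proof (rule poincare_miranda[of r q "\<lambda>x. m x - q", folded Q_def])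
      show "r > 0" by fact
      show "compact Q" by fact
      have "continuous_on N1 (\<Phi> i t0)" using N1(3) i by simp
      then have "continuous_on Q (\<lambda>x. \<Phi> i t0 (f x))"
        by (rule continuous_on_compose2[OF _ continuous_on_subset[OF fc]]) (use QN in \<open>auto simp: N_def\<close>)
      then have "continuous_on Q m"
        unfolding m_def[abs_def] by (rule continuous_on_compose2[OF cont_map[OF c(1)]]) (use close in auto)
      then show "continuous_on Q (\<lambda>x. m x - q)" by (intro continuous_intros)
      show "(m x - q) \<bullet> b > 0" if "x \<in> Q" "b \<in> B" "(x - q) \<bullet> b = r" for x b
        using coord[OF that(1,2)] that(3) \<open>r > 0\<close> unfolding split by linarith
      show "(m x - q) \<bullet> b < 0" if "x \<in> Q" "b \<in> B" "(x - q) \<bullet> b = - r" for x b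
        using coord[OF that(1,2)] that(3) \<open>r > 0\<close> unfolding split by linarith
    next
      fix x assume "x \<in> Q" "m x - q = 0"
      then show thesis by (rule that)
    qed
    have "\<Phi> i t0 (f x) = chart_inv c (m x)" using close(1)[OF x(1)] by (simp add: m_def inv_map c)
    also have "\<dots> = \<phi> t0 p" using x(2) c by (simp add: q_def inv_map)
    finally show ?thesis using QN(2)[OF x(1)] by (auto simp: N_def)
  qed
  then show ?thesis by blast
qed

lemma limit_in_leaf_locally:
  assumes t0: "t0 \<in> {0..1}"
  obtains \<epsilon> where "\<epsilon> > 0" "\<And>s. s \<in> {0..1} \<Longrightarrow> \<bar>s - t0\<bar> < \<epsilon> \<Longrightarrow>
    ham_reachable A P (\<phi> t0 p) (\<phi> s p) \<and> ham_reachable A P (\<phi> s p) (\<phi> t0 p)"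
proof -
  obtain c where c: "c \<in> A" "\<phi> t0 p \<in> chart_dom c" by (rule chart_exists)
  let ?q = "chart_map c (\<phi> t0 p)"
  obtain r G where G: "0 < r" "cball ?q r \<subseteq> chart_img c" "closed G"
    and stay: "\<And>a b t0' \<gamma> H t. \<lbrakk>smooth_time_dependent A H; ham_integral_curve A P H {0..1} \<gamma>; {a..b} \<subseteq> {0..1};
        t0' \<in> {a..b}; \<gamma> t0' = \<phi> t0 p; \<forall>t\<in>{a..b}. \<gamma> t \<in> chart_dom c \<and> chart_map c (\<gamma> t) \<in> cball ?q r;
        t \<in> {a..b}\<rbrakk> \<Longrightarrow> chart_map c (\<gamma> t) \<in> G"
    and reach: "\<And>x. x \<in> G \<Longrightarrow> ham_reachable A P (\<phi> t0 p) (chart_inv c x) \<and> ham_reachable A P (chart_inv c x) (\<phi> t0 p)"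
    by (rule leaf_locally_closed[OF c]) (rule that)
  obtain \<epsilon> N K I where w: "\<epsilon> > 0" "open N" "p \<in> N" "N \<subseteq> K" "compact K"
    and w\<phi>: "\<And>t p'. t \<in> {0..1} \<Longrightarrow> \<bar>t - t0\<bar> < \<epsilon> \<Longrightarrow> p' \<in> N \<Longrightarrow>
      \<phi> t p' \<in> chart_dom c \<and> chart_map c (\<phi> t p') \<in> ball ?q (r / 2)"
    and w\<Phi>: "\<And>i t p'. i \<ge> I \<Longrightarrow> t \<in> {0..1} \<Longrightarrow> \<bar>t - t0\<bar> < \<epsilon> \<Longrightarrow> p' \<in> N \<Longrightarrow>
      \<Phi> i t p' \<in> chart_dom c \<and> chart_map c (\<Phi> i t p') \<in> cball ?q r"
    by (rule window[OF t0 c G(1,2)]) (rule that)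
  have "chart_map c (\<phi> s p) \<in> G" if s: "s \<in> {0..1}" "\<bar>s - t0\<bar> < \<epsilon>" for s
  proof -
    have "\<exists>z\<in>G. dist z (chart_map c (\<phi> s p)) < \<eta>" if "\<eta> > 0" for \<eta>
    proof -
      \<comment> \<open>The hitting point \<open>p'\<close> is sought here so that
        \<open>\<phi> s p'\<close> is within \<open>\<eta> / 2\<close> of \<open>\<phi> s p\<close>;
        convergence at \<open>p'\<close> contributes another \<open>\<eta> / 4\<close>.\<close>
      define N' where "N' = N \<inter> \<phi> s -` {p' \<in> chart_dom c. chart_map c p' \<in> ball (chart_map c (\<phi> s p)) (\<eta> / 2)}"
      have "open N'"
        unfolding N'_def
        by (intro open_Int w(2) open_vimage open_chart_preimage[OF c(1) open_ball] cont_\<phi>_at s)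
      moreover have "p \<in> N'" using w\<phi>[OF s w(3)] w(3) \<open>\<eta> > 0\<close> by (simp add: N'_def)
      ultimately obtain I1 where I1: "\<And>i. i \<ge> I1 \<Longrightarrow> \<exists>p'\<in>N'. \<Phi> i t0 p' = \<phi> t0 p"
        using flows_eventually_hit[OF t0] by blast
      obtain I2 where I2: "\<And>i t p. \<lbrakk>i \<ge> I2; t \<in> {0..1}; p \<in> K; \<phi> t p \<in> chart_dom c; chart_map c (\<phi> t p) \<in> cball ?q (r / 2)\<rbrakk>
        \<Longrightarrow> \<Phi> i t p \<in> chart_dom c \<and> norm (chart_map c (\<Phi> i t p) - chart_map c (\<phi> t p)) \<le> \<eta> / 4"
        using C0_convergence_in_chart[OF metric conv c(1) G(1,2) w(5), of "\<eta> / 4"] \<open>\<eta> > 0\<close> by auto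
      define i where "i = max I (max I1 I2)"
      have "i \<ge> I1" by (simp add: i_def)
      then obtain p' where p': "p' \<in> N'" "\<Phi> i t0 p' = \<phi> t0 p" using I1 by blast
      have "p' \<in> N" using p' by (simp add: N'_def)
      have "chart_map c (\<Phi> i s p') \<in> G"
      proof (rule stay[OF smooth_H, of i "\<lambda>s. \<Phi> i s p'" "min t0 s" "max t0 s" t0])
        show "ham_integral_curve A P (H i) {0..1} (\<lambda>s. \<Phi> i s p')" using flow[of i] by (simp add: ham_flow_def)
        show "\<forall>t\<in>{min t0 s..max t0 s}. \<Phi> i t p' \<in> chart_dom c \<and> chart_map c (\<Phi> i t p') \<in> cball ?q r"
        proof
          fix t assume "t \<in> {min t0 s..max t0 s}"
          then have "t \<in> {0..1}" "\<bar>t - t0\<bar> < \<epsilon>" using s t0 \<open>\<epsilon> > 0\<close> by (auto simp: min_def max_def split: if_splits)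
          then show "\<Phi> i t p' \<in> chart_dom c \<and> chart_map c (\<Phi> i t p') \<in> cball ?q r"
            using \<open>p' \<in> N\<close> by (intro w\<Phi>) (auto simp: i_def)
        qed
      qed (use s t0 p' in auto)
      moreover have "dist (chart_map c (\<Phi> i s p')) (chart_map c (\<phi> s p)) < \<eta>"
      proof -
        have "norm (chart_map c (\<Phi> i s p') - chart_map c (\<phi> s p')) \<le> \<eta> / 4"
          using w\<phi>[OF s \<open>p' \<in> N\<close>] w(4) \<open>p' \<in> N\<close> s I2[of i s p'] by (auto simp: i_def)
        moreover have "dist (chart_map c (\<phi> s p)) (chart_map c (\<phi> s p')) < \<eta> / 2" using p' by (simp add: N'_def)
        ultimately show ?thesis
          using dist_triangle[of "chart_map c (\<Phi> i s p')" "chart_map c (\<phi> s p)" "chart_map c (\<phi> s p')"] \<open>\<eta> > 0\<close>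
          by (simp add: dist_norm norm_minus_commute)
      qed
      ultimately show ?thesis by blast
    qed
    then have "chart_map c (\<phi> s p) \<in> closure G" by (simp add: closure_approachable)
    then show ?thesis using G(3) by simp
  qed
  moreover have "chart_inv c (chart_map c (\<phi> s p)) = \<phi> s p" if "s \<in> {0..1}" "\<bar>s - t0\<bar> < \<epsilon>" for s
    using w\<phi>[OF that w(3)] by (simp add: inv_map c)
  ultimately show ?thesis using that[of \<epsilon>] w(1) reach by metis
qed

text \<open>An isotopy need not start at the identity by definition. Here it does, because all
  \<open>\<Phi> i 0\<close> are the identity and points with arbitrarily small coordinate distance
  are equal.\<close>

lemma \<phi>_0: "\<phi> 0 p = p"
proof -
  obtain c R where c: "c \<in> A" "\<phi> 0 p \<in> chart_dom c" "R > 0" "cball (chart_map c (\<phi> 0 p)) R \<subseteq> chart_img c"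
    by (rule chart_around)
  have \<Phi>0: "\<Phi> i 0 p = p" for i using flow[of i] by (simp add: ham_flow_def)
  have *: "p \<in> chart_dom c \<and> norm (chart_map c p - chart_map c (\<phi> 0 p)) \<le> \<rho>" if \<rho>: "\<rho> > 0" for \<rho>
  proof -
    obtain I where "\<And>i t p'. \<lbrakk>i \<ge> I; t \<in> {0..1}; p' \<in> {p}; \<phi> t p' \<in> chart_dom c; chart_map c (\<phi> t p') \<in> cball (chart_map c (\<phi> 0 p)) (R / 2)\<rbrakk>
      \<Longrightarrow> \<Phi> i t p' \<in> chart_dom c \<and> norm (chart_map c (\<Phi> i t p') - chart_map c (\<phi> t p')) \<le> \<rho>"
      using C0_convergence_in_chart[OF metric conv c(1,3,4) _ \<rho>, of "{p}"] by auto
    from this[of I 0 p] show ?thesis using c \<Phi>0 by simp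
  qed
  have "norm (chart_map c p - chart_map c (\<phi> 0 p)) \<le> 0"
    by (rule field_le_epsilon) (use * in simp)
  then have "chart_map c p = chart_map c (\<phi> 0 p)" by simp
  then show ?thesis using *[of 1] c inv_map[OF c(1)] by (metis zero_less_one)
qed

text \<open>Any two times near \<open>t0\<close> are linked through \<open>\<phi> t0 p\<close>,
  which takes reachability to and from this point; connectedness of \<open>[0,1]\<close> makes the
  local statement global.\<close>

lemma limit_in_leaf:
  assumes "t \<in> {0..1}"
  shows "(ham_reachable A P)\<^sup>*\<^sup>* p (\<phi> t p) \<and> (ham_reachable A P)\<^sup>*\<^sup>* (\<phi> t p) p"
proof -
  define C where "C t \<longleftrightarrow> (ham_reachable A P)\<^sup>*\<^sup>* p (\<phi> t p) \<and> (ham_reachable A P)\<^sup>*\<^sup>* (\<phi> t p) p" for t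
  have "C t"
  proof (rule connected_induction_simple[of "{0..1::real}" 0 t])
    show "C 0" by (simp add: C_def \<phi>_0)
  next
    fix t0 :: real assume t0: "t0 \<in> {0..1}"
    obtain \<epsilon> where \<epsilon>: "\<epsilon> > 0" "\<And>s. s \<in> {0..1} \<Longrightarrow> \<bar>s - t0\<bar> < \<epsilon> \<Longrightarrow>
      ham_reachable A P (\<phi> t0 p) (\<phi> s p) \<and> ham_reachable A P (\<phi> s p) (\<phi> t0 p)"
      by (rule limit_in_leaf_locally[OF t0]) (rule that)
    have step: "C y" if "x \<in> {0..1}" "\<bar>x - t0\<bar> < \<epsilon>" "y \<in> {0..1}" "\<bar>y - t0\<bar> < \<epsilon>" "C x" for x y
      using \<epsilon>(2)[OF that(1,2)] \<epsilon>(2)[OF that(3,4)] that(5) unfolding C_def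
      by (meson converse_rtranclp_into_rtranclp rtranclp.rtrancl_into_rtrancl)
    show "\<exists>T. openin (top_of_set {0..1}) T \<and> t0 \<in> T \<and> (\<forall>x\<in>T. \<forall>y\<in>T. C x \<longrightarrow> C y)"
    proof (intro exI[of _ "{t \<in> {0..1}. \<bar>t - t0\<bar> < \<epsilon>}"] conjI ballI impI openin_window)
      show "t0 \<in> {t \<in> {0..1}. \<bar>t - t0\<bar> < \<epsilon>}" using t0 \<epsilon>(1) by simp
    next
      fix x y assume "x \<in> {t \<in> {0..1}. \<bar>t - t0\<bar> < \<epsilon>}" "y \<in> {t \<in> {0..1}. \<bar>t - t0\<bar> < \<epsilon>}" "C x"
      then show "C y" by (intro step[of x y]) auto
    qed
  qed (use assms in auto)
  then show ?thesis by (simp add: C_def)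
qed

end

theorem corollary3p14:
  fixes A :: "('m::{t2_space,second_countable_topology},
               'e::{real_inner,banach,heine_borel}) chart set"
    and P :: "('m, 'e) bivector"
    and \<phi> :: "'m \<Rightarrow> 'm"
  assumes "poisson_manifold A P"
    and "hameomorphism A P \<phi>"
  shows "\<forall>p. \<phi> ` symplectic_leaf A P p = symplectic_leaf A P p"
proof -
  obtain B0 :: "'e set" where "finite B0" "span B0 = UNIV"
    using assms(1) unfolding poisson_manifold_def smooth_atlas_def by blast
  then obtain B :: "'e set" where B: "finite B" "\<And>a b. a \<in> B \<Longrightarrow> b \<in> B \<Longrightarrow> a \<bullet> b = (if a = b then 1 else 0)"
    "span B = UNIV"
    by (metis orthonormal_basis_of_span)
  obtain \<phi>t where \<phi>t: "hameotopy A P \<phi>t" "\<phi> = \<phi>t 1"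
    using assms(2) unfolding hameomorphism_def by blast
  then obtain H \<Phi> g where "isotopy_of_homeomorphisms \<phi>t"
    "\<And>i. smooth_time_dependent A (H i)" "\<And>i. ham_flow A P (H i) (\<Phi> i)"
    "riemannian_metric A g" "C0_converges_unif (riemannian_dist A g) {0..1} \<Phi> \<phi>t"
    unfolding hameotopy_def by blast
  then interpret hameotopy_limit B A P \<phi>t H \<Phi> g
    using B assms(1) by unfold_locales auto
  have leaf: "(ham_reachable A P)\<^sup>*\<^sup>* x (\<phi> x) \<and> (ham_reachable A P)\<^sup>*\<^sup>* (\<phi> x) x" for x
    using limit_in_leaf[of 1 x] by (simp add: \<phi>t(2))
  obtain \<psi> where \<psi>: "\<And>y. \<phi> (\<psi> y) = y"
    using isotopy unfolding isotopy_of_homeomorphisms_def homeomorphism_def \<phi>t(2) by fastforce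
  show ?thesis
  proof (intro allI equalityI subsetI)
    fix p y assume "y \<in> \<phi> ` symplectic_leaf A P p"
    then obtain x where "(ham_reachable A P)\<^sup>*\<^sup>* p x" "y = \<phi> x" by (auto simp: symplectic_leaf_def)
    then show "y \<in> symplectic_leaf A P p"
      using leaf[of x] by (auto simp: symplectic_leaf_def intro: rtranclp_trans)
  next
    fix p y assume "y \<in> symplectic_leaf A P p"
    \<comment> \<open>Here the way back is needed: \<open>y = \<phi> (\<psi> y)\<close> leads to its
      preimage \<open>\<psi> y\<close>, which therefore lies on the same leaf.\<close>
    then have "(ham_reachable A P)\<^sup>*\<^sup>* p (\<psi> y)"
      using leaf[of "\<psi> y"] \<psi>[of y] by (auto simp: symplectic_leaf_def intro: rtranclp_trans)
    then show "y \<in> \<phi> ` symplectic_leaf A P p"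
      using \<psi>[of y] by (auto simp: symplectic_leaf_def intro: image_eqI[of _ _ "\<psi> y"])
  qed
qed

end
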